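(* Let $\Lambda$ be a compact connected topological space, $d\in\mathbb{N}$, and let $A:\Lambda\times\mathbb{R}\to\mathrm{Mat}(d,\mathbb{R})$ be continuous such that each $A_\lambda:=A(\lambda,\cdot)$ is bounded and uniformly continuous. Let $L=\{L_\lambda\}_{\lambda\in\Lambda}$ be the family of operators $L_\lambda:H^1(\mathbb{R},\mathbb{R}^d)\to L^2(\mathbb{R},\mathbb{R}^d)$, $(L_\lambda x)(t)=\dot x(t)-A_\lambda(t)x(t)$. Assume: (A1) for each $\lambda\in\Lambda$ the equation $\dot x=A_\lambda(t)x$ admits an exponential dichotomy on $[0,\infty)$ and on $(-\infty,0]$ with invariant projectors $P^+_\lambda$ and $P^-_\lambda$, respectively, such that $\lambda\mapsto P^+_\lambda(\tau)$ and $\lambda\mapsto P^-_\lambda(-\tau)$ are continuous on $\Lambda$ for every $\tau\ge 0$; (A2) there is a closed subspace $\emptyset\neq\Lambda_0\subset\Lambda$ such that for each $\lambda\in\Lambda_0$ the equation $\dot x=A_\lambda(t)x$ has an exponential dichotomy on $\mathbb{R}$. Then $$\operatorname{ind}(L)=[E^u(0)\oplus E^s(0),\Theta(\mathbb{R}^d),\mathcal{L}]\in \mathrm{KO}(\Lambda,\Lambda_0),$$ where the bundle homomorphism $\mathcal{L}:E^u(0)\oplus E^s(0)\to\Theta(\mathbb{R}^d)$ is defined by $\mathcal{L}(\lambda,u,v)=(\lambda,u-v)$.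
   Context: Exponential dichotomy. For $\dot x=A(t)x$ with transition matrix $\Phi(t,s)\in\mathrm{GL}(d,\mathbb{R})$ ($t\mapsto\Phi(t,s)$ solves the equation and $\Phi(s,s)=I_d$) and an unbounded interval $\mathbb{I}\subset\mathbb{R}$, an invariant projector on $\mathbb{I}$ is a family $P:\mathbb{I}\to\mathrm{Mat}(d,\mathbb{R})$ with $P(t)^2=P(t)$ and $\Phi(t,s)P(s)=P(t)\Phi(t,s)$ for all $t,s\in\mathbb{I}$. The equation has an exponential dichotomy on $\mathbb{I}$ if there are an invariant projector $P$ and $K\ge1$, $\alpha>0$ with $\|\Phi(t,s)P(s)\|\le Ke^{-\alpha(t-s)}$ and $\|\Phi(s,t)(I_d-P(t))\|\le Ke^{-\alpha(t-s)}$ for all $t\ge s$ in $\mathbb{I}$. Stable/unstable spaces. With $\Phi_\lambda$ the transition matrix of $\dot x=A_\lambda(t)x$, put $E^s_\lambda(0)=\{x\in\mathbb{R}^d:\Phi_\lambda(t,0)x\to0,\ t\to\infty\}$ (the range of $P^+_\lambda(0)$) and $E^u_\lambda(0)=\{x\in\mathbb{R}^d:\Phi_\lambda(t,0)x\to0,\ t\to-\infty\}$ (the kernel of $P^-_\lambda(0)$). These are the fibres of vector bundles $E^s(0)$, $E^u(0)$ over $\Lambda$, subbundles of $\Lambda\times\mathbb{R}^d$. Vector bundles and relative K-theory. A (real) vector bundle over $\Lambda$ is a set $E=\{(\lambda,u)\in\Lambda\times\mathbb{R}^n:u\in R(P_\lambda)\}$, where $P:\Lambda\to\mathrm{Mat}(n,\mathbb{R})$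 is a continuous family of projections and $R(P_\lambda)$ is the range of $P_\lambda$; its fibre is $E_\lambda=R(P_\lambda)$. $\Theta(V)=\Lambda\times V$ is the product bundle. $E\oplus F$ is the bundle with fibres $E_\lambda\oplus F_\lambda$. Bundle homomorphisms are continuous fibre-preserving fibrewise linear maps. For $\Lambda_0\subset\Lambda$ closed consider triples $(E_0,E_1,h)$ with $E_0,E_1$ vector bundles over $\Lambda$ and $h:E_0\to E_1$ a bundle homomorphism that is an isomorphism over $\Lambda_0$; a triple is trivial if $h$ is an isomorphism over all of $\Lambda$. Triples $(E_0^1,E_1^1,h_1)$, $(E_0^2,E_1^2,h_2)$ are isomorphic if there are bundle isomorphisms $\varphi_i:E_i^1\to E_i^2$, $i=0,1$, with $h_2\varphi_0=\varphi_1h_1$ over $\Lambda_0$. Two triples $\xi^1,\xi^2$ are equivalent if $\xi^1\oplus\eta^1\cong\xi^2\oplus\eta^2$ for some trivial triples $\eta^1,\eta^2$. The set of equivalence classes $[E_0,E_1,h]$ is the abelian group $\mathrm{KO}(\Lambda,\Lambda_0)$ with addition induced by direct sum. Index bundle. Let $X,Y$ be Banach spaces, $\Phi_0(X,Y)$ the set of Fredholm operators of index $0$, and $L:(\Lambda,\Lambda_0)\to(\Phi_0(X,Y),\mathrm{GL}(X,Y))$ a map of pairs, so that $L_\lambda$ is invertible for $\lambda\in\Lambda_0$. Choose a finite-dimensional $V\subset Y$ with $R(L_\lambda)+V=Y$ for all $\lambda\in\Lambda$. Then $E(L,V)=\{(\lambda,w)\in\Lambda\times X: L_\lambda w\in V\}$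 is a vector bundle and $\operatorname{ind}(L):=[E(L,V),\Theta(V),L|_{E(L,V)}]\in\mathrm{KO}(\Lambda,\Lambda_0)$, which is independent of $V$. Under (A1) and (A2) the operators $L_\lambda:H^1(\mathbb{R},\mathbb{R}^d)\to L^2(\mathbb{R},\mathbb{R}^d)$ are Fredholm of index $0$, and invertible for $\lambda\in\Lambda_0$; $\operatorname{ind}(L)$ is the index bundle of this family.
   Formalization: It is assumed in addition that λ ↦ L_λ is continuous in the operator norm, as the definition of ind(L) for a map of pairs requires; continuity of A on Λ×ℝ does not imply this, and without it E(L,V) may fail to be a vector bundle. *)

theory Defs
  imports "HOL-Analysis.Analysis" "HOL-Analysis.Finite_Function_Topology"
begin

section \<open>The spaces \<open>L\<^sup>2(\<real>)\<close> and \<open>H\<^sup>1(\<real>)\<close>\<close>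

definition square_integrable :: "(real \<Rightarrow> 'b::euclidean_space) \<Rightarrow> bool" where
  "square_integrable f \<longleftrightarrow>
     f \<in> borel_measurable lborel \<and> integrable lborel (\<lambda>t. (norm (f t))\<^sup>2)"

definition L2_rel :: "(real \<Rightarrow> 'b::euclidean_space) \<Rightarrow> (real \<Rightarrow> 'b) \<Rightarrow> bool" where
  "L2_rel f g \<longleftrightarrow> square_integrable f \<and> square_integrable g \<and> (AE t in lborel. f t = g t)"

lemma square_integrable_measurable [measurable_dest]:
  "square_integrable f \<Longrightarrow> f \<in> borel_measurable lborel"
  by (simp add: square_integrable_def)

lemma square_integrable_0 [simp]: "square_integrable (\<lambda>_. 0)"
  by (simp add: square_integrable_def)

lemma square_integrable_scaleR:
  assumes "square_integrable f"
  shows "square_integrable (\<lambda>t. c *\<^sub>R f t)"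
  using assms by (auto simp: square_integrable_def power_mult_distrib)

lemma square_integrable_dominated:
  assumes [measurable]: "f \<in> borel_measurable lborel"
    and "square_integrable g" and "\<And>t. norm (f t) \<le> C * norm (g t)"
  shows "square_integrable f"
  unfolding square_integrable_def
proof (intro conjI)
  have "integrable lborel (\<lambda>t. C\<^sup>2 * (norm (g t))\<^sup>2)"
    using assms by (simp add: square_integrable_def)
  then show "integrable lborel (\<lambda>t. (norm (f t))\<^sup>2)"
  proof (rule Bochner_Integration.integrable_bound)
    have "(norm (f t))\<^sup>2 \<le> C\<^sup>2 * (norm (g t))\<^sup>2" for t
      using power_mono[OF assms(3)[of t], of 2] by (simp add: power_mult_distrib)
    then show "AE t in lborel. norm ((norm (f t))\<^sup>2) \<le> norm (C\<^sup>2 * (norm (g t))\<^sup>2)"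
      by simp
  qed simp
qed fact

lemma square_integrable_add:
  assumes f: "square_integrable f" and g: "square_integrable g"
  shows "square_integrable (\<lambda>t. f t + g t)"
  unfolding square_integrable_def
proof (intro conjI)
  note [measurable] = square_integrable_measurable[OF f] square_integrable_measurable[OF g]
  show "(\<lambda>t. f t + g t) \<in> borel_measurable lborel" by simp
  have "integrable lborel (\<lambda>t. 2 * (norm (f t))\<^sup>2 + 2 * (norm (g t))\<^sup>2)"
    using f g by (simp add: square_integrable_def)
  then show "integrable lborel (\<lambda>t. (norm (f t + g t))\<^sup>2)"
  proof (rule Bochner_Integration.integrable_bound)
    have "(norm (f t + g t))\<^sup>2 \<le> 2 * (norm (f t))\<^sup>2 + 2 * (norm (g t))\<^sup>2" for t
    proof -
      have "(norm (f t + g t))\<^sup>2 \<le> (norm (f t) + norm (g t))\<^sup>2"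
        by (simp add: norm_triangle_ineq power_mono)
      also have "\<dots> \<le> 2 * (norm (f t))\<^sup>2 + 2 * (norm (g t))\<^sup>2"
        using sum_squares_bound[of "norm (f t)" "norm (g t)"] by (simp add: power2_sum)
      finally show ?thesis .
    qed
    then show "AE t in lborel. norm ((norm (f t + g t))\<^sup>2)
        \<le> norm (2 * (norm (f t))\<^sup>2 + 2 * (norm (g t))\<^sup>2)"
      by simp
  qed simp
qed

lemma square_integrable_uminus:
  "square_integrable f \<Longrightarrow> square_integrable (\<lambda>t. - f t)"
  by (simp add: square_integrable_def)

lemma square_integrable_diff:
  "square_integrable f \<Longrightarrow> square_integrable g \<Longrightarrow> square_integrable (\<lambda>t. f t - g t)"
  using square_integrable_add[of f "\<lambda>t. - g t"] by (simp add: square_integrable_uminus)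

lemma square_integrable_bound_prod:
  fixes f :: "real \<Rightarrow> 'a::euclidean_space" and g :: "real \<Rightarrow> 'b::euclidean_space"
    and h :: "real \<Rightarrow> 'c::euclidean_space"
  assumes f: "square_integrable f" and g: "square_integrable g"
    and h: "h \<in> borel_measurable lborel" and le: "\<And>t. norm (h t) \<le> norm (f t) * norm (g t)"
  shows "integrable lborel h"
proof -
  have "integrable lborel (\<lambda>t. (norm (f t))\<^sup>2 + (norm (g t))\<^sup>2)"
    using f g by (simp add: square_integrable_def)
  then show ?thesis
  proof (rule Bochner_Integration.integrable_bound[OF _ h])
    have "norm (h t) \<le> (norm (f t))\<^sup>2 + (norm (g t))\<^sup>2" for t
    proof -
      have "norm (f t) * norm (g t) \<le> (norm (f t))\<^sup>2 + (norm (g t))\<^sup>2"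
        using sum_squares_bound[of "norm (f t)" "norm (g t)"]
          mult_nonneg_nonneg[OF norm_ge_zero[of "f t"] norm_ge_zero[of "g t"]] by linarith
      then show ?thesis using le[of t] by linarith
    qed
    then show "AE t in lborel. norm (h t) \<le> norm ((norm (f t))\<^sup>2 + (norm (g t))\<^sup>2)"
      by simp
  qed
qed

lemma square_integrable_inner:
  assumes "square_integrable f" and "square_integrable g"
  shows "integrable lborel (\<lambda>t. f t \<bullet> g t)"
  using assms by (intro square_integrable_bound_prod[OF assms])
    (auto simp: Cauchy_Schwarz_ineq2 square_integrable_def intro!: borel_measurable_inner)

lemma part_equivp_L2_rel: "part_equivp L2_rel"
proof (rule part_equivpI)
  show "\<exists>f. L2_rel f f"
    by (rule exI[of _ "\<lambda>_. 0"]) (simp add: L2_rel_def)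
  show "symp L2_rel" by (auto simp: L2_rel_def symp_def)
  show "transp L2_rel" by (auto simp: L2_rel_def transp_def)
qed

quotient_type (overloaded) 'b L2 = "real \<Rightarrow> 'b::euclidean_space" / partial: L2_rel
  by (rule part_equivp_L2_rel)

instantiation L2 :: (euclidean_space) real_vector
begin

lift_definition zero_L2 :: "'a L2" is "\<lambda>_. 0"
  by (simp add: L2_rel_def)

lift_definition plus_L2 :: "'a L2 \<Rightarrow> 'a L2 \<Rightarrow> 'a L2" is "\<lambda>f g t. f t + g t"
  by (auto simp: L2_rel_def square_integrable_add)

lift_definition uminus_L2 :: "'a L2 \<Rightarrow> 'a L2" is "\<lambda>f t. - f t"
  by (auto simp: L2_rel_def square_integrable_uminus)

lift_definition minus_L2 :: "'a L2 \<Rightarrow> 'a L2 \<Rightarrow> 'a L2" is "\<lambda>f g t. f t - g t"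
  by (auto simp: L2_rel_def square_integrable_diff)

lift_definition scaleR_L2 :: "real \<Rightarrow> 'a L2 \<Rightarrow> 'a L2" is "\<lambda>c f t. c *\<^sub>R f t"
  by (auto simp: L2_rel_def square_integrable_scaleR)

instance
proof
  fix x y z :: "'a L2" and a b :: real
  show "x + y + z = x + (y + z)"
    by transfer (auto simp: L2_rel_def add.assoc intro!: square_integrable_add)
  show "x + y = y + x"
    by transfer (auto simp: L2_rel_def add.commute intro!: square_integrable_add)
  show "0 + x = x" by transfer (auto simp: L2_rel_def)
  show "- x + x = 0" by transfer (auto simp: L2_rel_def)
  show "x - y = x + - y"
    by transfer (auto simp: L2_rel_def square_integrable_diff)
  show "a *\<^sub>R (x + y) = a *\<^sub>R x + a *\<^sub>R y"
    by transfer (auto simp: L2_rel_def scaleR_add_right intro!: square_integrable_add square_integrable_scaleR)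
  show "(a + b) *\<^sub>R x = a *\<^sub>R x + b *\<^sub>R x"
    by transfer (auto simp: L2_rel_def scaleR_add_left intro!: square_integrable_add square_integrable_scaleR)
  show "a *\<^sub>R b *\<^sub>R x = (a * b) *\<^sub>R x"
    by transfer (auto simp: L2_rel_def intro!: square_integrable_scaleR)
  show "1 *\<^sub>R x = x" by transfer (auto simp: L2_rel_def)
qed

end

instantiation L2 :: (euclidean_space) real_inner
begin

lift_definition inner_L2 :: "'a L2 \<Rightarrow> 'a L2 \<Rightarrow> real" is "\<lambda>f g. LINT t|lborel. f t \<bullet> g t"
  by (rule integral_cong_AE) (auto simp: L2_rel_def square_integrable_def)

definition norm_L2 :: "'a L2 \<Rightarrow> real" where "norm_L2 x = sqrt (x \<bullet> x)"
definition sgn_L2 :: "'a L2 \<Rightarrow> 'a L2" where "sgn_L2 x = x /\<^sub>R norm x"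
definition dist_L2 :: "'a L2 \<Rightarrow> 'a L2 \<Rightarrow> real" where "dist_L2 x y = norm (x - y)"
definition uniformity_L2 :: "('a L2 \<times> 'a L2) filter" where
  "uniformity_L2 = (INF e\<in>{0 <..}. principal {(x, y). dist x y < e})"
definition open_L2 :: "'a L2 set \<Rightarrow> bool" where
  "open_L2 U \<longleftrightarrow> (\<forall>x\<in>U. eventually (\<lambda>(x', y). x' = x \<longrightarrow> y \<in> U) uniformity)"

instance
proof
  fix x y z :: "'a L2" and a :: real
  show "x \<bullet> y = y \<bullet> x" by transfer (simp add: inner_commute)
  show "(x + y) \<bullet> z = x \<bullet> z + y \<bullet> z"
    by transfer (auto simp: L2_rel_def inner_add_left square_integrable_inner)
  show "a *\<^sub>R x \<bullet> y = a * (x \<bullet> y)"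
    by transfer (auto simp: L2_rel_def square_integrable_inner)
  show "0 \<le> x \<bullet> x" by transfer simp
  show "x \<bullet> x = 0 \<longleftrightarrow> x = 0"
  proof transfer
    fix f :: "real \<Rightarrow> 'a" assume "L2_rel f f"
    then have f: "square_integrable f" by (simp add: L2_rel_def)
    have "(LINT t|lborel. f t \<bullet> f t) = 0 \<longleftrightarrow> (AE t in lborel. f t \<bullet> f t = 0)"
      by (rule integral_nonneg_eq_0_iff_AE[OF square_integrable_inner[OF f f]]) simp
    then show "(LINT t|lborel. f t \<bullet> f t) = 0 \<longleftrightarrow> L2_rel f (\<lambda>_. 0)"
      using f by (simp add: L2_rel_def)
  qed
qed (simp_all add: norm_L2_def sgn_L2_def dist_L2_def uniformity_L2_def open_L2_def)

end

lemma bounded_range_matrix_vector: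
  fixes A :: "real \<Rightarrow> real^'n^'m"
  assumes "bounded (range A)"
  obtains C where "C \<ge> 0" "\<And>t x. norm (A t *v x) \<le> C * norm x"
proof -
  obtain b where b: "\<And>t. norm (A t) \<le> b"
    using assms by (auto simp: bounded_iff)
  have b0: "b \<ge> 0" using b[of 0] norm_ge_zero order_trans by blast
  define C where "C = real CARD('m) * real CARD('n) * b"
  show ?thesis
  proof
    show "C \<ge> 0" using b0 by (simp add: C_def)
    fix t x
    have "\<bar>A t $ i $ j\<bar> \<le> b" for i j
      using component_le_norm_cart[of "A t $ i" j] Finite_Cartesian_Product.norm_nth_le[of "A t" i] b[of t] by linarith
    then have "onorm ((*v) (A t)) \<le> C"
      unfolding C_def by (rule onorm_le_matrix_component)
    moreover have "norm (A t *v x) \<le> onorm ((*v) (A t)) * norm x"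
      by (rule onorm) (rule matrix_vector_mul_bounded_linear)
    ultimately show "norm (A t *v x) \<le> C * norm x"
      by (meson mult_right_mono norm_ge_zero order_trans)
  qed
qed

lemma measurable_matrix_vector:
  fixes A :: "real \<Rightarrow> real^'n^'m"
  assumes [measurable]: "A \<in> borel_measurable borel" "f \<in> borel_measurable borel"
  shows "(\<lambda>t. A t *v f t) \<in> borel_measurable borel"
proof -
  have "continuous_on UNIV (\<lambda>(M :: real^'n^'m, x). M *v x)"
    unfolding case_prod_unfold matrix_vector_mult_def
    by (intro continuous_intros continuous_on_vec_lambda)
  then have "(\<lambda>(M :: real^'n^'m, x). M *v x) \<in> borel_measurable (borel \<Otimes>\<^sub>M borel)"
    by (simp add: borel_prod borel_measurable_continuous_onI)
  from measurable_compose[OF measurable_Pair[OF assms] this] show ?thesis by simp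
qed

text \<open>Multiplication by a bounded measurable coefficient; the value is 0 for any other coefficient.\<close>

definition matrix_mult_fun :: "(real \<Rightarrow> real^'n^'n) \<Rightarrow> (real \<Rightarrow> real^'n) \<Rightarrow> real \<Rightarrow> real^'n" where
  "matrix_mult_fun A f =
     (if bounded (range A) \<and> A \<in> borel_measurable borel then (\<lambda>t. A t *v f t) else (\<lambda>_. 0))"

lemma L2_rel_matrix_mult_fun:
  assumes "L2_rel f g"
  shows "L2_rel (matrix_mult_fun A f) (matrix_mult_fun A g)"
proof -
  have "square_integrable (\<lambda>t. A t *v h t)"
    if A: "bounded (range A)" "A \<in> borel_measurable borel" and h: "square_integrable h" for h
  proof -
    obtain C where C: "C \<ge> 0" "\<And>t x. norm (A t *v x) \<le> C * norm x"
      by (rule bounded_range_matrix_vector[OF A(1)]) blast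
    have "(\<lambda>t. A t *v h t) \<in> borel_measurable lborel"
      using A h by (simp add: measurable_matrix_vector square_integrable_def)
    from this h C(2) show ?thesis by (rule square_integrable_dominated)
  qed
  then show ?thesis using assms by (auto simp: L2_rel_def matrix_mult_fun_def)
qed

lift_definition L2_mult :: "(real \<Rightarrow> real^'n^'n) \<Rightarrow> (real^'n) L2 \<Rightarrow> (real^'n) L2" is
  matrix_mult_fun
  by (rule L2_rel_matrix_mult_fun)

lemma norm_L2_mono:
  fixes f g :: "real \<Rightarrow> 'b::euclidean_space"
  assumes "L2_rel f f" "L2_rel g g" "C \<ge> 0" "\<And>t. norm (f t) \<le> C * norm (g t)"
  shows "(LINT t|lborel. f t \<bullet> f t) \<le> C\<^sup>2 * (LINT t|lborel. g t \<bullet> g t)"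
proof -
  have "(LINT t|lborel. f t \<bullet> f t) \<le> (LINT t|lborel. C\<^sup>2 * (g t \<bullet> g t))"
  proof (rule integral_mono)
    show "integrable lborel (\<lambda>t. f t \<bullet> f t)" "integrable lborel (\<lambda>t. C\<^sup>2 * (g t \<bullet> g t))"
      using assms by (auto simp: L2_rel_def intro!: square_integrable_inner)
    show "f t \<bullet> f t \<le> C\<^sup>2 * (g t \<bullet> g t)" for t
      using power_mono[OF assms(4)[of t], of 2]
      by (simp add: power_mult_distrib power2_norm_eq_inner)
  qed
  then show ?thesis by simp
qed

lemma L2_mult_add: "L2_mult A (x + y) = L2_mult A x + L2_mult A y"
proof (transfer, goal_cases)
  case (1 A f g)
  have "matrix_mult_fun A (\<lambda>t. f t + g t) = (\<lambda>t. matrix_mult_fun A f t + matrix_mult_fun A g t)"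
    by (auto simp: matrix_mult_fun_def matrix_vector_right_distrib)
  then show ?case
    using L2_rel_matrix_mult_fun[OF 1(1), of A] L2_rel_matrix_mult_fun[OF 1(2), of A]
    by (simp add: L2_rel_def square_integrable_add)
qed

lemma L2_mult_scaleR: "L2_mult A (c *\<^sub>R x) = c *\<^sub>R L2_mult A x"
proof (transfer, goal_cases)
  case (1 A c f)
  have "matrix_mult_fun A (\<lambda>t. c *\<^sub>R f t) = (\<lambda>t. c *\<^sub>R matrix_mult_fun A f t)"
    by (auto simp: matrix_mult_fun_def matrix_vector_mult_scaleR)
  then show ?case
    using L2_rel_matrix_mult_fun[OF 1, of A] by (simp add: L2_rel_def square_integrable_scaleR)
qed

lemma norm_L2_mult_le:
  assumes "C \<ge> 0" "\<And>f t. norm (matrix_mult_fun A f t) \<le> C * norm (f t)"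
  shows "norm (L2_mult A x) \<le> norm x * C"
proof -
  have "L2_mult A x \<bullet> L2_mult A x \<le> C\<^sup>2 * (x \<bullet> x)"
    using assms
  proof (transfer, goal_cases)
    case (1 C A f)
    show ?case
      by (rule norm_L2_mono[OF L2_rel_matrix_mult_fun[OF 1(3)] 1(3) 1(1) 1(2)])
  qed
  then have "(norm (L2_mult A x))\<^sup>2 \<le> (norm x * C)\<^sup>2"
    by (simp add: power2_norm_eq_inner power_mult_distrib mult.commute)
  then show ?thesis
    using assms(1) by (auto intro: power2_le_imp_le)
qed

lemma bounded_linear_L2_mult: "bounded_linear (L2_mult A)"
proof -
  obtain C where C: "C \<ge> 0" "\<And>f t. norm (matrix_mult_fun A f t) \<le> C * norm (f t)"
  proof (cases "bounded (range A)")
    case True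
    obtain C where "C \<ge> 0" "\<And>t x. norm (A t *v x) \<le> C * norm x"
      by (rule bounded_range_matrix_vector[OF True]) blast
    then show ?thesis by (intro that[of C]) (auto simp: matrix_mult_fun_def)
  next
    case False
    then show ?thesis by (intro that[of 0]) (auto simp: matrix_mult_fun_def)
  qed
  show ?thesis
    by (rule bounded_linear_intro[OF L2_mult_add L2_mult_scaleR norm_L2_mult_le[OF C]])
qed

text \<open>
  Weak derivatives are tested against compactly supported functions of class \<open>C\<^sup>1\<close>; this gives the
  same notion as testing against smooth ones.
\<close>

definition test_function :: "(real \<Rightarrow> real) \<Rightarrow> bool" where
  "test_function \<phi> \<longleftrightarrow> (\<forall>t. \<phi> differentiable (at t)) \<and> continuous_on UNIV (deriv \<phi>) \<and>
     (\<exists>R. \<forall>t. R < \<bar>t\<bar> \<longrightarrow> \<phi> t = 0)"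

lift_definition weak_derivative :: "'b::euclidean_space L2 \<Rightarrow> 'b L2 \<Rightarrow> bool" is
  "\<lambda>f g. \<forall>\<phi>. test_function \<phi> \<longrightarrow>
     (LINT t|lborel. deriv \<phi> t *\<^sub>R f t) = - (LINT t|lborel. \<phi> t *\<^sub>R g t)"
proof -
  have *: "(LINT t|lborel. \<phi> t *\<^sub>R f t) = (LINT t|lborel. \<phi> t *\<^sub>R f' t)"
    if "continuous_on UNIV \<phi>" "L2_rel f f'" for \<phi> :: "real \<Rightarrow> real" and f f' :: "real \<Rightarrow> 'b"
  proof (rule integral_cong_AE)
    have [measurable]: "\<phi> \<in> borel_measurable borel"
      using that by (simp add: borel_measurable_continuous_onI)
    have [measurable]: "f \<in> borel_measurable borel" "f' \<in> borel_measurable borel"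
      using that by (auto simp: L2_rel_def square_integrable_def)
    show "(\<lambda>t. \<phi> t *\<^sub>R f t) \<in> borel_measurable lborel"
      "(\<lambda>t. \<phi> t *\<^sub>R f' t) \<in> borel_measurable lborel" by simp_all
    show "AE t in lborel. \<phi> t *\<^sub>R f t = \<phi> t *\<^sub>R f' t"
      using that by (auto simp: L2_rel_def)
  qed
  have cont: "continuous_on UNIV \<phi>" if "test_function \<phi>" for \<phi>
    using that by (auto simp: test_function_def intro!: continuous_at_imp_continuous_on
        differentiable_imp_continuous_within)
  show "(\<forall>\<phi>. test_function \<phi> \<longrightarrow>
        (LINT t|lborel. deriv \<phi> t *\<^sub>R f t) = - (LINT t|lborel. \<phi> t *\<^sub>R g t)) =
      (\<forall>\<phi>. test_function \<phi> \<longrightarrow>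
        (LINT t|lborel. deriv \<phi> t *\<^sub>R f' t) = - (LINT t|lborel. \<phi> t *\<^sub>R g' t))"
    if "L2_rel f f'" "L2_rel g g'" for f f' g g' :: "real \<Rightarrow> 'b"
    using *[OF _ that(1)] *[OF cont that(2)] by (simp add: test_function_def)
qed

lemma test_function_square_integrable:
  assumes "test_function \<phi>"
  shows "square_integrable \<phi>" and "square_integrable (deriv \<phi>)"
proof -
  obtain R where R: "\<And>t. R < \<bar>t\<bar> \<Longrightarrow> \<phi> t = 0" and
    diff: "\<And>t. \<phi> differentiable (at t)" and cont': "continuous_on UNIV (deriv \<phi>)"
    using assms by (auto simp: test_function_def)
  have *: "square_integrable \<psi>"
    if c: "continuous_on UNIV \<psi>" and 0: "\<And>t. R < \<bar>t\<bar> \<Longrightarrow> \<psi> t = 0" for \<psi> :: "real \<Rightarrow> real"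
    unfolding square_integrable_def
  proof
    show "\<psi> \<in> borel_measurable lborel"
      using c by (simp add: borel_measurable_continuous_onI)
    have "set_integrable lborel {-R..R} (\<lambda>t. (norm (\<psi> t))\<^sup>2)"
      by (rule borel_integrable_atLeastAtMost')
        (intro continuous_intros continuous_on_subset[OF c] subset_UNIV)
    moreover have "(\<lambda>t. indicator {-R..R} t *\<^sub>R (norm (\<psi> t))\<^sup>2) = (\<lambda>t. (norm (\<psi> t))\<^sup>2)"
    proof
      show "indicator {-R..R} t *\<^sub>R (norm (\<psi> t))\<^sup>2 = (norm (\<psi> t))\<^sup>2" for t
        using 0[of t] by (cases "t \<in> {-R..R}") auto
    qed
    ultimately show "integrable lborel (\<lambda>t. (norm (\<psi> t))\<^sup>2)"
      unfolding set_integrable_def by (simp only:)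
  qed
  have "continuous_on UNIV \<phi>"
    using diff by (auto intro!: continuous_at_imp_continuous_on differentiable_imp_continuous_within)
  then show "square_integrable \<phi>" using R by (rule *)
  show "square_integrable (deriv \<phi>)"
  proof (rule *[OF cont'])
    fix t assume t: "R < \<bar>t\<bar>"
    have "open {s::real. R < \<bar>s\<bar>}"
      by (intro open_Collect_less continuous_intros)
    then have "(\<phi> has_field_derivative 0) (at t)"
      by (rule has_field_derivative_transform_within_open[where f="\<lambda>_. 0", rotated])
        (auto simp: R t)
    then show "deriv \<phi> t = 0" by (rule DERIV_imp_deriv)
  qed
qed

lemma square_integrable_scaleR_fun:
  fixes f :: "real \<Rightarrow> 'b::euclidean_space"
  assumes "square_integrable \<phi>" and "square_integrable f"
  shows "integrable lborel (\<lambda>t. \<phi> t *\<^sub>R f t)"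
  using assms by (intro square_integrable_bound_prod[OF assms])
    (auto simp: square_integrable_def intro!: borel_measurable_scaleR)

lemma weak_derivative_0: "weak_derivative 0 0"
  by transfer simp

lemma weak_derivative_add:
  "weak_derivative x y \<Longrightarrow> weak_derivative x' y' \<Longrightarrow> weak_derivative (x + x') (y + y')"
  by transfer (simp add: L2_rel_def scaleR_add_right test_function_square_integrable
      square_integrable_scaleR_fun)

lemma weak_derivative_scaleR:
  "weak_derivative x y \<Longrightarrow> weak_derivative (c *\<^sub>R x) (c *\<^sub>R y)"
proof transfer
  fix f g :: "real \<Rightarrow> 'a" and c :: real
  assume *: "\<forall>\<phi>. test_function \<phi> \<longrightarrow>
    (LINT t|lborel. deriv \<phi> t *\<^sub>R f t) = - (LINT t|lborel. \<phi> t *\<^sub>R g t)"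
  have "a *\<^sub>R c *\<^sub>R v = c *\<^sub>R a *\<^sub>R v" for a and v :: 'a
    by (rule scaleR_left_commute)
  then show "\<forall>\<phi>. test_function \<phi> \<longrightarrow>
    (LINT t|lborel. deriv \<phi> t *\<^sub>R c *\<^sub>R f t) = - (LINT t|lborel. \<phi> t *\<^sub>R c *\<^sub>R g t)"
    using * by (simp del: scaleR_scaleR)
qed

lemma weak_derivative_uminus: "weak_derivative x y \<Longrightarrow> weak_derivative (- x) (- y)"
  using weak_derivative_scaleR[of x y "-1"] by simp

lemma weak_derivative_diff:
  "weak_derivative x y \<Longrightarrow> weak_derivative x' y' \<Longrightarrow> weak_derivative (x - x') (y - y')"
  using weak_derivative_add[OF _ weak_derivative_uminus, of x y x' y'] by simp

text \<open>
  An element of \<open>H\<^sup>1\<close> is stored together with its (unique) weak derivative, i.e. \<open>H\<^sup>1\<close> is the graph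
  of the weak derivative.  The inner product of \<open>L\<^sup>2 \<times> L\<^sup>2\<close> then restricts to the usual one of \<open>H\<^sup>1\<close>,
  and the norm is the square root of \<open>\<parallel>x\<parallel>\<^sup>2 + \<parallel>x'\<parallel>\<^sup>2\<close>.
\<close>

typedef (overloaded) 'b H1 = "{(x :: 'b::euclidean_space L2, y). weak_derivative x y}"
  using weak_derivative_0 by auto

lifting_forget L2.lifting
setup_lifting type_definition_H1

lift_definition H1_fun :: "'b::euclidean_space H1 \<Rightarrow> 'b L2" is fst .
lift_definition H1_deriv :: "'b::euclidean_space H1 \<Rightarrow> 'b L2" is snd .

instantiation H1 :: (euclidean_space) real_vector
begin

lift_definition zero_H1 :: "'a H1" is 0
  by (simp add: zero_prod_def weak_derivative_0)
lift_definition plus_H1 :: "'a H1 \<Rightarrow> 'a H1 \<Rightarrow> 'a H1" is "(+)"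
  by (auto simp: weak_derivative_add)
lift_definition uminus_H1 :: "'a H1 \<Rightarrow> 'a H1" is uminus
  by (auto simp: weak_derivative_uminus)
lift_definition minus_H1 :: "'a H1 \<Rightarrow> 'a H1 \<Rightarrow> 'a H1" is "(-)"
  by (auto simp: weak_derivative_diff)
lift_definition scaleR_H1 :: "real \<Rightarrow> 'a H1 \<Rightarrow> 'a H1" is "(*\<^sub>R)"
  by (auto simp: weak_derivative_scaleR)

instance
  by (standard; transfer; simp add: scaleR_add_right scaleR_add_left)

end

instantiation H1 :: (euclidean_space) real_inner
begin

lift_definition inner_H1 :: "'a H1 \<Rightarrow> 'a H1 \<Rightarrow> real" is "(\<bullet>)" .

definition norm_H1 :: "'a H1 \<Rightarrow> real" where "norm_H1 x = sqrt (x \<bullet> x)"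
definition sgn_H1 :: "'a H1 \<Rightarrow> 'a H1" where "sgn_H1 x = x /\<^sub>R norm x"
definition dist_H1 :: "'a H1 \<Rightarrow> 'a H1 \<Rightarrow> real" where "dist_H1 x y = norm (x - y)"
definition uniformity_H1 :: "('a H1 \<times> 'a H1) filter" where
  "uniformity_H1 = (INF e\<in>{0 <..}. principal {(x, y). dist x y < e})"
definition open_H1 :: "'a H1 set \<Rightarrow> bool" where
  "open_H1 U \<longleftrightarrow> (\<forall>x\<in>U. eventually (\<lambda>(x', y). x' = x \<longrightarrow> y \<in> U) uniformity)"

instance
proof
  fix x y z :: "'a H1" and a :: real
  show "x \<bullet> y = y \<bullet> x" by transfer (rule inner_commute)
  show "(x + y) \<bullet> z = x \<bullet> z + y \<bullet> z" by transfer (rule inner_add_left)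
  show "a *\<^sub>R x \<bullet> y = a * (x \<bullet> y)" by transfer (rule inner_scaleR_left)
  show "0 \<le> x \<bullet> x" by transfer (rule inner_ge_zero)
  show "x \<bullet> x = 0 \<longleftrightarrow> x = 0" by transfer (rule inner_eq_zero_iff)
qed (simp_all add: norm_H1_def sgn_H1_def dist_H1_def uniformity_H1_def open_H1_def)

end


lemma norm_H1_eq: "norm x = norm (H1_fun x, H1_deriv x)"
  by (simp add: norm_H1_def inner_H1.rep_eq H1_fun.rep_eq H1_deriv.rep_eq norm_eq_sqrt_inner)

lemma bounded_linear_H1_fun: "bounded_linear H1_fun"
proof (rule bounded_linear_intro[where K=1])
  show "norm (H1_fun x) \<le> norm x * 1" for x :: "'a H1"
    using norm_fst_le[of "H1_fun x" "H1_deriv x"] by (simp add: norm_H1_eq)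
qed (auto simp: H1_fun.rep_eq plus_H1.rep_eq scaleR_H1.rep_eq)

lemma bounded_linear_H1_deriv: "bounded_linear H1_deriv"
proof (rule bounded_linear_intro[where K=1])
  show "norm (H1_deriv x) \<le> norm x * 1" for x :: "'a H1"
    using norm_snd_le[of "H1_deriv x" "H1_fun x"] by (simp add: norm_H1_eq)
qed (auto simp: H1_deriv.rep_eq plus_H1.rep_eq scaleR_H1.rep_eq)

section \<open>The differential operators \<open>x \<mapsto> x' - A x\<close>\<close>

definition diff_op :: "(real \<Rightarrow> real^'n^'n) \<Rightarrow> (real^'n) H1 \<Rightarrow>\<^sub>L (real^'n) L2" where
  "diff_op A = Blinfun (\<lambda>x. H1_deriv x - L2_mult A (H1_fun x))"

lemma diff_op_apply: "blinfun_apply (diff_op A) x = H1_deriv x - L2_mult A (H1_fun x)"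
  unfolding diff_op_def
  by (subst bounded_linear_Blinfun_apply)
    (auto intro!: bounded_linear_sub bounded_linear_H1_deriv
      bounded_linear_compose[OF bounded_linear_L2_mult bounded_linear_H1_fun])


section \<open>Linear differential equations and exponential dichotomies\<close>

definition transition_matrix ::
    "(real \<Rightarrow> real^'n^'n) \<Rightarrow> (real \<Rightarrow> real \<Rightarrow> real^'n^'n) \<Rightarrow> bool" where
  "transition_matrix A \<Phi> \<longleftrightarrow>
     (\<forall>s. \<Phi> s s = mat 1) \<and>
     (\<forall>t s. invertible (\<Phi> t s)) \<and>
     (\<forall>t s. ((\<lambda>r. \<Phi> r s) has_vector_derivative A t ** \<Phi> t s) (at t))"

definition invariant_projector ::
    "(real \<Rightarrow> real \<Rightarrow> real^'n^'n) \<Rightarrow> real set \<Rightarrow> (real \<Rightarrow> real^'n^'n) \<Rightarrow> bool" where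
  "invariant_projector \<Phi> I P \<longleftrightarrow>
     (\<forall>t\<in>I. P t ** P t = P t) \<and>
     (\<forall>t\<in>I. \<forall>s\<in>I. \<Phi> t s ** P s = P t ** \<Phi> t s)"

definition exp_dichotomy ::
    "(real \<Rightarrow> real \<Rightarrow> real^'n^'n) \<Rightarrow> real set \<Rightarrow> (real \<Rightarrow> real^'n^'n) \<Rightarrow> bool" where
  "exp_dichotomy \<Phi> I P \<longleftrightarrow> invariant_projector \<Phi> I P \<and>
     (\<exists>K\<ge>1. \<exists>\<alpha>>0. \<forall>t\<in>I. \<forall>s\<in>I. s \<le> t \<longrightarrow>
        onorm ((*v) (\<Phi> t s ** P s)) \<le> K * exp (- \<alpha> * (t - s)) \<and>
        onorm ((*v) (\<Phi> s t ** (mat 1 - P t))) \<le> K * exp (- \<alpha> * (t - s)))"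

definition stable_space :: "(real \<Rightarrow> real \<Rightarrow> real^'n^'n) \<Rightarrow> (real^'n) set" where
  "stable_space \<Phi> = {x. ((\<lambda>t. \<Phi> t 0 *v x) \<longlongrightarrow> 0) at_top}"

definition unstable_space :: "(real \<Rightarrow> real \<Rightarrow> real^'n^'n) \<Rightarrow> (real^'n) set" where
  "unstable_space \<Phi> = {x. ((\<lambda>t. \<Phi> t 0 *v x) \<longlongrightarrow> 0) at_bot}"


section \<open>Vector bundles\<close>

text \<open>
  The base \<open>\<Lambda>\<close> is the universe of the type \<open>'l\<close>.  A family of subspaces of an ambient normed space
  is given by its fibres; its total space over \<open>B\<close> is \<open>Sigma B E\<close>, with the topology
  induced from \<open>\<Lambda> \<times> 'a\<close>.
\<close>

type_synonym ('l, 'a) family = "'l \<Rightarrow> 'a set"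

definition bundle_hom ::
    "'l::topological_space set \<Rightarrow> ('l, 'a::real_normed_vector) family \<Rightarrow>
     ('l, 'b::real_normed_vector) family \<Rightarrow> ('l \<Rightarrow> 'a \<Rightarrow> 'b) \<Rightarrow> bool" where
  "bundle_hom B E F h \<longleftrightarrow>
     (\<forall>l\<in>B. \<forall>u\<in>E l. h l u \<in> F l) \<and>
     (\<forall>l\<in>B. \<forall>u\<in>E l. \<forall>v\<in>E l. h l (u + v) = h l u + h l v) \<and>
     (\<forall>l\<in>B. \<forall>u\<in>E l. \<forall>c. h l (c *\<^sub>R u) = c *\<^sub>R h l u) \<and>
     continuous_on (Sigma B E) (\<lambda>(l, u). h l u)"

definition bundle_iso ::
    "'l::topological_space set \<Rightarrow> ('l, 'a::real_normed_vector) family \<Rightarrow>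
     ('l, 'b::real_normed_vector) family \<Rightarrow> ('l \<Rightarrow> 'a \<Rightarrow> 'b) \<Rightarrow> bool" where
  "bundle_iso B E F h \<longleftrightarrow> bundle_hom B E F h \<and>
     (\<exists>k. bundle_hom B F E k \<and>
        (\<forall>l\<in>B. \<forall>u\<in>E l. k l (h l u) = u) \<and> (\<forall>l\<in>B. \<forall>v\<in>F l. h l (k l v) = v))"

text \<open>
  The spaces \<open>\<real>\<^sup>n\<close> for all \<open>n\<close> are realised in one type, as the vectors of \<open>(nat, real) poly_mapping\<close> supported
  in \<open>{..<n}\<close>; an \<open>n \<times> n\<close> matrix is a function \<open>M\<close> of two indices below \<open>n\<close>.  A concrete bundle is
  the family of ranges of a continuous family of projections in \<open>Mat(n, \<real>)\<close>.
\<close>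

type_synonym Rinf = "(nat, real) poly_mapping"

definition matrix_range :: "nat \<Rightarrow> (nat \<Rightarrow> nat \<Rightarrow> real) \<Rightarrow> Rinf set" where
  "matrix_range n M = {u. Poly_Mapping.keys u \<subseteq> {..<n} \<and>
     (\<exists>x. \<forall>i<n. Poly_Mapping.lookup u i = (\<Sum>j<n. M i j * x j))}"

definition concrete_bundle :: "('l::topological_space, Rinf) family \<Rightarrow> bool" where
  "concrete_bundle E \<longleftrightarrow> (\<exists>n (P :: 'l \<Rightarrow> nat \<Rightarrow> nat \<Rightarrow> real).
     (\<forall>i<n. \<forall>j<n. continuous_on UNIV (\<lambda>l. P l i j)) \<and>
     (\<forall>l. \<forall>i<n. \<forall>j<n. (\<Sum>k<n. P l i k * P l k j) = P l i j) \<and>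
     (\<forall>l. E l = matrix_range n (P l)))"

text \<open>
  A family of subspaces of an arbitrary ambient space is a vector bundle if it is isomorphic to
  a concrete one.  This covers \<open>E(L, V) \<subseteq> \<Lambda> \<times> X\<close>, which does not lie in some \<open>\<Lambda> \<times> \<real>\<^sup>n\<close>.
\<close>

definition vector_bundle :: "('l::topological_space, 'a::real_normed_vector) family \<Rightarrow> bool" where
  "vector_bundle E \<longleftrightarrow> (\<forall>l. subspace (E l)) \<and>
     (\<exists>F h. concrete_bundle F \<and> bundle_iso UNIV E F h)"

definition product_bundle :: "'a set \<Rightarrow> ('l, 'a) family" where
  "product_bundle V = (\<lambda>l. V)"

definition bundle_sum :: "('l, 'a) family \<Rightarrow> ('l, 'b) family \<Rightarrow> ('l, 'a \<times> 'b) family" where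
  "bundle_sum E F = (\<lambda>l. E l \<times> F l)"


section \<open>Relative K-theory\<close>

type_synonym ('l, 'a, 'b) triple = "('l, 'a) family \<times> ('l, 'b) family \<times> ('l \<Rightarrow> 'a \<Rightarrow> 'b)"

fun KO_triple ::
    "'l::topological_space set \<Rightarrow> ('l, 'a::real_normed_vector, 'b::real_normed_vector) triple \<Rightarrow> bool"
  where "KO_triple \<Lambda>\<^sub>0 (E0, E1, h) \<longleftrightarrow>
    vector_bundle E0 \<and> vector_bundle E1 \<and> bundle_hom UNIV E0 E1 h \<and> bundle_iso \<Lambda>\<^sub>0 E0 E1 h"

fun concrete_triple :: "('l::topological_space, Rinf, Rinf) triple \<Rightarrow> bool" where
  "concrete_triple (E0, E1, h) \<longleftrightarrow> concrete_bundle E0 \<and> concrete_bundle E1"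

fun trivial_triple ::
    "('l::topological_space, 'a::real_normed_vector, 'b::real_normed_vector) triple \<Rightarrow> bool"
  where "trivial_triple (E0, E1, h) \<longleftrightarrow>
    vector_bundle E0 \<and> vector_bundle E1 \<and> bundle_iso UNIV E0 E1 h"

fun triple_sum ::
    "('l, 'a, 'b) triple \<Rightarrow> ('l, 'c, 'd) triple \<Rightarrow> ('l, 'a \<times> 'c, 'b \<times> 'd) triple" where
  "triple_sum (E0, E1, h) (F0, F1, k) =
     (bundle_sum E0 F0, bundle_sum E1 F1, \<lambda>l (u, v). (h l u, k l v))"

fun triple_iso ::
    "'l::topological_space set \<Rightarrow> ('l, 'a::real_normed_vector, 'b::real_normed_vector) triple \<Rightarrow>
     ('l, 'c::real_normed_vector, 'd::real_normed_vector) triple \<Rightarrow> bool" where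
  "triple_iso \<Lambda>\<^sub>0 (E0, E1, h) (F0, F1, k) \<longleftrightarrow>
     (\<exists>\<phi>0 \<phi>1. bundle_iso UNIV E0 F0 \<phi>0 \<and> bundle_iso UNIV E1 F1 \<phi>1 \<and>
        (\<forall>l\<in>\<Lambda>\<^sub>0. \<forall>u\<in>E0 l. k l (\<phi>0 l u) = \<phi>1 l (h l u)))"

text \<open>
  The two triples may live in different ambient spaces.  Up to isomorphism every trivial triple is
  concrete, so it suffices to stabilise with concrete ones.
\<close>

definition KO_equiv ::
    "'l::topological_space set \<Rightarrow> ('l, 'a::real_normed_vector, 'b::real_normed_vector) triple \<Rightarrow>
     ('l, 'c::real_normed_vector, 'd::real_normed_vector) triple \<Rightarrow> bool" where
  "KO_equiv \<Lambda>\<^sub>0 \<xi> \<xi>' \<longleftrightarrow> KO_triple \<Lambda>\<^sub>0 \<xi> \<and> KO_triple \<Lambda>\<^sub>0 \<xi>' \<and>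
     (\<exists>\<eta> \<eta>'. concrete_triple \<eta> \<and> trivial_triple \<eta> \<and> concrete_triple \<eta>' \<and> trivial_triple \<eta>' \<and>
        triple_iso \<Lambda>\<^sub>0 (triple_sum \<xi> \<eta>) (triple_sum \<xi>' \<eta>'))"

text \<open>
  The class \<open>[E\<^sub>0, E\<^sub>1, h]\<close> of a triple in any ambient spaces consists of the concrete triples
  equivalent to it (all classes thus have the same type); it is empty if \<open>\<xi>\<close> is not a triple
  in the sense of \<open>KO_triple\<close>.
\<close>

definition KO_class ::
    "'l::topological_space set \<Rightarrow> ('l, 'a::real_normed_vector, 'b::real_normed_vector) triple \<Rightarrow>
     ('l, Rinf, Rinf) triple set" where
  "KO_class \<Lambda>\<^sub>0 \<xi> = {\<zeta>. concrete_triple \<zeta> \<and> KO_equiv \<Lambda>\<^sub>0 \<xi> \<zeta>}"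

definition KO :: "'l::topological_space set \<Rightarrow> ('l, Rinf, Rinf) triple set set" where
  "KO \<Lambda>\<^sub>0 = {KO_class \<Lambda>\<^sub>0 \<zeta> |\<zeta>. concrete_triple \<zeta> \<and> KO_triple \<Lambda>\<^sub>0 \<zeta>}"


section \<open>The index bundle\<close>

definition finite_dim_subspace :: "'a::real_vector set \<Rightarrow> bool" where
  "finite_dim_subspace V \<longleftrightarrow> (\<exists>B. finite B \<and> V = span B)"

text \<open>Index 0: the kernel has the same dimension as an algebraic complement of the range.\<close>

definition fredholm_index_0 ::
    "('x::real_normed_vector \<Rightarrow>\<^sub>L 'y::real_normed_vector) \<Rightarrow> bool" where
  "fredholm_index_0 T \<longleftrightarrow>
     closed (range (blinfun_apply T)) \<and>
     finite_dim_subspace {x. blinfun_apply T x = 0} \<and>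
     (\<exists>W. finite_dim_subspace W \<and> range (blinfun_apply T) \<inter> W = {0} \<and>
        (\<forall>y. \<exists>x. \<exists>w\<in>W. y = blinfun_apply T x + w) \<and>
        dim {x. blinfun_apply T x = 0} = dim W)"

definition invertible_op :: "('x::real_normed_vector \<Rightarrow>\<^sub>L 'y::real_normed_vector) \<Rightarrow> bool" where
  "invertible_op T \<longleftrightarrow> (\<exists>S. S o\<^sub>L T = id_blinfun \<and> T o\<^sub>L S = id_blinfun)"

text \<open>
  Maps of pairs \<open>(\<Lambda>, \<Lambda>\<^sub>0) \<rightarrow> (\<Phi>\<^sub>0(X, Y), GL(X, Y))\<close>, where \<open>\<Phi>\<^sub>0(X, Y)\<close> carries the topology
  of the operator norm.
\<close>

definition fredholm_pair ::
    "'l::topological_space set \<Rightarrow> ('l \<Rightarrow> 'x::real_normed_vector \<Rightarrow>\<^sub>L 'y::real_normed_vector) \<Rightarrow> bool"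
  where "fredholm_pair \<Lambda>\<^sub>0 L \<longleftrightarrow>
    continuous_on UNIV L \<and> (\<forall>l. fredholm_index_0 (L l)) \<and> (\<forall>l\<in>\<Lambda>\<^sub>0. invertible_op (L l))"

definition transversal ::
    "('l \<Rightarrow> 'x::real_normed_vector \<Rightarrow>\<^sub>L 'y::real_normed_vector) \<Rightarrow> 'y set \<Rightarrow> bool" where
  "transversal L V \<longleftrightarrow> finite_dim_subspace V \<and>
     (\<forall>l y. \<exists>w. \<exists>v\<in>V. y = blinfun_apply (L l) w + v)"

definition preimage_bundle ::
    "('l \<Rightarrow> 'x::real_normed_vector \<Rightarrow>\<^sub>L 'y::real_normed_vector) \<Rightarrow> 'y set \<Rightarrow> ('l, 'x) family" where
  "preimage_bundle L V = (\<lambda>l. {w. blinfun_apply (L l) w \<in> V})"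

text \<open>
  The index bundle is only defined for maps of pairs; the value \<open>{}\<close> in all other cases is
  not an element of \<open>KO \<Lambda>\<^sub>0\<close>.
\<close>

definition index_bundle ::
    "'l::topological_space set \<Rightarrow> ('l \<Rightarrow> 'x::real_normed_vector \<Rightarrow>\<^sub>L 'y::real_normed_vector) \<Rightarrow>
     ('l, Rinf, Rinf) triple set" where
  "index_bundle \<Lambda>\<^sub>0 L =
     (if fredholm_pair \<Lambda>\<^sub>0 L
      then let V = (SOME V. transversal L V)
        in KO_class \<Lambda>\<^sub>0 (preimage_bundle L V, product_bundle V, \<lambda>l. blinfun_apply (L l))
      else {})"

end

theory Submission
  imports Defs
begin

text \<open>
  Fix a function \<open>e\<close> in \<open>H\<^sup>1\<close> with \<open>e(0) = 1\<close>.  A pair \<open>(x, c)\<close> in \<open>H\<^sup>1 \<times> \<real>\<^sup>d\<close> stands for the function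
  \<open>w = x + 1\<^bsub>[0, \<infinity>)\<^esub> e c\<close>, which is \<open>H\<^sup>1\<close> on each half-line and has the jump \<open>c\<close> at 0.  On such functions
  consider \<open>N\<^sub>\<lambda> w = (w' - A\<^sub>\<lambda> w, (I - P\<^sup>-) w(0-), P\<^sup>+ w(0+))\<close>, with \<open>w'\<close> taken on the half-lines.  By variation of
  constants on each half-line, \<open>N\<^sub>\<lambda>\<close> is an isomorphism onto \<open>L\<^sup>2 \<times> E\<^sup>u \<times> E\<^sup>s\<close>.  It depends continuously on \<open>\<lambda>\<close>,
  and so does its inverse, because a lower bound \<open>\<parallel>w\<parallel> \<le> C \<parallel>N\<^sub>\<lambda> w\<parallel>\<close> persists near \<open>\<lambda>\<close>.

  Let \<open>V\<close> be transversal to \<open>L\<close>.  Through \<open>N\<close>, the functions with \<open>w' - A w\<close> in \<open>V\<close> form the bundle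
  \<open>V \<oplus> E\<^sup>u \<oplus> E\<^sup>s\<close>.  The jump maps it onto \<open>\<real>\<^sup>d\<close> with kernel \<open>E(L, V)\<close>, so a continuous right inverse of the
  jump gives \<open>E(L, V) \<oplus> \<real>\<^sup>d \<cong> E\<^sup>u \<oplus> E\<^sup>s \<oplus> V\<close>.  Since the jump of a solution of the homogeneous equation
  is the difference of its boundary values, this is up to an automorphism of \<open>\<real>\<^sup>d \<oplus> V\<close> an isomorphism from
  \<open>(E(L, V), V, L)\<close> to \<open>(E\<^sup>u \<oplus> E\<^sup>s, \<real>\<^sup>d, u - v)\<close> stabilised by trivial triples.  The base need not be Hausdorff,
  hence all bundles are given by explicit continuous projections instead of partitions of unity.
\<close>

section \<open>Bundle homomorphisms\<close>

text \<open>The obstacle is that L_\<lambda> is only Fredholm: neither its kernel nor E(L, V) comes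
  with coordinates varying continuously in \<lambda>. A problem that is uniquely solvable for every
  \<lambda> replaces it, so that whatever varies with \<lambda> is expressed through one continuous
  solution operator. The source and the boundary data become the unknowns, the jump is a linear
  function J of them with values in R^d, and E(L, V) is a kernel of J. The same reduction yields the
  existence of V, the closed range and index 0: the range of L_\<lambda> is the preimage of E^u +
  E^s under f |-> J(f, 0, 0), and dim E^u + dim E^s = d, because these dimensions are constant on
  the connected base and the spaces are complementary over \<open>\<Lambda>\<^sub>0\<close>. Since V
  is an arbitrary choice in the definition of the index bundle, the equivalence of triples is shown
  for every transversal V. The bundles lie in R^d, L^2 and H^1, so triples in different ambient
  spaces are compared, and stabilisers are exchanged for isomorphic concrete ones.\<close>

lemma bundle_homD:
  assumes "bundle_hom B E F h" "l \<in> B"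
  shows "u \<in> E l \<Longrightarrow> h l u \<in> F l"
    and "u \<in> E l \<Longrightarrow> v \<in> E l \<Longrightarrow> h l (u + v) = h l u + h l v"
    and "u \<in> E l \<Longrightarrow> h l (c *\<^sub>R u) = c *\<^sub>R h l u"
  using assms by (auto simp: bundle_hom_def)

lemma bundle_hom_continuous_pair:
  assumes "bundle_hom B E F h"
  shows "continuous_on (Sigma B E) (\<lambda>p. (fst p, h (fst p) (snd p)))"
  using assms unfolding bundle_hom_def case_prod_unfold
  by (intro continuous_intros) auto

lemma bundle_hom_comp:
  assumes h: "bundle_hom B E F h" and k: "bundle_hom B F G k"
  shows "bundle_hom B E G (\<lambda>l u. k l (h l u))"
proof -
  have "continuous_on (Sigma B E) (\<lambda>p. (\<lambda>(l, v). k l v) (fst p, h (fst p) (snd p)))"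
    by (rule continuous_on_compose2[OF _ bundle_hom_continuous_pair[OF h], of "Sigma B F"])
      (use h k in \<open>auto simp: bundle_hom_def\<close>)
  then have "continuous_on (Sigma B E) (\<lambda>(l, u). k l (h l u))"
    by (simp add: case_prod_unfold)
  then show ?thesis
    using h k by (auto simp: bundle_hom_def)
qed

lemma bundle_hom_id: "bundle_hom B E E (\<lambda>l u. u)"
  unfolding bundle_hom_def case_prod_unfold by (auto intro!: continuous_intros)

lemma bundle_hom_subset: "bundle_hom B E F h \<Longrightarrow> B' \<subseteq> B \<Longrightarrow> bundle_hom B' E F h"
  unfolding bundle_hom_def by (auto elim!: continuous_on_subset)

lemma bundle_hom_sum:
  assumes h: "bundle_hom B E F h" and h': "bundle_hom B E' F' h'"
  shows "bundle_hom B (bundle_sum E E') (bundle_sum F F') (\<lambda>l (u, u'). (h l u, h' l u'))"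
proof -
  have "continuous_on (Sigma B (bundle_sum E E')) (\<lambda>p. (\<lambda>(l, v). h l v) (fst p, fst (snd p)))"
    by (rule continuous_on_compose2[of "Sigma B E"])
      (use h in \<open>auto simp: bundle_hom_def bundle_sum_def intro!: continuous_intros\<close>)
  moreover have "continuous_on (Sigma B (bundle_sum E E')) (\<lambda>p. (\<lambda>(l, v). h' l v) (fst p, snd (snd p)))"
    by (rule continuous_on_compose2[of "Sigma B E'"])
      (use h' in \<open>auto simp: bundle_hom_def bundle_sum_def intro!: continuous_intros\<close>)
  ultimately have "continuous_on (Sigma B (bundle_sum E E'))
      (\<lambda>(l, w). (\<lambda>(u, u'). (h l u, h' l u')) w)"
    by (simp add: case_prod_unfold continuous_on_Pair)
  then show ?thesis
    using h h' by (auto simp: bundle_hom_def bundle_sum_def)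
qed

lemma bundle_isoI:
  assumes "bundle_hom B E F h" "bundle_hom B F E k"
    and "\<And>l u. l \<in> B \<Longrightarrow> u \<in> E l \<Longrightarrow> k l (h l u) = u"
    and "\<And>l v. l \<in> B \<Longrightarrow> v \<in> F l \<Longrightarrow> h l (k l v) = v"
  shows "bundle_iso B E F h"
  using assms by (auto simp: bundle_iso_def)

lemma bundle_isoE:
  assumes "bundle_iso B E F h"
  obtains k where "bundle_hom B E F h" "bundle_hom B F E k"
    "\<And>l u. l \<in> B \<Longrightarrow> u \<in> E l \<Longrightarrow> k l (h l u) = u"
    "\<And>l v. l \<in> B \<Longrightarrow> v \<in> F l \<Longrightarrow> h l (k l v) = v"
    "bundle_iso B F E k"
  using assms unfolding bundle_iso_def by blast

lemma bundle_iso_id: "bundle_iso B E E (\<lambda>l u. u)"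
  by (rule bundle_isoI[OF bundle_hom_id bundle_hom_id]) auto

lemma bundle_iso_subset: "bundle_iso B E F h \<Longrightarrow> B' \<subseteq> B \<Longrightarrow> bundle_iso B' E F h"
  unfolding bundle_iso_def by (meson bundle_hom_subset subsetD)

lemma bundle_iso_comp:
  assumes h: "bundle_iso B E F h" and k: "bundle_iso B F G k"
  shows "bundle_iso B E G (\<lambda>l u. k l (h l u))"
proof -
  obtain h' where h': "bundle_hom B E F h" "bundle_hom B F E h'"
    "\<And>l u. l \<in> B \<Longrightarrow> u \<in> E l \<Longrightarrow> h' l (h l u) = u"
    "\<And>l v. l \<in> B \<Longrightarrow> v \<in> F l \<Longrightarrow> h l (h' l v) = v"
    using h by (rule bundle_isoE) blast
  obtain k' where k': "bundle_hom B F G k" "bundle_hom B G F k'"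
    "\<And>l u. l \<in> B \<Longrightarrow> u \<in> F l \<Longrightarrow> k' l (k l u) = u"
    "\<And>l v. l \<in> B \<Longrightarrow> v \<in> G l \<Longrightarrow> k l (k' l v) = v"
    using k by (rule bundle_isoE) blast
  show ?thesis
    by (rule bundle_isoI[OF bundle_hom_comp[OF h'(1) k'(1)] bundle_hom_comp[OF k'(2) h'(2)]])
      (simp_all add: h' k' bundle_homD[OF h'(1)] bundle_homD[OF k'(2)])
qed

lemma bundle_iso_sum:
  assumes h: "bundle_iso B E F h" and k: "bundle_iso B E' F' k"
  shows "bundle_iso B (bundle_sum E E') (bundle_sum F F') (\<lambda>l (u, u'). (h l u, k l u'))"
proof -
  obtain h' where h': "bundle_hom B E F h" "bundle_hom B F E h'"
    "\<And>l u. l \<in> B \<Longrightarrow> u \<in> E l \<Longrightarrow> h' l (h l u) = u"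
    "\<And>l v. l \<in> B \<Longrightarrow> v \<in> F l \<Longrightarrow> h l (h' l v) = v"
    using h by (rule bundle_isoE) blast
  obtain k' where k': "bundle_hom B E' F' k" "bundle_hom B F' E' k'"
    "\<And>l u. l \<in> B \<Longrightarrow> u \<in> E' l \<Longrightarrow> k' l (k l u) = u"
    "\<And>l v. l \<in> B \<Longrightarrow> v \<in> F' l \<Longrightarrow> k l (k' l v) = v"
    using k by (rule bundle_isoE) blast
  show ?thesis
    by (rule bundle_isoI[OF bundle_hom_sum[OF h'(1) k'(1)] bundle_hom_sum[OF h'(2) k'(2)]])
      (auto simp add: h' k' bundle_sum_def)
qed

lemma bundle_hom_continuous_linear:
  assumes "\<And>l. bounded_linear (f :: 'a::real_normed_vector \<Rightarrow> 'b::real_normed_vector)"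
    and "\<And>l u. l \<in> B \<Longrightarrow> u \<in> E l \<Longrightarrow> f u \<in> F l"
  shows "bundle_hom B E F (\<lambda>l. f)"
proof -
  interpret bounded_linear f by fact
  show ?thesis
    unfolding bundle_hom_def case_prod_unfold using assms(2)
    by (auto simp: add scaleR intro!: continuous_intros continuous_on)
qed

lemma bounded_linear_assoc:
  "bounded_linear (\<lambda>((u, v), w). (u, (v, w)))" "bounded_linear (\<lambda>(u, (v, w)). ((u, v), w))"
  "bounded_linear (\<lambda>((u, v), w). ((u, w), v))"
  unfolding case_prod_unfold
  by (intro bounded_linear_Pair bounded_linear_fst_comp bounded_linear_snd_comp bounded_linear_ident)+

lemma bundle_iso_assoc:
  "bundle_iso B (bundle_sum (bundle_sum E F) G) (bundle_sum E (bundle_sum F G))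
     (\<lambda>l. \<lambda>((u, v), w). (u, (v, w)))"
  by (rule bundle_isoI[OF bundle_hom_continuous_linear[OF bounded_linear_assoc(1)]
        bundle_hom_continuous_linear[OF bounded_linear_assoc(2)]])
    (auto simp: bundle_sum_def)

lemma bundle_iso_right_commute:
  "bundle_iso B (bundle_sum (bundle_sum E F) G) (bundle_sum (bundle_sum E G) F)
     (\<lambda>l. \<lambda>((u, v), w). ((u, w), v))"
  by (rule bundle_isoI[OF bundle_hom_continuous_linear[OF bounded_linear_assoc(3)]
        bundle_hom_continuous_linear[OF bounded_linear_assoc(3)]])
    (auto simp: bundle_sum_def)

section \<open>Coordinates on vector bundles\<close>

text \<open>A bundle in coordinates: \<open>c\<close> is biorthogonal to \<open>e\<close>, and the
  coordinate vectors of the fibre are those fixed by the idempotent \<open>P l\<close>, which form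
  its range. The ambient space enters only through \<open>e\<close> and \<open>c\<close>, so a
  bundle inside an infinite-dimensional space can share its matrix family with a concrete
  one.\<close>

definition presentation ::
    "nat \<Rightarrow> (nat \<Rightarrow> 'a::real_normed_vector) \<Rightarrow> (nat \<Rightarrow> 'a \<Rightarrow> real) \<Rightarrow>
     ('l::topological_space \<Rightarrow> nat \<Rightarrow> nat \<Rightarrow> real) \<Rightarrow> ('l, 'a) family \<Rightarrow> bool" where
  "presentation n e c P E \<longleftrightarrow>
     (\<forall>i<n. bounded_linear (c i)) \<and> (\<forall>i<n. \<forall>j<n. c i (e j) = of_bool (i = j)) \<and>
     (\<forall>i<n. \<forall>j<n. continuous_on UNIV (\<lambda>l. P l i j)) \<and>
     (\<forall>l. \<forall>i<n. \<forall>j<n. (\<Sum>k<n. P l i k * P l k j) = P l i j) \<and>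
     (\<forall>l. E l = {(\<Sum>i<n. x i *\<^sub>R e i) |x. \<forall>i<n. x i = (\<Sum>j<n. P l i j * x j)})"

lemma presentation_coord:
  assumes "presentation n e c P E" "i < n"
  shows "c i (\<Sum>j<n. x j *\<^sub>R e j) = x i"
proof -
  interpret bounded_linear "c i" using assms by (auto simp: presentation_def)
  have "c i (\<Sum>j<n. x j *\<^sub>R e j) = (\<Sum>j<n. x j * of_bool (i = j))"
    using assms by (simp add: sum scaleR presentation_def)
  also have "\<dots> = (\<Sum>j<n. if i = j then x j else 0)"
    by (intro sum.cong) auto
  finally show ?thesis using assms(2) by simp
qed

text \<open>Coordinates with respect to \<open>e\<close> are turned into coordinates with respect to
  \<open>e'\<close>. This map does not depend on the base point and is bounded, since the
  \<open>c i\<close> are, so equal matrix families suffice for an isomorphism.\<close>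

lemma presentation_iso:
  assumes E: "presentation n e c P E" and F: "presentation n e' c' P F"
  shows "bundle_iso UNIV E F (\<lambda>l u. \<Sum>i<n. c i u *\<^sub>R e' i)"
proof -
  have *: "bundle_hom UNIV E F (\<lambda>l u. \<Sum>i<n. c i u *\<^sub>R e' i)"
    if E: "presentation n e c P E" and F: "presentation n e' c' P F"
    for E and e :: "nat \<Rightarrow> 'x::real_normed_vector" and c and F and e' :: "nat \<Rightarrow> 'y::real_normed_vector" and c'
  proof (rule bundle_hom_continuous_linear)
    show "bounded_linear (\<lambda>u. \<Sum>i<n. c i u *\<^sub>R e' i)"
      using E by (intro bounded_linear_sum bounded_linear_compose[OF bounded_linear_scaleR_left])
        (auto simp: presentation_def)
    fix l u assume "u \<in> E l"
    then obtain x where x: "\<forall>i<n. x i = (\<Sum>j<n. P l i j * x j)" "u = (\<Sum>i<n. x i *\<^sub>R e i)"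
      using E by (auto simp: presentation_def)
    then have "(\<Sum>i<n. c i u *\<^sub>R e' i) = (\<Sum>i<n. x i *\<^sub>R e' i)"
      using presentation_coord[OF E] by simp
    then show "(\<Sum>i<n. c i u *\<^sub>R e' i) \<in> F l"
      using x(1) F by (auto simp: presentation_def)
  qed
  have **: "(\<Sum>i<n. c' i (\<Sum>i<n. c i u *\<^sub>R e' i) *\<^sub>R e i) = u"
    if E: "presentation n e c P E" and F: "presentation n e' c' P F" and u: "u \<in> E l"
    for l u E and e :: "nat \<Rightarrow> 'x::real_normed_vector" and c and F and e' :: "nat \<Rightarrow> 'y::real_normed_vector" and c'
  proof -
    obtain x where x: "u = (\<Sum>i<n. x i *\<^sub>R e i)"
      using E u by (auto simp: presentation_def)
    then have "(\<Sum>i<n. c i u *\<^sub>R e' i) = (\<Sum>i<n. x i *\<^sub>R e' i)"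
      using presentation_coord[OF E] by simp
    then show ?thesis using presentation_coord[OF F] x by simp
  qed
  show ?thesis
    by (rule bundle_isoI[OF *[OF E F] *[OF F E]]) (rule **[OF E F] **[OF F E]; assumption)+
qed

lemma lookup_scaleR: "Poly_Mapping.lookup (c *\<^sub>R u) i = c *\<^sub>R Poly_Mapping.lookup u i"
proof -
  have "finite {i. c *\<^sub>R Poly_Mapping.lookup u i \<noteq> 0}"
    by (rule finite_subset[OF _ finite_lookup[of u]]) auto
  then show ?thesis
    unfolding scaleR_poly_mapping_def by (subst Abs_poly_mapping_inverse) auto
qed

lemma lookup_sum: "Poly_Mapping.lookup (sum f S) i = (\<Sum>x\<in>S. Poly_Mapping.lookup (f x) i)"
  by (induction S rule: infinite_finite_induct) (auto simp: lookup_add)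

lemma bounded_linear_lookup: "bounded_linear (\<lambda>u :: Rinf. Poly_Mapping.lookup u i)"
proof (rule bounded_linear_intro[where K=1])
  fix u :: Rinf
  show "norm (Poly_Mapping.lookup u i) \<le> norm u * 1"
  proof (cases "i \<in> Poly_Mapping.keys u")
    case True
    then show ?thesis
      unfolding norm_poly_mapping_def dist_poly_mapping_def
      using member_le_sum[of i "Poly_Mapping.keys u" "\<lambda>i. norm (Poly_Mapping.lookup u i)"] by simp
  qed (simp add: in_keys_iff)
qed (auto simp: lookup_add lookup_scaleR)

lemma presentation_matrix_range:
  assumes P: "\<forall>i<n. \<forall>j<n. continuous_on UNIV (\<lambda>l. P l i j)"
    "\<forall>l. \<forall>i<n. \<forall>j<n. (\<Sum>k<n. P l i k * P l k j) = P l i j"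
  shows "presentation n (\<lambda>i. Poly_Mapping.single i (1::real)) (\<lambda>i u. Poly_Mapping.lookup u i) P
           (\<lambda>l. matrix_range n (P l))"
proof -
  have lk: "Poly_Mapping.lookup (\<Sum>i<n. x i *\<^sub>R Poly_Mapping.single i (1::real)) j = (if j < n then x j else 0)"
    for x :: "nat \<Rightarrow> real" and j
  proof -
    have "Poly_Mapping.lookup (\<Sum>i<n. x i *\<^sub>R Poly_Mapping.single i (1::real)) j
        = (\<Sum>i<n. if i = j then x i else 0)"
      unfolding lookup_sum lookup_scaleR lookup_single
      by (intro sum.cong) (auto simp: when_def)
    then show ?thesis by simp
  qed
  have "matrix_range n (P l) = {(\<Sum>i<n. x i *\<^sub>R Poly_Mapping.single i (1::real)) |x.
      \<forall>i<n. x i = (\<Sum>j<n. P l i j * x j)}" for l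
  proof (intro equalityI subsetI; (elim CollectE exE conjE)?)
    fix u assume "u \<in> matrix_range n (P l)"
    then obtain x where k: "Poly_Mapping.keys u \<subseteq> {..<n}"
      and x: "\<forall>i<n. Poly_Mapping.lookup u i = (\<Sum>j<n. P l i j * x j)"
      by (auto simp: matrix_range_def)
    have "u = (\<Sum>i<n. Poly_Mapping.lookup u i *\<^sub>R Poly_Mapping.single i (1::real))"
      using k by (intro poly_mapping_eqI) (auto simp: lk in_keys_iff)
    \<comment> \<open>Idempotence turns membership in the range into being fixed: P u = P (P x) = P
      x = u.\<close>
    moreover have "Poly_Mapping.lookup u i = (\<Sum>j<n. P l i j * Poly_Mapping.lookup u j)" if i: "i < n" for i
    proof -
      have "(\<Sum>j<n. P l i j * Poly_Mapping.lookup u j) = (\<Sum>j<n. \<Sum>k<n. P l i j * P l j k * x k)"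
        using x by (auto simp: sum_distrib_left mult.assoc intro!: sum.cong)
      also have "\<dots> = (\<Sum>k<n. (\<Sum>j<n. P l i j * P l j k) * x k)"
        by (subst sum.swap) (simp add: sum_distrib_right)
      also have "\<dots> = Poly_Mapping.lookup u i"
        using P(2) x i by (auto intro!: sum.cong)
      finally show ?thesis by simp
    qed
    ultimately show "u \<in> {(\<Sum>i<n. x i *\<^sub>R Poly_Mapping.single i (1::real)) |x.
        \<forall>i<n. x i = (\<Sum>j<n. P l i j * x j)}" by blast
  next
    fix u x assume "u = (\<Sum>i<n. x i *\<^sub>R Poly_Mapping.single i (1::real))" "\<forall>i<n. x i = (\<Sum>j<n. P l i j * x j)"
    then show "u \<in> matrix_range n (P l)"
      unfolding matrix_range_def by (auto simp: lk in_keys_iff split: if_splits intro!: exI[of _ x])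
  qed
  then show ?thesis
    using P bounded_linear_lookup
    by (simp add: presentation_def lookup_single when_def of_bool_def)
qed

lemma concrete_bundle_presentation:
  assumes "concrete_bundle F"
  obtains n P where "presentation n (\<lambda>i. Poly_Mapping.single i (1::real)) (\<lambda>i u. Poly_Mapping.lookup u i) P F"
proof -
  obtain n P where *: "\<forall>i<n. \<forall>j<n. continuous_on UNIV (\<lambda>l. P l i j)"
    "\<forall>l. \<forall>i<n. \<forall>j<n. (\<Sum>k<n. P l i k * P l k j) = P l i j" "\<forall>l. F l = matrix_range n (P l)"
    using assms unfolding concrete_bundle_def by blast
  then have "F = (\<lambda>l. matrix_range n (P l))" by blast
  then show ?thesis using presentation_matrix_range[OF *(1,2)] that by blast
qed

lemma subspace_presentation:
  assumes "presentation n e c P E"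
  shows "subspace (E l)"
proof -
  have E: "E l = {(\<Sum>i<n. x i *\<^sub>R e i) |x. \<forall>i<n. x i = (\<Sum>j<n. P l i j * x j)}"
    using assms by (simp add: presentation_def)
  show ?thesis unfolding E
  proof (rule subspaceI)
    show "0 \<in> {\<Sum>i<n. x i *\<^sub>R e i |x. \<forall>i<n. x i = (\<Sum>j<n. P l i j * x j)}"
      by (intro CollectI exI[of _ "\<lambda>_. 0"]) auto
  next
    fix u v assume "u \<in> {\<Sum>i<n. x i *\<^sub>R e i |x. \<forall>i<n. x i = (\<Sum>j<n. P l i j * x j)}"
      "v \<in> {\<Sum>i<n. x i *\<^sub>R e i |x. \<forall>i<n. x i = (\<Sum>j<n. P l i j * x j)}"
    then obtain x y where "u = (\<Sum>i<n. x i *\<^sub>R e i)" "v = (\<Sum>i<n. y i *\<^sub>R e i)"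
      "\<forall>i<n. x i = (\<Sum>j<n. P l i j * x j)" "\<forall>i<n. y i = (\<Sum>j<n. P l i j * y j)" by blast
    then show "u + v \<in> {\<Sum>i<n. x i *\<^sub>R e i |x. \<forall>i<n. x i = (\<Sum>j<n. P l i j * x j)}"
      by (intro CollectI exI[of _ "\<lambda>i. x i + y i"])
        (auto simp: scaleR_add_left sum.distrib distrib_left)
  next
    fix a u assume "u \<in> {\<Sum>i<n. x i *\<^sub>R e i |x. \<forall>i<n. x i = (\<Sum>j<n. P l i j * x j)}"
    then obtain x where "u = (\<Sum>i<n. x i *\<^sub>R e i)" and x: "\<forall>i<n. x i = (\<Sum>j<n. P l i j * x j)" by blast
    moreover have "a * x i = (\<Sum>j<n. P l i j * (a * x j))" if "i < n" for i
    proof -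
      have "a * x i = a * (\<Sum>j<n. P l i j * x j)" using x that by simp
      then show ?thesis by (simp add: sum_distrib_left ac_simps)
    qed
    ultimately show "a *\<^sub>R u \<in> {\<Sum>i<n. x i *\<^sub>R e i |x. \<forall>i<n. x i = (\<Sum>j<n. P l i j * x j)}"
      by (intro CollectI exI[of _ "\<lambda>i. a * x i"]) (auto simp: scaleR_sum_right)
  qed
qed

lemma vector_bundle_presentation:
  assumes "presentation n e c P E"
  shows "vector_bundle E"
proof -
  have P: "\<forall>i<n. \<forall>j<n. continuous_on UNIV (\<lambda>l. P l i j)"
    "\<forall>l. \<forall>i<n. \<forall>j<n. (\<Sum>k<n. P l i k * P l k j) = P l i j"
    using assms by (simp_all add: presentation_def)
  have "concrete_bundle (\<lambda>l. matrix_range n (P l))"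
    using P unfolding concrete_bundle_def by blast
  with presentation_iso[OF assms presentation_matrix_range[OF P]] subspace_presentation[OF assms]
  show ?thesis unfolding vector_bundle_def by blast
qed

lemma vector_bundle_concrete: "concrete_bundle F \<Longrightarrow> vector_bundle F"
  by (erule concrete_bundle_presentation) (rule vector_bundle_presentation)

lemma vector_bundle_iso:
  assumes "vector_bundle F" "bundle_iso UNIV E F h" "\<And>l. subspace (E l)"
  shows "vector_bundle E"
  using assms bundle_iso_comp[OF assms(2)] unfolding vector_bundle_def by meson

lemma sum_lessThan_add:
  fixes f :: "nat \<Rightarrow> 'a::comm_monoid_add"
  shows "(\<Sum>i<n + m. f i) = (\<Sum>i<n. f i) + (\<Sum>i<m. f (n + i))"
  by (induction m) (auto simp: add.assoc)

lemma all_less_add: "(\<forall>i<n + m. Q i) \<longleftrightarrow> (\<forall>i<n. Q i) \<and> (\<forall>i<m. Q (n + i))" for n m :: nat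
  by (metis add_less_cancel_left le_add1 le_Suc_ex less_add_eq_less linorder_not_le nat_le_linear order_less_le_trans trans_less_add1)

text \<open>Block diagonal matrices: an index below \<open>n\<close> addresses the first summand,
  otherwise \<open>i - n\<close> addresses the second.\<close>

lemma presentation_sum:
  assumes E: "presentation n e c P E" and F: "presentation m e' c' P' F"
  shows "presentation (n + m) (\<lambda>i. if i < n then (e i, 0) else (0, e' (i - n)))
     (\<lambda>i u. if i < n then c i (fst u) else c' (i - n) (snd u))
     (\<lambda>l i j. if i < n \<and> j < n then P l i j else if \<not> i < n \<and> \<not> j < n then P' l (i - n) (j - n) else 0)
     (bundle_sum E F)"
  (is "presentation _ ?e ?c ?P _")
proof -
  have [simp]: "c i 0 = 0" if "i < n" for i
    using E that by (auto simp: presentation_def linear_simps)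
  have [simp]: "c' i 0 = 0" if "i < m" for i
    using F that by (auto simp: presentation_def linear_simps)
  have s: "(\<Sum>i<n + m. x i *\<^sub>R ?e i) = ((\<Sum>i<n. x i *\<^sub>R e i), (\<Sum>i<m. x (n + i) *\<^sub>R e' i))" for x
    by (simp add: sum_lessThan_add prod_eq_iff fst_sum snd_sum)
  have "bundle_sum E F l = {(\<Sum>i<n + m. x i *\<^sub>R ?e i) |x. \<forall>i<n+m. x i = (\<Sum>j<n+m. ?P l i j * x j)}" for l
  proof (intro equalityI subsetI; (elim CollectE exE conjE)?)
    fix w assume "w \<in> bundle_sum E F l"
    then obtain x y where w: "w = ((\<Sum>i<n. x i *\<^sub>R e i), (\<Sum>i<m. y i *\<^sub>R e' i))"
      and x: "\<forall>i<n. x i = (\<Sum>j<n. P l i j * x j)" and y: "\<forall>i<m. y i = (\<Sum>j<m. P' l i j * y j)"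
      using E F by (auto simp: presentation_def bundle_sum_def)
    define z where "z i = (if i < n then x i else y (i - n))" for i
    have "w = (\<Sum>i<n + m. z i *\<^sub>R ?e i)" unfolding s w by (simp add: z_def)
    moreover have "\<forall>i<n+m. z i = (\<Sum>j<n+m. ?P l i j * z j)"
      unfolding all_less_add sum_lessThan_add using x y by (simp add: z_def)
    ultimately show "w \<in> {(\<Sum>i<n + m. x i *\<^sub>R ?e i) |x. \<forall>i<n+m. x i = (\<Sum>j<n+m. ?P l i j * x j)}"
      by blast
  next
    fix w x assume w: "w = (\<Sum>i<n + m. x i *\<^sub>R ?e i)" and x: "\<forall>i<n+m. x i = (\<Sum>j<n+m. ?P l i j * x j)"
    have "\<forall>i<n. x i = (\<Sum>j<n. P l i j * x j)" "\<forall>i<m. x (n + i) = (\<Sum>j<m. P' l i j * x (n + j))"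
      using x unfolding all_less_add sum_lessThan_add by simp_all
    then show "w \<in> bundle_sum E F l"
      using E F unfolding w s by (auto simp: presentation_def bundle_sum_def)
  qed
  then show ?thesis
    using E F unfolding presentation_def all_less_add sum_lessThan_add
    by (simp add: bounded_linear_compose[OF _ bounded_linear_fst] bounded_linear_compose[OF _ bounded_linear_snd] zero_prod_def)
qed

lemma vector_bundle_sum:
  assumes "vector_bundle E" "vector_bundle F"
  shows "vector_bundle (bundle_sum E F)"
proof -
  obtain E' h where E': "concrete_bundle E'" "bundle_iso UNIV E E' h" "\<And>l. subspace (E l)"
    using assms unfolding vector_bundle_def by blast
  obtain F' k where F': "concrete_bundle F'" "bundle_iso UNIV F F' k" "\<And>l. subspace (F l)"
    using assms unfolding vector_bundle_def by blast
  obtain n P where "presentation n (\<lambda>i. Poly_Mapping.single i (1::real)) (\<lambda>i u. Poly_Mapping.lookup u i) P E'"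
    by (rule concrete_bundle_presentation[OF E'(1)])
  moreover obtain m Q where "presentation m (\<lambda>i. Poly_Mapping.single i (1::real)) (\<lambda>i u. Poly_Mapping.lookup u i) Q F'"
    by (rule concrete_bundle_presentation[OF F'(1)])
  ultimately have "vector_bundle (bundle_sum E' F')"
    by (intro vector_bundle_presentation[OF presentation_sum])
  then show ?thesis
  proof (rule vector_bundle_iso[OF _ bundle_iso_sum[OF E'(2) F'(2)]])
    show "subspace (bundle_sum E F l)" for l
      using E'(3) F'(3) unfolding bundle_sum_def by (rule subspace_Times)
  qed
qed

section \<open>Orthonormal bases and bundles cut out by projections\<close>

lemma orthonormal_enumeration:
  fixes S :: "'a::real_inner set"
  assumes "finite S"
  obtains n and e :: "nat \<Rightarrow> 'a" where "span (e ` {..<n}) = span S"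
    "\<And>i j. i < n \<Longrightarrow> j < n \<Longrightarrow> e i \<bullet> e j = of_bool (i = j)"
proof -
  obtain C where C: "finite C" "span C = span S" "pairwise orthogonal C"
    using basis_orthogonal[OF assms] by blast
  \<comment> \<open>An orthogonal set may contain 0, which could not be normalised.\<close>
  define D where "D = C - {0}"
  obtain f where f: "bij_betw f {..<card D} D"
    using C(1) finite_same_card_bij[of "{..<card D}" D] D_def by auto
  define e where "e i = sgn (f i)" for i
  have fD: "f i \<in> D" "f i \<noteq> 0" if "i < card D" for i
    using f that D_def by (auto simp: bij_betw_def)
  show ?thesis
  proof (rule that)
    have "span (e ` {..<card D}) = span D"
    proof
      have "e i \<in> span D" if "i < card D" for i
        unfolding e_def sgn_div_norm by (intro span_mul span_base fD that)
      then show "span (e ` {..<card D}) \<subseteq> span D" by (intro span_minimal) auto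
      have "v \<in> span (e ` {..<card D})" if "v \<in> D" for v
      proof -
        obtain i where i: "i < card D" "v = f i"
          using f \<open>v \<in> D\<close> by (auto simp: bij_betw_def)
        have "v = norm v *\<^sub>R e i" using fD[OF i(1)] i by (simp add: e_def sgn_div_norm)
        then show ?thesis using i by (metis imageI lessThan_iff span_base span_mul)
      qed
      then show "span D \<subseteq> span (e ` {..<card D})" by (intro span_minimal) auto
    qed
    then show "span (e ` {..<card D}) = span S" using C by (simp add: D_def)
    fix i j assume ij: "i < card D" "j < card D"
    show "e i \<bullet> e j = of_bool (i = j)"
    proof (cases "i = j")
      case True
      then show ?thesis using fD[OF ij(1)]
        by (simp add: e_def sgn_div_norm power2_norm_eq_inner[symmetric] power2_eq_square)
    next
      case False
      then have "f i \<noteq> f j" using f ij by (auto simp: bij_betw_def inj_on_def)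
      then have "f i \<bullet> f j = 0"
        using C(3) fD[OF ij(1)] fD[OF ij(2)] by (auto simp: pairwise_def D_def orthogonal_def)
      then show ?thesis using False by (simp add: e_def sgn_div_norm)
    qed
  qed
qed

lemma span_image_lessThan:
  "v \<in> span (e ` {..<n::nat}) \<Longrightarrow> \<exists>x. v = (\<Sum>i<n. x i *\<^sub>R e i)" for e :: "nat \<Rightarrow> 'a::real_vector"
proof (induction rule: span_induct_alt)
  case base
  show ?case by (rule exI[of _ "\<lambda>_. 0"]) simp
next
  case (step a u v)
  then obtain i x where "i < n" "u = e i" and v: "v = (\<Sum>i<n. x i *\<^sub>R e i)" by auto
  have "a *\<^sub>R u = (\<Sum>j<n. (if j = i then a else 0) *\<^sub>R e j)"
    using \<open>i < n\<close> \<open>u = e i\<close> by (simp add: if_distrib[of "\<lambda>a. a *\<^sub>R _"] cong: if_cong)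
  then have "a *\<^sub>R u + v = (\<Sum>j<n. ((if j = i then a else 0) + x j) *\<^sub>R e j)"
    by (simp add: v scaleR_add_left sum.distrib)
  then show ?case by (rule exI[of _ "\<lambda>j. (if j = i then a else 0) + x j"])
qed

text \<open>The matrix of \<open>Q l\<close> in an orthonormal basis of \<open>span S\<close> is a
  continuous family of idempotents, so the ranges form a bundle without any local trivialisation.
  Being a projection is required on \<open>span S\<close> only; the ambient space may have infinite
  dimension.\<close>

lemma vector_bundle_projections:
  fixes Q :: "'l::topological_space \<Rightarrow> 'a::real_inner \<Rightarrow> 'a"
  assumes S: "finite S" and lin: "\<And>l. linear (Q l)"
    and inv: "\<And>l u. u \<in> span S \<Longrightarrow> Q l u \<in> span S"
    and idem: "\<And>l u. u \<in> span S \<Longrightarrow> Q l (Q l u) = Q l u"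
    and cont: "\<And>u. u \<in> span S \<Longrightarrow> continuous_on UNIV (\<lambda>l. Q l u)"
  shows "vector_bundle (\<lambda>l. Q l ` span S)"
proof -
  obtain n and e :: "nat \<Rightarrow> 'a" where e: "span (e ` {..<n}) = span S"
    "\<And>i j. i < n \<Longrightarrow> j < n \<Longrightarrow> e i \<bullet> e j = of_bool (i = j)"
    using orthonormal_enumeration[OF S] by metis
  have eS: "e i \<in> span S" if "i < n" for i
    using that e(1) span_base[of "e i" "e ` {..<n}"] by auto
  have sumS: "(\<Sum>i<n. x i *\<^sub>R e i) \<in> span S" for x
    by (intro span_sum span_mul eS) auto
  have coord: "e i \<bullet> (\<Sum>j<n. x j *\<^sub>R e j) = x i" if "i < n" for i x
  proof -
    have "e i \<bullet> (\<Sum>j<n. x j *\<^sub>R e j) = (\<Sum>j<n. if i = j then x j else 0)"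
      unfolding inner_sum_right using that by (intro sum.cong) (auto simp: e)
    then show ?thesis using that by simp
  qed
  have ex: "u = (\<Sum>i<n. (e i \<bullet> u) *\<^sub>R e i)" if u: "u \<in> span S" for u
  proof -
    obtain x where "u = (\<Sum>i<n. x i *\<^sub>R e i)"
      using span_image_lessThan[of u e n] u e(1) by auto
    then show ?thesis using coord by simp
  qed
  have Qe: "e i \<bullet> Q l (\<Sum>j<n. x j *\<^sub>R e j) = (\<Sum>j<n. (e i \<bullet> Q l (e j)) * x j)" for l x i
    by (simp add: linear_sum[OF lin] linear_scale[OF lin] inner_sum_right mult.commute)
  have "presentation n e (\<lambda>i u. e i \<bullet> u) (\<lambda>l i j. e i \<bullet> Q l (e j)) (\<lambda>l. Q l ` span S)"
    unfolding presentation_def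
  proof (intro conjI allI impI)
    show "bounded_linear (\<lambda>u. e i \<bullet> u)" for i by (rule bounded_linear_inner_right)
    show "e i \<bullet> e j = of_bool (i = j)" if "i < n" "j < n" for i j by (rule e(2)[OF that])
    show "continuous_on UNIV (\<lambda>l. e i \<bullet> Q l (e j))" if "j < n" for i j
      by (intro continuous_intros cont eS that)
    show "(\<Sum>k<n. (e i \<bullet> Q l (e k)) * (e k \<bullet> Q l (e j))) = e i \<bullet> Q l (e j)" if "j < n" for l i j
      using Qe[of i l "\<lambda>k. e k \<bullet> Q l (e j)"]
      unfolding ex[OF inv[OF eS[OF that], of l], symmetric] idem[OF eS[OF that], of l] by simp
    show "Q l ` span S = {\<Sum>i<n. x i *\<^sub>R e i |x. \<forall>i<n. x i = (\<Sum>j<n. (e i \<bullet> Q l (e j)) * x j)}" for l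
    proof (intro equalityI subsetI; (elim CollectE exE conjE imageE)?)
      fix w u assume w: "w = Q l u" and u: "u \<in> span S"
      have *: "e i \<bullet> w = (\<Sum>j<n. (e i \<bullet> Q l (e j)) * (e j \<bullet> w))" for i
        using Qe[of i l "\<lambda>k. e k \<bullet> w"]
        unfolding w ex[OF inv[OF u, of l], symmetric] idem[OF u] by simp
      show "w \<in> {\<Sum>i<n. x i *\<^sub>R e i |x. \<forall>i<n. x i = (\<Sum>j<n. (e i \<bullet> Q l (e j)) * x j)}"
        by (intro CollectI exI[of _ "\<lambda>i. e i \<bullet> w"] conjI allI impI *)
          (use ex[OF inv[OF u, of l], folded w] in assumption)
    next
      fix w x assume w: "w = (\<Sum>i<n. x i *\<^sub>R e i)" and x: "\<forall>i<n. x i = (\<Sum>j<n. (e i \<bullet> Q l (e j)) * x j)"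
      have wS: "w \<in> span S" unfolding w by (rule sumS)
      have "e i \<bullet> Q l w = x i" if "i < n" for i using Qe[of i l x] x that w by simp
      then have "Q l w = w"
        by (subst ex[OF inv[OF wS]]) (simp add: w)
      then show "w \<in> Q l ` span S" using wS by (metis imageI)
    qed
  qed
  then show ?thesis by (rule vector_bundle_presentation)
qed

lemma vector_bundle_product:
  fixes V :: "'a::real_inner set"
  assumes "finite_dim_subspace V"
  shows "vector_bundle (product_bundle V :: ('l::topological_space, 'a) family)"
proof -
  obtain S where S: "finite S" "V = span S" using assms by (auto simp: finite_dim_subspace_def)
  have "vector_bundle (\<lambda>l::'l. (\<lambda>u. u) ` span S)"
    by (rule vector_bundle_projections[OF S(1)]) (auto simp: linear_iff)
  then show ?thesis by (simp add: product_bundle_def S)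
qed

section \<open>Equivalence of triples\<close>

text \<open>Triviality is the condition of a triple relative to the whole base, so statements about
  triples over an arbitrary \<open>B\<close> cover trivial triples as well.\<close>

lemma trivial_triple_eq: "trivial_triple \<xi> = KO_triple UNIV \<xi>"
  by (cases \<xi>) (auto simp: bundle_iso_def)

lemma KO_triple_subset: "KO_triple B \<xi> \<Longrightarrow> B' \<subseteq> B \<Longrightarrow> KO_triple B' \<xi>"
  by (cases \<xi>) (auto intro: bundle_iso_subset)

lemma triple_iso_subset: "triple_iso B \<xi> \<zeta> \<Longrightarrow> B' \<subseteq> B \<Longrightarrow> triple_iso B' \<xi> \<zeta>"
proof -
  obtain E0 E1 h F0 F1 k where *: "\<xi> = (E0, E1, h)" "\<zeta> = (F0, F1, k)"
    by (metis prod_cases3)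
  show "triple_iso B \<xi> \<zeta> \<Longrightarrow> B' \<subseteq> B \<Longrightarrow> triple_iso B' \<xi> \<zeta>"
    unfolding * triple_iso.simps by blast
qed

lemma triple_iso_refl: "triple_iso B \<xi> \<xi>"
  by (cases \<xi>) (auto intro!: exI[of _ "\<lambda>l u. u"] bundle_iso_id)

lemma triple_iso_trans:
  assumes "triple_iso B \<xi> \<xi>'" "triple_iso B \<xi>' \<xi>''"
  shows "triple_iso B \<xi> \<xi>''"
proof -
  obtain E0 E1 h F0 F1 k G0 G1 m where [simp]: "\<xi> = (E0, E1, h)" "\<xi>' = (F0, F1, k)" "\<xi>'' = (G0, G1, m)"
    by (metis prod_cases3)
  obtain p0 p1 where p: "bundle_iso UNIV E0 F0 p0" "bundle_iso UNIV E1 F1 p1"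
    "\<And>l u. l \<in> B \<Longrightarrow> u \<in> E0 l \<Longrightarrow> k l (p0 l u) = p1 l (h l u)"
    using assms(1) by auto
  obtain q0 q1 where q: "bundle_iso UNIV F0 G0 q0" "bundle_iso UNIV F1 G1 q1"
    "\<And>l u. l \<in> B \<Longrightarrow> u \<in> F0 l \<Longrightarrow> m l (q0 l u) = q1 l (k l u)"
    using assms(2) by auto
  have "p0 l u \<in> F0 l" if "u \<in> E0 l" for l u
    using p(1) that by (auto simp: bundle_iso_def bundle_hom_def)
  then have "\<forall>l\<in>B. \<forall>u\<in>E0 l. m l (q0 l (p0 l u)) = q1 l (p1 l (h l u))"
    using p(3) q(3) by simp
  with bundle_iso_comp[OF p(1) q(1)] bundle_iso_comp[OF p(2) q(2)] show ?thesis
    unfolding \<open>\<xi> = _\<close> \<open>\<xi>'' = _\<close> triple_iso.simps by blast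
qed

text \<open>The inverse isomorphisms commute with \<open>h\<close> and \<open>k\<close> because
  \<open>h\<close> maps into \<open>E1\<close>, where \<open>q1\<close> inverts \<open>p1\<close>.
  That mapping property comes from \<open>KO_triple B' \<xi>\<close> and holds over the whole base,
  whence the separate set \<open>B'\<close>.\<close>

lemma triple_iso_sym:
  assumes "triple_iso B \<xi> \<xi>'" and "KO_triple B' \<xi>"
  shows "triple_iso B \<xi>' \<xi>"
proof -
  obtain E0 E1 h F0 F1 k where [simp]: "\<xi> = (E0, E1, h)" "\<xi>' = (F0, F1, k)"
    by (metis prod_cases3)
  obtain p0 p1 where p: "bundle_iso UNIV E0 F0 p0" "bundle_iso UNIV E1 F1 p1"
    "\<And>l u. l \<in> B \<Longrightarrow> u \<in> E0 l \<Longrightarrow> k l (p0 l u) = p1 l (h l u)"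
    using assms(1) by auto
  obtain q0 where q0: "bundle_hom UNIV F0 E0 q0" "\<And>l v. v \<in> F0 l \<Longrightarrow> p0 l (q0 l v) = v"
      "bundle_iso UNIV F0 E0 q0"
    using p(1) by (rule bundle_isoE) auto
  obtain q1 where q1: "\<And>l u. u \<in> E1 l \<Longrightarrow> q1 l (p1 l u) = u" "bundle_iso UNIV F1 E1 q1"
    using p(2) by (rule bundle_isoE) auto
  have "h l (q0 l v) = q1 l (k l v)" if "l \<in> B" "v \<in> F0 l" for l v
  proof -
    have q: "q0 l v \<in> E0 l" using q0(1) that by (auto simp: bundle_hom_def)
    then have "h l (q0 l v) \<in> E1 l" using assms(2) by (auto simp: bundle_hom_def)
    then have "h l (q0 l v) = q1 l (p1 l (h l (q0 l v)))" using q1 by simp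
    also have "\<dots> = q1 l (k l v)" using p(3)[OF that(1) q] q0(2) that by simp
    finally show ?thesis .
  qed
  with q0(3) q1(2) show ?thesis
    unfolding \<open>\<xi> = _\<close> \<open>\<xi>' = _\<close> triple_iso.simps by blast
qed

lemma triple_iso_sum:
  assumes "triple_iso B \<xi> \<xi>'" "triple_iso B \<eta> \<eta>'"
  shows "triple_iso B (triple_sum \<xi> \<eta>) (triple_sum \<xi>' \<eta>')"
proof -
  obtain E0 E1 h F0 F1 k where [simp]: "\<xi> = (E0, E1, h)" "\<xi>' = (F0, F1, k)"
    by (metis prod_cases3)
  obtain G0 G1 m H0 H1 n where [simp]: "\<eta> = (G0, G1, m)" "\<eta>' = (H0, H1, n)"
    by (metis prod_cases3)
  obtain p0 p1 where p: "bundle_iso UNIV E0 F0 p0" "bundle_iso UNIV E1 F1 p1"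
    "\<And>l u. l \<in> B \<Longrightarrow> u \<in> E0 l \<Longrightarrow> k l (p0 l u) = p1 l (h l u)"
    using assms(1) by auto
  obtain q0 q1 where q: "bundle_iso UNIV G0 H0 q0" "bundle_iso UNIV G1 H1 q1"
    "\<And>l u. l \<in> B \<Longrightarrow> u \<in> G0 l \<Longrightarrow> n l (q0 l u) = q1 l (m l u)"
    using assms(2) by auto
  have "\<forall>l\<in>B. \<forall>w\<in>bundle_sum E0 G0 l. (case case w of (u, v) \<Rightarrow> (p0 l u, q0 l v) of (u, v) \<Rightarrow> (k l u, n l v)) =
      (case case w of (u, v) \<Rightarrow> (h l u, m l v) of (u, v) \<Rightarrow> (p1 l u, q1 l v))"
    using p(3) q(3) by (auto simp: bundle_sum_def)
  with bundle_iso_sum[OF p(1) q(1)] bundle_iso_sum[OF p(2) q(2)]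
  show ?thesis unfolding \<open>\<xi> = _\<close> \<open>\<xi>' = _\<close> \<open>\<eta> = _\<close> \<open>\<eta>' = _\<close> triple_sum.simps triple_iso.simps by blast
qed

lemma triple_iso_assoc:
  "triple_iso B (triple_sum (triple_sum \<xi> \<eta>) \<theta>) (triple_sum \<xi> (triple_sum \<eta> \<theta>))"
proof -
  obtain E0 E1 h F0 F1 k G0 G1 m where *: "\<xi> = (E0, E1, h)" "\<eta> = (F0, F1, k)" "\<theta> = (G0, G1, m)"
    by (metis prod_cases3)
  show ?thesis
    unfolding * triple_sum.simps triple_iso.simps
    by (intro exI conjI, rule bundle_iso_assoc, rule bundle_iso_assoc) auto
qed

lemma triple_iso_right_commute:
  "triple_iso B (triple_sum (triple_sum \<xi> \<eta>) \<theta>) (triple_sum (triple_sum \<xi> \<theta>) \<eta>)"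
proof -
  obtain E0 E1 h F0 F1 k G0 G1 m where *: "\<xi> = (E0, E1, h)" "\<eta> = (F0, F1, k)" "\<theta> = (G0, G1, m)"
    by (metis prod_cases3)
  show ?thesis
    unfolding * triple_sum.simps triple_iso.simps
    by (intro exI conjI, rule bundle_iso_right_commute, rule bundle_iso_right_commute) auto
qed

lemma KO_triple_sum:
  assumes "KO_triple B \<xi>" "KO_triple B \<eta>"
  shows "KO_triple B (triple_sum \<xi> \<eta>)"
proof -
  obtain E0 E1 h F0 F1 k where \<xi>: "\<xi> = (E0, E1, h)" and \<eta>: "\<eta> = (F0, F1, k)"
    by (metis prod_cases3)
  show ?thesis
    using assms unfolding \<xi> \<eta> triple_sum.simps KO_triple.simps
    by (elim conjE, intro conjI vector_bundle_sum bundle_hom_sum bundle_iso_sum)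
qed

text \<open>Conjugating \<open>h\<close> with the isomorphisms in the definition of
  \<open>vector_bundle\<close> moves the triple to concrete bundles. Even a sum of concrete triples
  has to be moved back in this way, since it lies in a product of ambient spaces.\<close>

lemma KO_triple_iso_concrete:
  assumes "KO_triple B \<xi>"
  obtains \<zeta> where "concrete_triple \<zeta>" "KO_triple B \<zeta>" "triple_iso UNIV \<xi> \<zeta>"
proof -
  obtain E0 E1 h where \<xi>: "\<xi> = (E0, E1, h)" by (rule prod_cases3)
  have E: "vector_bundle E0" "vector_bundle E1" "bundle_hom UNIV E0 E1 h" "bundle_iso B E0 E1 h"
    using assms \<xi> by auto
  obtain F0 p0 where F0: "concrete_bundle F0" "bundle_iso UNIV E0 F0 p0"
    using E(1) by (auto simp: vector_bundle_def)
  obtain F1 p1 where F1: "concrete_bundle F1" "bundle_iso UNIV E1 F1 p1"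
    using E(2) by (auto simp: vector_bundle_def)
  obtain q0 where q0: "bundle_hom UNIV F0 E0 q0" "bundle_iso UNIV F0 E0 q0"
    "\<And>l u. u \<in> E0 l \<Longrightarrow> q0 l (p0 l u) = u"
    using F0(2) by (rule bundle_isoE) auto
  have p1: "bundle_hom UNIV E1 F1 p1" using F1(2) by (simp add: bundle_iso_def)
  define k where "k l v = p1 l (h l (q0 l v))" for l v
  show ?thesis
  proof
    show "concrete_triple (F0, F1, k)" using F0 F1 by simp
    show "KO_triple B (F0, F1, k)"
      using vector_bundle_concrete[OF F0(1)] vector_bundle_concrete[OF F1(1)]
        bundle_hom_comp[OF bundle_hom_comp[OF q0(1) E(3)] p1]
        bundle_iso_comp[OF bundle_iso_comp[OF bundle_iso_subset[OF q0(2)] E(4)] bundle_iso_subset[OF F1(2)]]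
      by (simp add: k_def[abs_def])
    show "triple_iso UNIV \<xi> (F0, F1, k)"
      unfolding \<xi> triple_iso.simps k_def
      by (intro exI[of _ p0] exI[of _ p1]) (simp add: F0(2) F1(2) q0(3))
  qed
qed

lemma KO_triple_sum_trivial:
  "KO_triple B \<xi> \<Longrightarrow> KO_triple UNIV \<eta> \<Longrightarrow> KO_triple B (triple_sum \<xi> \<eta>)"
  by (intro KO_triple_sum KO_triple_subset[of UNIV \<eta> B]) auto

lemma KO_equiv_sym:
  assumes "KO_equiv B \<xi> \<zeta>"
  shows "KO_equiv B \<zeta> \<xi>"
proof -
  obtain \<eta> \<eta>' where \<eta>: "concrete_triple \<eta>" "KO_triple UNIV \<eta>" "concrete_triple \<eta>'" "KO_triple UNIV \<eta>'"
    "triple_iso B (triple_sum \<xi> \<eta>) (triple_sum \<zeta> \<eta>')"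
    using assms unfolding KO_equiv_def trivial_triple_eq by blast
  have K: "KO_triple B \<xi>" "KO_triple B \<zeta>"
    using assms unfolding KO_equiv_def by auto
  show ?thesis
    using K \<eta> triple_iso_sym[OF \<eta>(5) KO_triple_sum_trivial[OF K(1) \<eta>(2)]]
    unfolding KO_equiv_def trivial_triple_eq by blast
qed

text \<open>Stabilise the first isomorphism by \<theta> and the second by \<eta>': both then pass
  through \<xi>' + \<eta>' + \<theta>. The stabilisers \<eta> + \<theta> and \<theta>' + \<eta>' lie
  in a product of ambient spaces, hence the detour through the isomorphic concrete triples
  \<open>\<kappa>\<close> and \<open>\<kappa>'\<close>.\<close>

lemma KO_equiv_trans:
  assumes 1: "KO_equiv B \<xi> \<xi>'" and 2: "KO_equiv B \<xi>' \<zeta>"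
  shows "KO_equiv B \<xi> \<zeta>"
proof -
  obtain \<eta> \<eta>' where \<eta>: "concrete_triple \<eta>" "KO_triple UNIV \<eta>" "concrete_triple \<eta>'" "KO_triple UNIV \<eta>'"
    "triple_iso B (triple_sum \<xi> \<eta>) (triple_sum \<xi>' \<eta>')"
    using 1 unfolding KO_equiv_def trivial_triple_eq by blast
  obtain \<theta> \<theta>' where \<theta>: "concrete_triple \<theta>" "KO_triple UNIV \<theta>" "concrete_triple \<theta>'" "KO_triple UNIV \<theta>'"
    "triple_iso B (triple_sum \<xi>' \<theta>) (triple_sum \<zeta> \<theta>')"
    using 2 unfolding KO_equiv_def trivial_triple_eq by blast
  have K: "KO_triple B \<xi>" "KO_triple B \<zeta>"
    using 1 2 unfolding KO_equiv_def by auto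
  obtain \<kappa> where \<kappa>: "concrete_triple \<kappa>" "KO_triple UNIV \<kappa>" "triple_iso UNIV (triple_sum \<eta> \<theta>) \<kappa>"
    by (rule KO_triple_iso_concrete[OF KO_triple_sum[OF \<eta>(2) \<theta>(2)]])
  obtain \<kappa>' where \<kappa>': "concrete_triple \<kappa>'" "KO_triple UNIV \<kappa>'" "triple_iso UNIV (triple_sum \<theta>' \<eta>') \<kappa>'"
    by (rule KO_triple_iso_concrete[OF KO_triple_sum[OF \<theta>(4) \<eta>(4)]])
  have 0: "triple_iso B (triple_sum \<xi> \<kappa>) (triple_sum \<xi> (triple_sum \<eta> \<theta>))"
    by (rule triple_iso_sum[OF triple_iso_refl triple_iso_subset[OF
          triple_iso_sym[OF \<kappa>(3) KO_triple_sum[OF \<eta>(2) \<theta>(2)]]]]) simp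
  have a: "triple_iso B (triple_sum \<xi> (triple_sum \<eta> \<theta>)) (triple_sum (triple_sum \<xi> \<eta>) \<theta>)"
    by (rule triple_iso_sym[OF triple_iso_assoc KO_triple_sum_trivial[OF
          KO_triple_sum_trivial[OF K(1) \<eta>(2)] \<theta>(2)]])
  have b: "triple_iso B (triple_sum (triple_sum \<xi> \<eta>) \<theta>) (triple_sum (triple_sum \<xi>' \<eta>') \<theta>)"
    by (rule triple_iso_sum[OF \<eta>(5) triple_iso_refl])
  have c: "triple_iso B (triple_sum (triple_sum \<xi>' \<theta>) \<eta>') (triple_sum (triple_sum \<zeta> \<theta>') \<eta>')"
    by (rule triple_iso_sum[OF \<theta>(5) triple_iso_refl])
  have d: "triple_iso B (triple_sum \<zeta> (triple_sum \<theta>' \<eta>')) (triple_sum \<zeta> \<kappa>')"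
    by (rule triple_iso_sum[OF triple_iso_refl triple_iso_subset[OF \<kappa>'(3)]]) simp
  have "triple_iso B (triple_sum \<xi> \<kappa>) (triple_sum \<zeta> \<kappa>')"
    by (rule triple_iso_trans[OF 0 triple_iso_trans[OF a triple_iso_trans[OF b
      triple_iso_trans[OF triple_iso_right_commute triple_iso_trans[OF c
      triple_iso_trans[OF triple_iso_assoc d]]]]]])
  then show ?thesis
    using K \<kappa> \<kappa>' unfolding KO_equiv_def trivial_triple_eq by blast
qed

lemma KO_class_eq: "KO_equiv B \<xi> \<xi>' \<Longrightarrow> KO_class B \<xi> = KO_class B \<xi>'"
  unfolding KO_class_def by (auto intro: KO_equiv_trans KO_equiv_sym)

lemma concrete_zero_triple: "concrete_triple (\<lambda>_. {0}, \<lambda>_. {0}, \<lambda>_ u. u)"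
proof -
  have "matrix_range 0 M = {0}" for M by (auto simp: matrix_range_def)
  then show ?thesis unfolding concrete_triple.simps concrete_bundle_def
    by (auto intro!: exI[of _ 0])
qed

lemma KO_equiv_of_iso:
  assumes "KO_triple B \<xi>" "KO_triple B \<zeta>" "triple_iso B \<xi> \<zeta>"
  shows "KO_equiv B \<xi> \<zeta>"
proof -
  have "trivial_triple ((\<lambda>_. {0}, \<lambda>_. {0}, \<lambda>_ u. u) :: ('a, Rinf, Rinf) triple)"
    using concrete_zero_triple by (auto intro: vector_bundle_concrete bundle_iso_id)
  then show ?thesis
    using assms triple_iso_sum[OF assms(3) triple_iso_refl] concrete_zero_triple
    unfolding KO_equiv_def by blast
qed

lemma KO_class_in_KO:
  assumes "KO_triple B \<xi>"
  shows "KO_class B \<xi> \<in> KO B"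
proof -
  obtain \<zeta> where \<zeta>: "concrete_triple \<zeta>" "KO_triple B \<zeta>" "triple_iso UNIV \<xi> \<zeta>"
    by (rule KO_triple_iso_concrete[OF assms])
  then have "KO_class B \<xi> = KO_class B \<zeta>"
    by (intro KO_class_eq KO_equiv_of_iso assms triple_iso_subset[OF \<zeta>(3)]) auto
  with \<zeta> show ?thesis unfolding KO_def by blast
qed

text \<open>Replacing the stabilisers by concrete copies changes the sums only up to isomorphism. In
  the application they are the identities of R^d and of a subspace V of L^2, neither of which is
  concrete.\<close>

lemma KO_equiv_stable_iso:
  assumes \<xi>: "KO_triple B \<xi>" "KO_triple B \<zeta>" and \<eta>: "trivial_triple \<eta>" "trivial_triple \<theta>"
    and iso: "triple_iso B (triple_sum \<xi> \<eta>) (triple_sum \<zeta> \<theta>)"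
  shows "KO_equiv B \<xi> \<zeta>"
proof -
  obtain \<eta>' where \<eta>': "concrete_triple \<eta>'" "trivial_triple \<eta>'" "triple_iso UNIV \<eta> \<eta>'"
    using KO_triple_iso_concrete \<eta>(1) unfolding trivial_triple_eq by metis
  obtain \<theta>' where \<theta>': "concrete_triple \<theta>'" "trivial_triple \<theta>'" "triple_iso UNIV \<theta> \<theta>'"
    using KO_triple_iso_concrete \<eta>(2) unfolding trivial_triple_eq by metis
  have "triple_iso B (triple_sum \<xi> \<eta>') (triple_sum \<xi> \<eta>)"
    using \<eta>(1) unfolding trivial_triple_eq
    by (intro triple_iso_sum triple_iso_refl triple_iso_subset[OF triple_iso_sym[OF \<eta>'(3)]]) auto
  moreover have "triple_iso B (triple_sum \<zeta> \<theta>) (triple_sum \<zeta> \<theta>')"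
    by (intro triple_iso_sum triple_iso_refl triple_iso_subset[OF \<theta>'(3)]) auto
  ultimately have "triple_iso B (triple_sum \<xi> \<eta>') (triple_sum \<zeta> \<theta>')"
    by (blast intro: iso triple_iso_trans)
  then show ?thesis using \<xi> \<eta>' \<theta>' unfolding KO_equiv_def by blast
qed

section \<open>Families of bounded linear maps\<close>

text \<open>If T p is within 1/(2C') of T0, then norm u \<le> C' norm (T0 u) \<le> C' norm (T p u) +
  norm u / 2, so T p is bounded below with the constant 2C'. Applied to u = w p - w0, whose image
  under T p is z p - T p w0, this forces convergence.\<close>

lemma tendsto_inverse_bounded_below:
  fixes T :: "'p \<Rightarrow> 'a::real_normed_vector \<Rightarrow>\<^sub>L 'b::real_normed_vector"
  assumes T: "(T \<longlongrightarrow> T0) F" and z: "(z \<longlongrightarrow> blinfun_apply T0 w0) F"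
    and w: "eventually (\<lambda>p. blinfun_apply (T p) (w p) = z p) F"
    and C: "\<And>u. norm u \<le> C * norm (blinfun_apply T0 u)"
  shows "(w \<longlongrightarrow> w0) F"
proof -
  define C' where "C' = max C 1"
  have C': "C' > 0" "norm u \<le> C' * norm (blinfun_apply T0 u)" for u
    using C[of u] mult_right_mono[of C C' "norm (blinfun_apply T0 u)"] by (auto simp: C'_def)
  have ev: "eventually (\<lambda>p. dist (T p) T0 < 1 / (2 * C')) F"
    using C'(1) by (intro tendstoD[OF T]) simp
  have "((\<lambda>p. 2 * C' * norm (z p - blinfun_apply (T p) w0)) \<longlongrightarrow>
      2 * C' * norm (blinfun_apply T0 w0 - blinfun_apply T0 w0)) F"
    by (intro tendsto_intros T z)
  then have lim: "((\<lambda>p. 2 * C' * norm (z p - blinfun_apply (T p) w0)) \<longlongrightarrow> 0) F"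
    by simp
  have "((\<lambda>p. w p - w0) \<longlongrightarrow> 0) F"
  proof (rule Lim_null_comparison[OF _ lim])
    show "\<forall>\<^sub>F p in F. norm (w p - w0) \<le> 2 * C' * norm (z p - blinfun_apply (T p) w0)"
      using ev w
    proof eventually_elim
      case (elim p)
      define u where "u = w p - w0"
      have "norm (blinfun_apply (T0 - T p) u) \<le> norm (T0 - T p) * norm u"
        by (rule norm_blinfun)
      also have "\<dots> \<le> 1 / (2 * C') * norm u"
        using elim(1) by (intro mult_right_mono) (auto simp: dist_norm norm_minus_commute)
      finally have "norm (blinfun_apply T0 u) \<le> norm (blinfun_apply (T p) u) + 1 / (2 * C') * norm u"
        using norm_triangle_sub[of "blinfun_apply T0 u" "blinfun_apply (T p) u"]
        by (simp add: blinfun.diff_left)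
      then have "C' * norm (blinfun_apply T0 u) \<le> C' * norm (blinfun_apply (T p) u) + norm u / 2"
        using mult_left_mono[OF _ less_imp_le[OF C'(1)]] C'(1) by (force simp: field_simps)
      with C'(2)[of u] have "norm u \<le> 2 * C' * norm (blinfun_apply (T p) u)" by linarith
      then show ?case using elim(2) by (simp add: u_def blinfun.diff_right)
    qed
  qed
  then show ?thesis by (simp add: LIM_zero_iff)
qed

lemma inj_bounded_below:
  assumes "\<And>u. norm u \<le> C * norm (blinfun_apply T u)"
  shows "inj (blinfun_apply T)"
proof (rule injI)
  fix x y assume "blinfun_apply T x = blinfun_apply T y"
  then show "x = y" using assms[of "x - y"] by (simp add: blinfun.diff_right)
qed

text \<open>No completeness is needed here: the lower bound at a point gives one nearby.\<close>

lemma continuous_on_inverse_bounded_below: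
  fixes T :: "'l::topological_space \<Rightarrow> 'a::real_normed_vector \<Rightarrow>\<^sub>L 'b::real_normed_vector"
  assumes T: "continuous_on B T"
    and C: "\<And>l. l \<in> B \<Longrightarrow> \<exists>C. \<forall>u. norm u \<le> C * norm (blinfun_apply (T l) u)"
  shows "continuous_on (Sigma B (\<lambda>l. range (blinfun_apply (T l))))
           (\<lambda>p. inv (blinfun_apply (T (fst p))) (snd p))"
  unfolding continuous_on_def
proof
  fix p assume p: "p \<in> Sigma B (\<lambda>l. range (blinfun_apply (T l)))" (is "p \<in> ?S")
  have "fst p \<in> B" using p by auto
  then obtain C where C': "\<And>u. norm u \<le> C * norm (blinfun_apply (T (fst p)) u)"
    using C by blast
  define w0 where "w0 = inv (blinfun_apply (T (fst p))) (snd p)"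
  have w0: "blinfun_apply (T (fst p)) w0 = snd p"
    using p by (auto simp: w0_def f_inv_into_f)
  have 1: "((\<lambda>q. T (fst q)) \<longlongrightarrow> T (fst p)) (at p within ?S)"
    using continuous_on_compose2[OF T continuous_on_fst[OF continuous_on_id], of ?S] p
    unfolding continuous_on_def by fastforce
  have 2: "(snd \<longlongrightarrow> blinfun_apply (T (fst p)) w0) (at p within ?S)"
    unfolding w0 by (intro tendsto_intros)
  have 3: "\<forall>\<^sub>F q in at p within ?S.
      blinfun_apply (T (fst q)) (inv (blinfun_apply (T (fst q))) (snd q)) = snd q"
    unfolding eventually_at_filter by (intro always_eventually) (auto simp: f_inv_into_f)
  show "((\<lambda>q. inv (blinfun_apply (T (fst q))) (snd q)) \<longlongrightarrow>
      inv (blinfun_apply (T (fst p))) (snd p)) (at p within ?S)"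
    unfolding w0_def[symmetric] by (rule tendsto_inverse_bounded_below[OF 1 2 3 C'])
qed

section \<open>Linear families on Euclidean spaces and dimensions of ranges\<close>

lemma linear_norm_le_sum_Basis:
  fixes f :: "'a::euclidean_space \<Rightarrow> 'b::real_normed_vector"
  assumes "linear f"
  shows "norm (f x) \<le> (\<Sum>i\<in>Basis. norm (f i)) * norm x"
proof -
  have "f x = f (\<Sum>i\<in>Basis. (x \<bullet> i) *\<^sub>R i)" by (simp add: euclidean_representation)
  also have "\<dots> = (\<Sum>i\<in>Basis. (x \<bullet> i) *\<^sub>R f i)"
    by (simp add: linear_sum[OF assms] linear_scale[OF assms])
  finally have e: "f x = (\<Sum>i\<in>Basis. (x \<bullet> i) *\<^sub>R f i)" .
  have "norm (f x) \<le> (\<Sum>i\<in>Basis. norm ((x \<bullet> i) *\<^sub>R f i))"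
    unfolding e by (rule norm_sum)
  also have "\<dots> \<le> (\<Sum>i\<in>Basis. norm x * norm (f i))"
    by (intro sum_mono) (auto simp: Basis_le_norm intro!: mult_right_mono)
  finally show ?thesis by (simp add: sum_distrib_left mult.commute)
qed

text \<open>Expansion in the standard basis writes \<open>f l x\<close> as a finite sum of
  continuous terms, so separate continuity becomes joint continuity.\<close>

lemma continuous_on_linear_family:
  fixes f :: "'l::topological_space \<Rightarrow> 'a::euclidean_space \<Rightarrow> 'b::real_normed_vector"
  assumes lin: "\<And>l. linear (f l)" and cont: "\<And>x. continuous_on UNIV (\<lambda>l. f l x)"
    and g: "continuous_on S g" and h: "continuous_on S h"
  shows "continuous_on S (\<lambda>p. f (g p) (h p))"
proof -
  have *: "f l x = (\<Sum>i\<in>Basis. (x \<bullet> i) *\<^sub>R f l i)" for l x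
  proof -
    have "f l x = f l (\<Sum>i\<in>Basis. (x \<bullet> i) *\<^sub>R i)" by (simp add: euclidean_representation)
    then show ?thesis by (simp add: linear_sum[OF lin] linear_scale[OF lin])
  qed
  have "continuous_on S (\<lambda>p. f (g p) i)" for i
    by (rule continuous_on_compose2[OF cont g]) auto
  then show ?thesis
    by (subst *) (intro continuous_intros h)
qed

text \<open>On a Euclidean domain, convergence of the values on basis vectors is convergence in
  operator norm.\<close>

lemma continuous_on_Blinfun_family:
  fixes f :: "'l::topological_space \<Rightarrow> 'a::euclidean_space \<Rightarrow> 'b::real_normed_vector"
  assumes lin: "\<And>l. linear (f l)" and cont: "\<And>x. continuous_on UNIV (\<lambda>l. f l x)"
  shows "continuous_on UNIV (\<lambda>l. Blinfun (f l))"
  unfolding continuous_on_def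
proof
  fix l
  have bl: "bounded_linear (f l)" for l
    using linear_norm_le_sum_Basis[OF lin[of l]] lin[of l]
    by (auto intro!: bounded_linear_intro[where K="\<Sum>i\<in>Basis. norm (f l i)"]
        simp: linear_add linear_scale mult.commute)
  show "((\<lambda>l. Blinfun (f l)) \<longlongrightarrow> Blinfun (f l)) (at l within UNIV)"
    by (rule tendsto_componentwise1)
      (use cont in \<open>auto simp: bounded_linear_Blinfun_apply[OF bl] continuous_on_def\<close>)
qed

lemma blinfun_apply_Blinfun_linear:
  fixes f :: "'a::euclidean_space \<Rightarrow> 'b::real_normed_vector"
  assumes "linear f"
  shows "blinfun_apply (Blinfun f) = f"
  using assms linear_norm_le_sum_Basis[OF assms]
  by (intro bounded_linear_Blinfun_apply bounded_linear_intro[where K="\<Sum>i\<in>Basis. norm (f i)"])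
    (auto simp: linear_add linear_scale mult.commute)

lemma dim_image_inj_on:
  fixes f :: "'a::euclidean_space \<Rightarrow> 'b::real_vector"
  assumes "linear f" "subspace V" "inj_on f V"
  shows "dim (f ` V) = dim V"
proof -
  obtain B where B: "B \<subseteq> V" "independent B" "V \<subseteq> span B" "card B = dim V"
    using basis_exists[of V] by metis
  have VB: "V = span B" using span_subspace[OF B(1,3) assms(2)] by simp
  have "independent (f ` B)"
    using linear_independent_injective_image[OF assms(1) B(2)] assms(3) VB by simp
  moreover have "card (f ` B) = card B"
    using assms(3) B(1) by (meson card_image inj_on_subset)
  ultimately show ?thesis
    unfolding VB linear_span_image[OF assms(1), symmetric] dim_span
    using B(4) VB by (simp add: dim_eq_card_independent)
qed

text \<open>If P m is close to P l, a nonzero x = P l x with P m x = 0 would satisfy norm x = norm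
  ((P m - P l) x) < norm x. So P m is injective on the range of P l, and by symmetry the dimensions
  agree.\<close>

lemma dim_range_projection_locally_constant:
  fixes P :: "'l::topological_space \<Rightarrow> 'a::euclidean_space \<Rightarrow> 'a"
  assumes lin: "\<And>l. linear (P l)" and idem: "\<And>l x. P l (P l x) = P l x"
    and cont: "\<And>x. continuous_on UNIV (\<lambda>l. P l x)"
  shows "\<forall>\<^sub>F m in at l. dim (range (P l)) = dim (range (P m))"
proof -
  have le: "dim (range (P l)) \<le> dim (range (P m))" if "(\<Sum>i\<in>Basis. norm (P m i - P l i)) < 1" for l m
  proof -
    have lin': "linear (\<lambda>x. P m x - P l x)" by (intro linear_compose_sub lin)
    have "inj_on (P m) (range (P l))"
    proof (rule linear_injective_on_subspace_0[THEN iffD2, OF lin])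
      show "subspace (range (P l))" by (intro linear_subspace_image lin subspace_UNIV)
      show "\<forall>x\<in>range (P l). P m x = 0 \<longrightarrow> x = 0"
      proof (intro ballI impI)
        fix x assume "x \<in> range (P l)" "P m x = 0"
        then have "norm x \<le> (\<Sum>i\<in>Basis. norm (P m i - P l i)) * norm x"
          using linear_norm_le_sum_Basis[OF lin', of x] idem by auto
        then show "x = 0"
          using mult_strict_right_mono[OF that, of "norm x"] by (cases "x = 0") auto
      qed
    qed
    then have "dim (P m ` range (P l)) = dim (range (P l))"
      by (intro dim_image_inj_on lin linear_subspace_image subspace_UNIV)
    moreover have "dim (P m ` range (P l)) \<le> dim (range (P m))" by (intro dim_subset) auto
    ultimately show ?thesis by simp
  qed
  have "((\<lambda>m. \<Sum>i\<in>Basis. norm (P m i - P l i)) \<longlongrightarrow> (\<Sum>i\<in>Basis. norm (P l i - P l i))) (at l)"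
    using cont by (intro tendsto_intros) (auto simp: continuous_on_def)
  then have "\<forall>\<^sub>F m in at l. (\<Sum>i\<in>Basis. norm (P m i - P l i)) < 1"
    by (rule order_tendstoD) simp
  then show ?thesis
  proof eventually_elim
    case (elim m)
    then show ?case using le[of m l] le[of l m] by (simp add: norm_minus_commute)
  qed
qed

lemma finite_dim_subspace_UNIV: "finite_dim_subspace (UNIV :: 'a::euclidean_space set)"
  unfolding finite_dim_subspace_def using span_Basis finite_Basis by metis

lemma finite_dim_subspace_subspace:
  fixes V :: "'a::euclidean_space set"
  assumes "subspace V"
  shows "finite_dim_subspace V"
proof -
  obtain B where B: "B \<subseteq> V" "independent B" "V \<subseteq> span B" using basis_exists[of V] by metis
  have "finite B" "V = span B"
    using independent_imp_finite[OF B(2)] span_subspace[OF B(1,3) assms] by auto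
  then show ?thesis by (auto simp: finite_dim_subspace_def)
qed

lemma finite_dim_subspace_image:
  assumes "finite_dim_subspace V" "linear f"
  shows "finite_dim_subspace (f ` V)"
  using assms unfolding finite_dim_subspace_def by (metis finite_imageI linear_span_image)

lemma finite_dim_subspace_imp_subspace: "finite_dim_subspace V \<Longrightarrow> subspace V"
  by (auto simp: finite_dim_subspace_def)

lemma finite_dim_subspace_Times:
  assumes "finite_dim_subspace V" "finite_dim_subspace W"
  shows "finite_dim_subspace (V \<times> W)"
proof -
  obtain S T where S: "finite S" "V = span S" "finite T" "W = span T"
    using assms by (auto simp: finite_dim_subspace_def)
  have l: "linear (\<lambda>a. (a, 0))" "linear (\<lambda>b. (0, b))" by (auto simp: linear_iff)
  have "span ((\<lambda>a. (a, 0)) ` S \<union> (\<lambda>b. (0, b)) ` T) = V \<times> W"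
  proof
    show "span ((\<lambda>a. (a, 0)) ` S \<union> (\<lambda>b. (0, b)) ` T) \<subseteq> V \<times> W"
      using S by (intro span_minimal subspace_Times) (auto simp: span_base span_zero)
    have "(a, b) \<in> span ((\<lambda>a. (a, 0)) ` S \<union> (\<lambda>b. (0, b)) ` T)" if "a \<in> V" "b \<in> W" for a b
    proof -
      have "(a, 0) \<in> span ((\<lambda>a. (a, 0)) ` S)" "(0, b) \<in> span ((\<lambda>b. (0, b)) ` T)"
        using that S by (auto simp: linear_span_image[OF l(1)] linear_span_image[OF l(2)])
      moreover have "span ((\<lambda>a. (a, 0)) ` S) \<subseteq> span ((\<lambda>a. (a, 0)) ` S \<union> (\<lambda>b. (0, b)) ` T)"
        "span ((\<lambda>b. (0, b)) ` T) \<subseteq> span ((\<lambda>a. (a, 0)) ` S \<union> (\<lambda>b. (0, b)) ` T)"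
        by (intro span_mono Un_upper1 Un_upper2)+
      ultimately have "(a, 0) + (0, b) \<in> span ((\<lambda>a. (a, 0)) ` S \<union> (\<lambda>b. (0, b)) ` T)"
        by (intro span_add) (rule subsetD; assumption)+
      then show ?thesis by simp
    qed
    then show "V \<times> W \<subseteq> span ((\<lambda>a. (a, 0)) ` S \<union> (\<lambda>b. (0, b)) ` T)" by auto
  qed
  moreover have "finite ((\<lambda>a. (a, 0)) ` S \<union> (\<lambda>b. (0, b)) ` T)" using S by simp
  ultimately show ?thesis unfolding finite_dim_subspace_def by blast
qed

section \<open>Index bundles of boundary value families\<close>

text \<open>
  \<open>N\<^sub>\<lambda>(x, c) = (L\<^sub>\<lambda> x + K\<^sub>\<lambda> c, a, b)\<close> abstracts the operator on functions \<open>x\<close> with a jump \<open>c\<close> at \<open>0\<close>,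
  together with the boundary values \<open>a\<close>, \<open>b\<close> in the unstable and the stable space.
\<close>

locale boundary_family =
  fixes L :: "'l::topological_space \<Rightarrow> 'x::real_normed_vector \<Rightarrow>\<^sub>L 'y::real_inner"
    and N :: "'l \<Rightarrow> ('x \<times> 'c::euclidean_space) \<Rightarrow>\<^sub>L ('y \<times> 'c \<times> 'c)"
    and Pu Ps :: "'l \<Rightarrow> 'c \<Rightarrow> 'c"
    and \<Lambda>\<^sub>0 :: "'l set"
  assumes compact: "compact (UNIV :: 'l set)" and connected: "connected (UNIV :: 'l set)"
    and continuous_L: "continuous_on UNIV L" and continuous_N: "continuous_on UNIV N"
    and linear_Pu: "linear (Pu l)" and linear_Ps: "linear (Ps l)"
    and Pu_idem [simp]: "Pu l (Pu l u) = Pu l u" and Ps_idem [simp]: "Ps l (Ps l u) = Ps l u"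
    and continuous_Pu: "continuous_on UNIV (\<lambda>l. Pu l u)"
    and continuous_Ps: "continuous_on UNIV (\<lambda>l. Ps l u)"
    and N_L: "fst (blinfun_apply (N l) (x, 0)) = blinfun_apply (L l) x"
    and N_bounded_below: "\<exists>C. \<forall>w. norm w \<le> C * norm (blinfun_apply (N l) w)"
    and range_N: "range (blinfun_apply (N l)) = UNIV \<times> range (Pu l) \<times> range (Ps l)"
    and jump: "blinfun_apply (N l) (x, c) = (0, a, b) \<Longrightarrow> c = b - a"
    and \<Lambda>\<^sub>0_nonempty: "\<Lambda>\<^sub>0 \<noteq> {}"
    and \<Lambda>\<^sub>0_Int: "l \<in> \<Lambda>\<^sub>0 \<Longrightarrow> range (Pu l) \<inter> range (Ps l) = {0}"
    and \<Lambda>\<^sub>0_sum: "l \<in> \<Lambda>\<^sub>0 \<Longrightarrow> \<exists>a b. u = Pu l a + Ps l b"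
begin

text \<open>Projection onto the range of \<open>N l\<close>, which varies with \<open>l\<close>;
  composing with it keeps all later maps on one fixed space.\<close>

definition Q :: "'l \<Rightarrow> 'y \<times> 'c \<times> 'c \<Rightarrow> 'y \<times> 'c \<times> 'c" where
  "Q l z = (fst z, Pu l (fst (snd z)), Ps l (snd (snd z)))"

text \<open>The solution operator of the boundary value problem, made total by \<open>Q\<close>. Its
  component \<open>J\<close> is the jump that source and boundary data force at 0.\<close>

definition K :: "'l \<Rightarrow> 'y \<times> 'c \<times> 'c \<Rightarrow> 'x \<times> 'c" where
  "K l z = inv (blinfun_apply (N l)) (Q l z)"

definition J :: "'l \<Rightarrow> 'y \<times> 'c \<times> 'c \<Rightarrow> 'c" where "J l z = snd (K l z)"

lemma linear_Q: "linear (Q l)"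
  by (auto simp: linear_iff Q_def linear_add[OF linear_Pu] linear_add[OF linear_Ps]
      linear_scale[OF linear_Pu] linear_scale[OF linear_Ps])

lemma fst_Q [simp]: "fst (Q l z) = fst z"
  by (simp add: Q_def)

lemma Q_Q [simp]: "Q l (Q l z) = Q l z"
  by (simp add: Q_def)

lemma Q_in_range: "Q l z \<in> range (blinfun_apply (N l))"
  unfolding range_N by (simp add: Q_def)

lemma Q_N [simp]: "Q l (blinfun_apply (N l) w) = blinfun_apply (N l) w"
proof -
  have "blinfun_apply (N l) w \<in> range (blinfun_apply (N l))" by simp
  then show ?thesis unfolding range_N by (auto simp: Q_def)
qed

lemma N_K [simp]: "blinfun_apply (N l) (K l z) = Q l z"
  unfolding K_def by (rule f_inv_into_f[OF Q_in_range])

lemma inj_N: "inj (blinfun_apply (N l))"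
  using N_bounded_below[of l] inj_bounded_below by blast

lemma K_N [simp]: "K l (blinfun_apply (N l) w) = w"
  unfolding K_def by (simp add: inj_N)

lemma K_Q [simp]: "K l (Q l z) = K l z"
  by (simp add: K_def)

lemma J_Q [simp]: "J l (Q l z) = J l z"
  by (simp add: J_def)

lemma linear_K: "linear (K l)"
proof -
  have "K l (u + v) = K l u + K l v" for u v
    by (rule injD[OF inj_N[of l]]) (simp add: blinfun.add_right linear_add[OF linear_Q])
  moreover have "K l (r *\<^sub>R u) = r *\<^sub>R K l u" for r u
    by (rule injD[OF inj_N[of l]]) (simp add: blinfun.scaleR_right linear_scale[OF linear_Q])
  ultimately show ?thesis by (simp add: linear_iff)
qed

lemma linear_J: "linear (J l)"
  by (simp add: linear_iff J_def linear_add[OF linear_K] linear_scale[OF linear_K])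

text \<open>With zero source the jump is the difference of the boundary values, so on the boundary
  bundle \<open>J\<close> is minus the map (u, v) |-> u - v of the second triple.\<close>

lemma J_boundary: "J l (0, p, q) = Ps l q - Pu l p"
proof -
  obtain x c where w: "K l (0, p, q) = (x, c)" by fastforce
  then have "blinfun_apply (N l) (x, c) = (0, Pu l p, Ps l q)"
    using N_K[of l "(0, p, q)"] by (simp add: Q_def)
  then show ?thesis using jump w by (simp add: J_def)
qed

lemma J_decompose: "J l (y, p, q) = J l (y, 0, 0) + Ps l q - Pu l p"
  using linear_add[OF linear_J, of l "(y, 0, 0)" "(0, p, q)"] by (simp add: J_boundary)

lemma continuous_Q:
  assumes "continuous_on S g" "continuous_on S h"
  shows "continuous_on S (\<lambda>p. Q (g p) (h p))"
  unfolding Q_def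
  by (intro continuous_intros assms continuous_on_linear_family[OF linear_Pu continuous_Pu assms(1)]
      continuous_on_linear_family[OF linear_Ps continuous_Ps assms(1)])

lemma continuous_K:
  assumes "continuous_on S g" "continuous_on S h"
  shows "continuous_on S (\<lambda>p. K (g p) (h p))"
proof -
  have "continuous_on (Sigma UNIV (\<lambda>l. range (blinfun_apply (N l))))
      (\<lambda>p. inv (blinfun_apply (N (fst p))) (snd p))"
    by (rule continuous_on_inverse_bounded_below[OF continuous_N N_bounded_below])
  then have "continuous_on S (\<lambda>p. inv (blinfun_apply (N (fst (g p, Q (g p) (h p))))) (snd (g p, Q (g p) (h p))))"
    by (rule continuous_on_compose2) (auto intro!: continuous_intros assms continuous_Q Q_in_range)
  then show ?thesis by (simp add: K_def)
qed

lemma continuous_J: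
  assumes "continuous_on S g" "continuous_on S h"
  shows "continuous_on S (\<lambda>p. J (g p) (h p))"
  unfolding J_def by (intro continuous_intros continuous_K assms)

lemma fst_N: "fst (blinfun_apply (N l) (x, c)) = blinfun_apply (L l) x + fst (blinfun_apply (N l) (0, c))"
proof -
  have "blinfun_apply (N l) (x, c) = blinfun_apply (N l) (x, 0) + blinfun_apply (N l) (0, c)"
    by (simp add: blinfun.add_right[symmetric])
  then show ?thesis by (simp add: N_L)
qed

text \<open>By linearity the source of (x, c) is L x plus the source of the pure jump c. In
  particular, if \<open>J l z = 0\<close> then L maps the solution to the prescribed source; this is
  how membership in E(L, V) is recognised.\<close>

lemma L_fst_K: "blinfun_apply (L l) (fst (K l z)) = fst z - fst (blinfun_apply (N l) (0, J l z))"
  using fst_N[of l "fst (K l z)" "snd (K l z)"] by (simp add: J_def)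

subsection \<open>Transversal subspaces\<close>

text \<open>Transversality writes the source of the pure jump c as L x + v; the pair (- x, c) then
  has the source v in V and the jump c.\<close>

lemma transversal_J_surj:
  assumes "transversal L V"
  shows "\<exists>z. fst z \<in> V \<and> J l z = c"
proof -
  obtain x v where v: "v \<in> V" "fst (blinfun_apply (N l) (0, c)) = blinfun_apply (L l) x + v"
    using assms unfolding transversal_def by metis
  have "fst (blinfun_apply (N l) (- x, c)) = v"
    using v(2) by (simp add: fst_N[of l "-x"] blinfun.minus_right)
  then show ?thesis
    using v(1) by (intro exI[of _ "blinfun_apply (N l) (- x, c)"]) (simp add: J_def)
qed

text \<open>The solution with source y and one with source in V and the same jump differ by a
  function without jump, which L maps to the difference of the two sources.\<close>

lemma transversalI:
  assumes "finite_dim_subspace V" and "\<And>l c. \<exists>z. fst z \<in> V \<and> J l z = c"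
  shows "transversal L V"
  unfolding transversal_def
proof (intro conjI allI assms(1))
  fix l y
  obtain z where z: "fst z \<in> V" "J l z = J l (y, 0, 0)" using assms(2) by blast
  have "y = blinfun_apply (L l) (fst (K l (y, 0, 0)) - fst (K l z)) + fst z"
    by (simp add: blinfun.diff_right L_fst_K z(2))
  then show "\<exists>w. \<exists>v\<in>V. y = blinfun_apply (L l) w + v" using z(1) by blast
qed

text \<open>The data \<open>N m (0, i)\<close> have the jump i at m, for each basis vector i. For l
  near m their jumps stay so close to the basis that the induced endomorphism \<open>T\<close>
  differs from the identity by less than 1 in norm; it is then injective and, by dimension,
  surjective.\<close>

lemma exists_transversal_locally:
  obtains S U where "finite S" "open U" "m \<in> U"
    "\<And>l c. l \<in> U \<Longrightarrow> \<exists>z. fst z \<in> span S \<and> J l z = c"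
proof
  define z where "z i = blinfun_apply (N m) (0, i)" for i
  have Jz: "J m (z i) = i" for i by (simp add: z_def J_def)
  define S where "S = fst ` z ` Basis"
  define U where "U = {l. (\<Sum>i\<in>Basis. norm (J l (z i) - i)) < 1}"
  show "finite S" by (simp add: S_def)
  show "open U" unfolding U_def
    by (intro open_Collect_less continuous_intros continuous_J)
  show "m \<in> U" by (simp add: U_def Jz)
  fix l c assume l: "l \<in> U"
  define T where "T c = J l (\<Sum>i\<in>Basis. (c \<bullet> i) *\<^sub>R z i)" for c
  have "T = (\<lambda>c. \<Sum>i\<in>Basis. (c \<bullet> i) *\<^sub>R J l (z i))"
    by (simp add: T_def[abs_def] linear_sum[OF linear_J] linear_scale[OF linear_J])
  then have linT: "linear T"
    by (simp add: linear_iff inner_add_left scaleR_add_left sum.distrib scaleR_sum_right)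
  have "inj T"
  proof (rule linear_injective_0[THEN iffD2, OF linT, rule_format])
    fix u assume u: "T u = 0"
    have T: "T i = J l (z i)" if "i \<in> Basis" for i
    proof -
      have "(\<Sum>j\<in>Basis. (i \<bullet> j) *\<^sub>R z j) = (\<Sum>j\<in>Basis. if i = j then z j else 0)"
        using that by (intro sum.cong) (auto simp: inner_Basis)
      then show ?thesis using that by (simp add: T_def)
    qed
    have "linear (\<lambda>u. T u - u)" by (intro linear_compose_sub linT linear_ident)
    from linear_norm_le_sum_Basis[OF this, of u]
    have "norm u \<le> (\<Sum>i\<in>Basis. norm (J l (z i) - i)) * norm u"
      by (simp add: u T cong: sum.cong)
    moreover have "(\<Sum>i\<in>Basis. norm (J l (z i) - i)) < 1" using l by (simp add: U_def)
    ultimately show "u = 0"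
      using mult_strict_right_mono[of "\<Sum>i\<in>Basis. norm (J l (z i) - i)" 1 "norm u"]
      by (cases "u = 0") auto
  qed
  then have "surj T" by (rule linear_injective_imp_surjective[OF linT]) (rule refl)
  then obtain u where u: "c = T u" by blast
  have "fst (\<Sum>i\<in>Basis. (u \<bullet> i) *\<^sub>R z i) \<in> span S"
    unfolding fst_sum fst_scaleR S_def by (intro span_sum span_mul span_base) auto
  then show "\<exists>z. fst z \<in> span S \<and> J l z = c" using u unfolding T_def by blast
qed

text \<open>By compactness finitely many of the local choices cover the base. The span of all their
  sources serves everywhere, because enlarging V keeps \<open>J\<close> surjective.\<close>

lemma exists_transversal: "\<exists>V. transversal L V"
proof -
  have "\<forall>m. \<exists>S U. finite S \<and> open U \<and> m \<in> U \<and> (\<forall>l\<in>U. \<forall>c. \<exists>z. fst z \<in> span S \<and> J l z = c)"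
  proof
    fix m
    show "\<exists>S U. finite S \<and> open U \<and> m \<in> U \<and> (\<forall>l\<in>U. \<forall>c. \<exists>z. fst z \<in> span S \<and> J l z = c)"
      by (rule exists_transversal_locally[of m]) blast
  qed
  then obtain S U where S: "\<And>m. finite (S m)" and U: "\<And>m. open (U m)" "\<And>m. m \<in> U m"
    and J: "\<And>m l c. l \<in> U m \<Longrightarrow> \<exists>z. fst z \<in> span (S m) \<and> J l z = c"
    by metis
  have cover: "UNIV \<subseteq> (\<Union>m\<in>UNIV. U m)" using U(2) by blast
  have "\<exists>M. finite M \<and> UNIV \<subseteq> (\<Union>m\<in>M. U m)"
    by (rule compactE_image[OF compact U(1) cover]) (intro exI conjI)
  then obtain M where M: "finite M" "UNIV \<subseteq> (\<Union>m\<in>M. U m)" by (elim exE conjE)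
  have "transversal L (span (\<Union>m\<in>M. S m))"
  proof (rule transversalI)
    show "finite_dim_subspace (span (\<Union>m\<in>M. S m))"
      unfolding finite_dim_subspace_def by (intro exI[of _ "\<Union>m\<in>M. S m"]) (simp add: M S)
    fix l c
    obtain m where m: "m \<in> M" "l \<in> U m" using M(2) by auto
    have "span (S m) \<subseteq> span (\<Union>m\<in>M. S m)" using m(1) by (intro span_mono) blast
    then show "\<exists>z. fst z \<in> span (\<Union>m\<in>M. S m) \<and> J l z = c" using J[OF m(2), of c] by blast
  qed
  then show ?thesis by (rule exI)
qed

end

context boundary_family begin

text \<open>Needed for the closed range of L, which is the preimage of a subspace of R^d under this
  map. The bound is the lower bound for \<open>N\<close>, applied to the solution with zero boundary
  data.\<close>

lemma bounded_linear_J: "bounded_linear (\<lambda>y. J l (y, 0, 0))"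
proof -
  obtain C where C: "\<forall>w. norm w \<le> C * norm (blinfun_apply (N l) w)" using N_bounded_below by blast
  show ?thesis
  proof (rule bounded_linear_intro[where K=C])
    fix x y and r :: real
    show "J l (x + y, 0, 0) = J l (x, 0, 0) + J l (y, 0, 0)"
      using linear_add[OF linear_J, of l "(x, 0, 0)" "(y, 0, 0)"] by simp
    show "J l (r *\<^sub>R x, 0, 0) = r *\<^sub>R J l (x, 0, 0)"
      using linear_scale[OF linear_J, of l r "(x, 0, 0)"] by simp
    have "norm (J l (x, 0, 0)) \<le> norm (K l (x, 0, 0))" 
      using norm_snd_le[of "snd (K l (x, 0, 0))" "fst (K l (x, 0, 0))"] by (simp add: J_def)
    also have "\<dots> \<le> C * norm (Q l (x, 0, 0))" using C by (metis N_K)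
    also have "norm (Q l (x, 0, 0)) = norm x"
      by (simp add: Q_def linear_0[OF linear_Pu] linear_0[OF linear_Ps] norm_Pair)
    finally show "norm (J l (x, 0, 0)) \<le> norm x * C" by (simp add: mult.commute)
  qed
qed

lemma range_Pu_iff: "a \<in> range (Pu l) \<longleftrightarrow> Pu l a = a"
  by (metis Pu_idem rangeE rangeI)

lemma range_Ps_iff: "a \<in> range (Ps l) \<longleftrightarrow> Ps l a = a"
  by (metis Ps_idem rangeE rangeI)

lemma subspace_Pu: "subspace (range (Pu l))" and subspace_Ps: "subspace (range (Ps l))"
  by (intro linear_subspace_image linear_Pu linear_Ps subspace_UNIV)+

subsection \<open>The triple of boundary values\<close>

text \<open>The components a - Pu a and b - Ps b extend the map a - b from the boundary bundle,
  where they vanish, to an operator whose domain does not vary with \<open>l\<close>. The result on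
  continuity of inverses then applies.\<close>

definition \<Delta> :: "'l \<Rightarrow> ('c \<times> 'c) \<Rightarrow>\<^sub>L ('c \<times> 'c \<times> 'c)" where
  "\<Delta> l = Blinfun (\<lambda>(a, b). (a - b, a - Pu l a, b - Ps l b))"

lemma \<Delta>_apply: "blinfun_apply (\<Delta> l) (a, b) = (a - b, a - Pu l a, b - Ps l b)"
proof -
  have "linear (\<lambda>(a, b). (a - b, a - Pu l a, b - Ps l b))"
    by (auto simp: linear_iff algebra_simps linear_add[OF linear_Pu] linear_add[OF linear_Ps]
        linear_scale[OF linear_Pu] linear_scale[OF linear_Ps])
  then show ?thesis unfolding \<Delta>_def by (simp add: blinfun_apply_Blinfun_linear)
qed

lemma continuous_\<Delta>: "continuous_on UNIV \<Delta>"
proof -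
  have "continuous_on UNIV (\<lambda>l. Blinfun (\<lambda>p. (fst p - snd p, fst p - Pu l (fst p), snd p - Ps l (snd p))))"
    by (rule continuous_on_Blinfun_family)
      (auto simp: linear_iff algebra_simps linear_add[OF linear_Pu] linear_add[OF linear_Ps]
        linear_scale[OF linear_Pu] linear_scale[OF linear_Ps]
        intro!: continuous_intros continuous_Pu continuous_Ps)
  then show ?thesis by (simp add: \<Delta>_def[abs_def] case_prod_unfold)
qed

text \<open>A kernel element is (a, a) with a in both ranges, and over
  \<open>\<Lambda>\<^sub>0\<close> these meet only in 0. In finite dimension injectivity gives a
  lower bound.\<close>

lemma \<Delta>_bounded_below:
  assumes "l \<in> \<Lambda>\<^sub>0"
  shows "\<exists>C. \<forall>w. norm w \<le> C * norm (blinfun_apply (\<Delta> l) w)"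
proof -
  have lin: "linear (blinfun_apply (\<Delta> l))" by (rule bounded_linear.linear[OF blinfun.bounded_linear_right])
  have "inj (blinfun_apply (\<Delta> l))"
  proof (rule linear_injective_0[THEN iffD2, OF lin, rule_format])
    fix w assume "blinfun_apply (\<Delta> l) w = 0"
    then obtain a b where w: "w = (a, b)" "a = b" "Pu l a = a" "Ps l a = a"
      by (cases w) (auto simp: \<Delta>_apply zero_prod_def)
    then have "a \<in> range (Pu l) \<inter> range (Ps l)" by (metis IntI rangeI)
    then show "w = 0" using w \<Lambda>\<^sub>0_Int[OF assms] by (simp add: zero_prod_def)
  qed
  then obtain B where "B > 0" "\<And>w. B * norm w \<le> norm (blinfun_apply (\<Delta> l) w)"
    using linear_inj_bounded_below_pos[OF lin] by metis
  then show ?thesis by (intro exI[of _ "1 / B"]) (simp add: field_simps)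
qed

lemma \<Lambda>\<^sub>0_diff: "l \<in> \<Lambda>\<^sub>0 \<Longrightarrow> \<exists>a b. Pu l a = a \<and> Ps l b = b \<and> u = a - b"
proof -
  assume "l \<in> \<Lambda>\<^sub>0"
  then obtain a b where "u = Pu l a + Ps l b" using \<Lambda>\<^sub>0_sum by blast
  then show ?thesis
    by (intro exI[of _ "Pu l a"] exI[of _ "Ps l (- b)"]) (simp add: linear_neg[OF linear_Ps])
qed

abbreviation boundary_bundle :: "('l, 'c \<times> 'c) family" where
  "boundary_bundle \<equiv> bundle_sum (\<lambda>l. range (Pu l)) (\<lambda>l. range (Ps l))"

lemma vector_bundle_boundary: "vector_bundle boundary_bundle"
proof -
  have "vector_bundle (\<lambda>l. Pu l ` span Basis)" "vector_bundle (\<lambda>l. Ps l ` span Basis)"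
    by (rule vector_bundle_projections; simp add: linear_Pu linear_Ps continuous_Pu continuous_Ps)+
  then show ?thesis by (intro vector_bundle_sum) simp_all
qed

text \<open>Over \<open>\<Lambda>\<^sub>0\<close> the inverse sends c to the preimage of (c, 0, 0)
  under \<open>\<Delta> l\<close>. This preimage exists and lies in the bundle because the two
  ranges are complementary, and the lower bound for \<Delta> makes it depend continuously on (l,
  c).\<close>

lemma KO_triple_boundary:
  "KO_triple \<Lambda>\<^sub>0 (boundary_bundle, product_bundle UNIV, \<lambda>l (u, v). u - v)"
proof -
  have h: "bundle_hom UNIV boundary_bundle (product_bundle UNIV) (\<lambda>l (u, v). u - v)"
    by (rule bundle_hom_continuous_linear)
      (auto simp: case_prod_unfold product_bundle_def
        intro!: bounded_linear_sub bounded_linear_fst bounded_linear_snd)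
  have \<Delta>: "blinfun_apply (\<Delta> l) (a, b) = (a - b, 0, 0)" if "(a, b) \<in> boundary_bundle l" for l a b
    using that by (auto simp: \<Delta>_apply bundle_sum_def)
  have ex: "\<exists>w\<in>boundary_bundle l. blinfun_apply (\<Delta> l) w = (c, 0, 0)" if l: "l \<in> \<Lambda>\<^sub>0" for l c
  proof -
    obtain a b where ab: "Pu l a = a" "Ps l b = b" "c = a - b" using \<Lambda>\<^sub>0_diff[OF l] by blast
    then have "(a, b) \<in> boundary_bundle l" by (simp add: bundle_sum_def range_Pu_iff range_Ps_iff)
    with \<Delta>[OF this] ab(3) show ?thesis by auto
  qed
  define k where "k l c = inv (blinfun_apply (\<Delta> l)) (c, 0, 0)" for l c
  have inj: "inj (blinfun_apply (\<Delta> l))" if "l \<in> \<Lambda>\<^sub>0" for l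
    using \<Delta>_bounded_below[OF that] inj_bounded_below by blast
  have k1: "k l (a - b) = (a, b)" if "l \<in> \<Lambda>\<^sub>0" "(a, b) \<in> boundary_bundle l" for l a b
    unfolding k_def \<Delta>[OF that(2), symmetric] by (rule inv_f_f[OF inj[OF that(1)]])
  have k2: "k l c \<in> boundary_bundle l \<and> blinfun_apply (\<Delta> l) (k l c) = (c, 0, 0)" if l: "l \<in> \<Lambda>\<^sub>0" for l c
    using ex[OF l, of c] inj[OF l] by (auto simp: k_def inv_f_f[OF inj[OF l], symmetric] simp del: inv_f_f)
       (metis inv_f_f)+
  have k: "bundle_hom \<Lambda>\<^sub>0 (product_bundle UNIV) boundary_bundle k"
    unfolding bundle_hom_def
  proof (intro conjI ballI allI)
    fix l assume l: "l \<in> \<Lambda>\<^sub>0"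
    fix u v and r :: real
    show "k l u \<in> boundary_bundle l" using k2[OF l] by blast
    show "k l (u + v) = k l u + k l v"
      by (rule injD[OF inj[OF l]]) (simp add: k2[OF l] blinfun.add_right)
    show "k l (r *\<^sub>R u) = r *\<^sub>R k l u"
      by (rule injD[OF inj[OF l]]) (simp add: k2[OF l] blinfun.scaleR_right)
  next
    have "continuous_on (Sigma \<Lambda>\<^sub>0 (\<lambda>l. range (blinfun_apply (\<Delta> l))))
        (\<lambda>p. inv (blinfun_apply (\<Delta> (fst p))) (snd p))"
      by (rule continuous_on_inverse_bounded_below[OF continuous_on_subset[OF continuous_\<Delta>] \<Delta>_bounded_below]) auto
    moreover have "continuous_on (Sigma \<Lambda>\<^sub>0 (product_bundle UNIV)) (\<lambda>p :: 'l \<times> 'c. (fst p, (snd p, 0 :: 'c, 0 :: 'c)))"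
      by (intro continuous_intros)
    moreover have "(\<lambda>p :: 'l \<times> 'c. (fst p, (snd p, 0, 0))) ` Sigma \<Lambda>\<^sub>0 (product_bundle UNIV)
        \<subseteq> Sigma \<Lambda>\<^sub>0 (\<lambda>l. range (blinfun_apply (\<Delta> l)))"
    proof -
      have "(c, 0, 0) \<in> range (blinfun_apply (\<Delta> l))" if "l \<in> \<Lambda>\<^sub>0" for l c
        using k2[OF that] by (metis rangeI)
      then show ?thesis by auto
    qed
    ultimately have "continuous_on (Sigma \<Lambda>\<^sub>0 (product_bundle UNIV))
        (\<lambda>p :: 'l \<times> 'c. inv (blinfun_apply (\<Delta> (fst (fst p, snd p, 0 :: 'c, 0 :: 'c)))) (snd (fst p, snd p, 0, 0)))"
      by (rule continuous_on_compose2)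
    then show "continuous_on (Sigma \<Lambda>\<^sub>0 (product_bundle UNIV)) (\<lambda>(l, u). k l u)"
      by (simp add: k_def case_prod_unfold)
  qed
  have "bundle_iso \<Lambda>\<^sub>0 boundary_bundle (product_bundle UNIV) (\<lambda>l (u, v). u - v)"
  proof (rule bundle_isoI[OF bundle_hom_subset[OF h] k])
    fix l v assume l: "l \<in> \<Lambda>\<^sub>0"
    obtain a b where ab: "k l v = (a, b)" by fastforce
    then show "(case k l v of (u, v) \<Rightarrow> u - v) = v" using k2[OF l, of v] by (simp add: \<Delta>_apply)
  qed (auto simp: k1)
  then show ?thesis
    using h vector_bundle_boundary vector_bundle_product[OF finite_dim_subspace_UNIV] by simp
qed

subsection \<open>The index triple\<close>

text \<open>For y = L x the boundary data (a, b) of x satisfy a - b = J(y, 0, 0), since x has no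
  jump. Over \<open>\<Lambda>\<^sub>0\<close> the difference a - b controls (a, b) through \<Delta>,
  and N then controls x. Conversely, any y is reached by choosing boundary data with a - b = J(y, 0,
  0).\<close>

lemma L_bijective:
  assumes l: "l \<in> \<Lambda>\<^sub>0"
  shows L_bounded_below: "\<exists>C. \<forall>x. norm x \<le> C * norm (blinfun_apply (L l) x)"
    and L_surj: "range (blinfun_apply (L l)) = UNIV"
proof -
  obtain C where C: "\<And>w. norm w \<le> C * norm (blinfun_apply (N l) w)" using N_bounded_below by blast
  obtain D where D: "\<And>w. norm w \<le> D * norm (blinfun_apply (\<Delta> l) w)" using \<Delta>_bounded_below[OF l] by blast
  obtain E where E: "E \<ge> 0" "\<And>y. norm (J l (y, 0, 0)) \<le> norm y * E"
    using bounded_linear.nonneg_bounded[OF bounded_linear_J] by blast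
  define C' where "C' = max C 0"
  define D' where "D' = max D 0"
  have CD: "C' \<ge> 0" "D' \<ge> 0" "norm w \<le> C' * norm (blinfun_apply (N l) w)"
    "norm z \<le> D' * norm (blinfun_apply (\<Delta> l) z)" for w z
    using C[of w] D[of z] mult_right_mono[of C C' "norm (blinfun_apply (N l) w)"]
      mult_right_mono[of D D' "norm (blinfun_apply (\<Delta> l) z)"] by (auto simp: C'_def D'_def)
  have "norm x \<le> C' * (1 + D' * E) * norm (blinfun_apply (L l) x)" for x
  proof -
    define y a b where "y = blinfun_apply (L l) x" and "a = fst (snd (blinfun_apply (N l) (x, 0)))"
      and "b = snd (snd (blinfun_apply (N l) (x, 0)))"
    have N: "blinfun_apply (N l) (x, 0) = (y, a, b)"
      by (simp add: y_def a_def b_def prod_eq_iff N_L)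
    have ab: "Pu l a = a" "Ps l b = b" using Q_N[of l "(x, 0)"] by (simp_all add: N Q_def)
    have "0 = J l (y, a, b)" unfolding N[symmetric] by (simp add: J_def)
    then have d: "a - b = J l (y, 0, 0)" using J_decompose[of l y a b]
      by (simp add: ab) (metis add_diff_cancel_right')
    have "norm (a, b) \<le> D' * norm (J l (y, 0, 0), 0::'c, 0::'c)"
      using CD(4)[of "(a, b)"] by (simp add: \<Delta>_apply ab d)
    also have "norm (J l (y, 0, 0), 0::'c, 0::'c) = norm (J l (y, 0, 0))" by (simp add: norm_Pair)
    also have "D' * norm (J l (y, 0, 0)) \<le> D' * (norm y * E)" by (intro mult_left_mono E CD)
    finally have "norm (y, a, b) \<le> norm y + D' * (norm y * E)"
      using norm_Pair_le[of y "(a, b)"] by linarith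
    then have "C' * norm (y, a, b) \<le> C' * (norm y + D' * (norm y * E))" by (intro mult_left_mono CD)
    moreover have "norm x \<le> C' * norm (y, a, b)"
      using CD(3)[of "(x, 0)"] by (simp add: N norm_Pair)
    ultimately show ?thesis by (simp add: y_def algebra_simps)
  qed
  then show "\<exists>C. \<forall>x. norm x \<le> C * norm (blinfun_apply (L l) x)" by blast
  have "\<exists>x. blinfun_apply (L l) x = y" for y
  proof -
    obtain a b where ab: "Pu l a = a" "Ps l b = b" "J l (y, 0, 0) = a - b" using \<Lambda>\<^sub>0_diff[OF l] by blast
    then have "J l (y, a, b) = 0" using J_decompose[of l y a b] by simp
    then have "blinfun_apply (L l) (fst (K l (y, a, b))) = y" by (simp add: L_fst_K zero_prod_def[symmetric])
    then show ?thesis by blast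
  qed
  then show "range (blinfun_apply (L l)) = UNIV" by (metis surj_def)
qed

end

section \<open>The stable isomorphism between the index triple and the boundary triple\<close>

context boundary_family begin

lemma transversal_span:
  assumes "transversal L V"
  obtains S where "finite S" "span S = V \<times> (UNIV :: ('c \<times> 'c) set)"
proof -
  have "finite_dim_subspace (V \<times> (UNIV :: ('c \<times> 'c) set))"
    using assms finite_dim_subspace_UNIV unfolding transversal_def
    by (intro finite_dim_subspace_Times) auto
  then show ?thesis
    unfolding finite_dim_subspace_def by (elim exE conjE) (rule that; simp)
qed

text \<open>The pseudo-inverse \<open>J\<^sup>T (J J\<^sup>T)\<^sup>-\<^sup>1\<close> with respect to a spanning set of \<open>V \<times> \<real>\<^sup>d \<times> \<real>\<^sup>d\<close>.\<close>

lemma right_inverse_J: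
  assumes V: "transversal L V"
  obtains D :: "'l \<Rightarrow> 'c \<Rightarrow> 'y \<times> 'c \<times> 'c" where
    "\<And>l. linear (D l)" "\<And>l c. J l (D l c) = c" "\<And>l c. Q l (D l c) = D l c"
    "\<And>l c. fst (D l c) \<in> V" "\<And>c. continuous_on UNIV (\<lambda>l. D l c)"
proof -
  obtain S where S: "finite S" "span S = V \<times> (UNIV :: ('c \<times> 'c) set)"
    by (rule transversal_span[OF V])
  define Gram where "Gram l c = (\<Sum>z\<in>S. (J l z \<bullet> c) *\<^sub>R J l z)" for l c
  have lin: "linear (Gram l)" for l
    by (simp add: Gram_def[abs_def] linear_iff inner_add_right scaleR_add_left sum.distrib scaleR_sum_right)
  have cont: "continuous_on UNIV (\<lambda>l. Gram l c)" for c
    unfolding Gram_def by (intro continuous_intros continuous_J)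
  define G where "G l = Blinfun (Gram l)" for l
  have G: "blinfun_apply (G l) = Gram l" for l
    unfolding G_def by (rule blinfun_apply_Blinfun_linear[OF lin])
  have contG: "continuous_on UNIV G"
    using continuous_on_Blinfun_family[OF lin cont] by (simp add: G_def[abs_def])
  \<comment> \<open>c . Gram c is a sum of squares, so c in the kernel is orthogonal to the image of
    \<open>span S\<close> under \<open>J l\<close>, which is everything by transversality.\<close>
  have inj: "inj (Gram l)" for l
  proof (rule linear_injective_0[THEN iffD2, OF lin, rule_format])
    fix c assume "Gram l c = 0"
    then have "0 = c \<bullet> Gram l c" by simp
    also have "\<dots> = (\<Sum>z\<in>S. (J l z \<bullet> c)\<^sup>2)"
      by (simp add: Gram_def inner_sum_right power2_eq_square inner_commute)
    finally have z: "J l z \<bullet> c = 0" if "z \<in> S" for z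
      using that S(1) sum_nonneg_eq_0_iff[of S "\<lambda>z. (J l z \<bullet> c)\<^sup>2"] by simp
    have "J l z \<bullet> c = 0" if "z \<in> span S" for z
      using that
    proof (induction rule: span_induct_alt)
      case base
      show ?case by (simp add: linear_0[OF linear_J])
    next
      case (step r x y)
      then show ?case by (simp add: linear_add[OF linear_J] linear_scale[OF linear_J] inner_add_left z)
    qed
    moreover obtain z where "fst z \<in> V" "J l z = c" using transversal_J_surj[OF V] by blast
    ultimately have "c \<bullet> c = 0" using S(2) by (metis UNIV_I mem_Times_iff)
    then show "c = 0" by simp
  qed
  have surj: "range (Gram l) = UNIV" for l
    using linear_injective_imp_surjective[OF lin inj] by simp
  have below: "\<exists>C. \<forall>u. norm u \<le> C * norm (blinfun_apply (G l) u)" for l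
  proof -
    obtain B where "B > 0" "\<And>w. B * norm w \<le> norm (Gram l w)"
      using linear_inj_bounded_below_pos[OF lin inj] by metis
    then show ?thesis by (intro exI[of _ "1 / B"]) (simp add: field_simps G)
  qed
  define H where "H l = inv (Gram l)" for l
  have H: "Gram l (H l c) = c" for l c
    unfolding H_def by (rule f_inv_into_f) (simp add: surj)
  have contH: "continuous_on UNIV (\<lambda>l. H l c)" for c
  proof -
    have "continuous_on (Sigma UNIV (\<lambda>l. range (blinfun_apply (G l))))
        (\<lambda>p. inv (blinfun_apply (G (fst p))) (snd p))"
      by (rule continuous_on_inverse_bounded_below[OF contG below])
    moreover have "continuous_on UNIV (\<lambda>l. (l, c))" by (intro continuous_intros)
    moreover have "(\<lambda>l. (l, c)) ` UNIV \<subseteq> Sigma UNIV (\<lambda>l. range (blinfun_apply (G l)))"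
      by (auto simp: G surj)
    ultimately have "continuous_on UNIV (\<lambda>l. inv (blinfun_apply (G (fst (l, c)))) (snd (l, c)))"
      by (rule continuous_on_compose2)
    then show ?thesis by (simp add: G H_def)
  qed
  have linH: "linear (H l)" for l
  proof -
    have "H l (u + v) = H l u + H l v" "H l (r *\<^sub>R u) = r *\<^sub>R H l u" for u v r
      by (rule injD[OF inj[of l]], simp add: H linear_add[OF lin] linear_scale[OF lin])+
    then show ?thesis by (simp add: linear_iff)
  qed
  \<comment> \<open>Applying \<open>Q\<close> moves the value into the range of N. It changes
    neither the jump nor the source, which therefore stays in V.\<close>
  define D where "D l c = Q l (\<Sum>z\<in>S. (J l z \<bullet> H l c) *\<^sub>R z)" for l c
  show ?thesis
  proof
    show "linear (D l)" for l
      by (simp add: D_def[abs_def] linear_iff linear_sum[OF linear_Q] linear_scale[OF linear_Q]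
          linear_add[OF linH] linear_scale[OF linH] inner_add_right scaleR_add_left sum.distrib scaleR_sum_right)
    show "J l (D l c) = c" for l c
      using H[of l c] by (simp add: D_def linear_sum[OF linear_J] linear_scale[OF linear_J] Gram_def)
    show "Q l (D l c) = D l c" for l c by (simp add: D_def)
    have "(\<Sum>z\<in>S. (J l z \<bullet> H l c) *\<^sub>R z) \<in> span S" for l c
      by (intro span_sum span_mul span_base)
    then show "fst (D l c) \<in> V" for l c
      using S(2) by (simp add: D_def mem_Times_iff)
    show "continuous_on UNIV (\<lambda>l. D l c)" for c
      unfolding D_def by (intro continuous_Q continuous_intros continuous_J contH)
  qed
qed

lemma subspace_transversal: "transversal L V \<Longrightarrow> subspace V"
  by (auto simp: transversal_def finite_dim_subspace_imp_subspace)

text \<open>Under x |-> N(x, 0) the bundle E(L, V) becomes the kernel of J on the data with source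
  in V. The map T = Q - D J projects onto this kernel, is continuous in \<open>l\<close> and acts in
  the fixed finite-dimensional space V x R^d x R^d.\<close>

lemma vector_bundle_preimage:
  assumes V: "transversal L V"
  shows "vector_bundle (preimage_bundle L V)"
proof -
  note sub = subspace_transversal[OF V]
  obtain D where D: "\<And>l. linear (D l)" "\<And>l c. J l (D l c) = c" "\<And>l c. Q l (D l c) = D l c"
    "\<And>l c. fst (D l c) \<in> V" "\<And>c. continuous_on UNIV (\<lambda>l. D l c)"
    by (rule right_inverse_J[OF V]) blast
  obtain S where S: "finite S" "span S = V \<times> (UNIV :: ('c \<times> 'c) set)"
    by (rule transversal_span[OF V])
  define T where "T l z = Q l z - D l (J l z)" for l z
  have contD: "continuous_on X (\<lambda>p. D (g p) (h p))"
    if "continuous_on X g" "continuous_on X h" for X and g :: "'z::topological_space \<Rightarrow> 'l" and h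
    by (rule continuous_on_linear_family[OF D(1) D(5) that])
  have JT: "J l (T l z) = 0" "Q l (T l z) = T l z" for l z
    by (simp_all add: T_def linear_diff[OF linear_J] linear_diff[OF linear_Q] D)
  have fixT: "T l z = z" if "Q l z = z" "J l z = 0" for l z
    using that by (simp add: T_def linear_0[OF D(1)])
  have vb: "vector_bundle (\<lambda>l. T l ` span S)"
  proof (rule vector_bundle_projections[OF S(1)])
    show "linear (T l)" for l
      unfolding T_def
      by (intro linear_compose_sub linear_Q linear_compose[OF linear_J D(1), unfolded o_def])
    show "T l u \<in> span S" if "u \<in> span S" for l u
      using that subspace_diff[OF sub _ D(4)] by (auto simp: S T_def mem_Times_iff)
    show "T l (T l u) = T l u" for l u by (rule fixT[OF JT(2,1)])
    show "continuous_on UNIV (\<lambda>l. T l u)" for u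
      unfolding T_def by (intro continuous_intros continuous_Q contD continuous_J)
  qed
  have T: "T l ` span S = {z. fst z \<in> V \<and> Q l z = z \<and> J l z = 0}" for l
  proof (intro equalityI subsetI; (elim CollectE conjE imageE)?)
    fix z u assume "z = T l u" "u \<in> span S"
    then show "z \<in> {z. fst z \<in> V \<and> Q l z = z \<and> J l z = 0}"
      using JT subspace_diff[OF sub _ D(4)] by (auto simp: T_def S mem_Times_iff)
  next
    fix z assume "fst z \<in> V" "Q l z = z" "J l z = 0"
    then show "z \<in> T l ` span S"
      using fixT[of l z] by (intro image_eqI[of _ _ z]) (auto simp: S mem_Times_iff)
  qed
  have iso: "bundle_iso UNIV (preimage_bundle L V) (\<lambda>l. T l ` span S)
      (\<lambda>l x. blinfun_apply (N l) (x, 0))"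
  proof (rule bundle_isoI)
    show "bundle_hom UNIV (preimage_bundle L V) (\<lambda>l. T l ` span S) (\<lambda>l x. blinfun_apply (N l) (x, 0))"
      unfolding bundle_hom_def
    proof (intro conjI ballI allI)
      fix l x assume "x \<in> preimage_bundle L V l"
      then show "blinfun_apply (N l) (x, 0) \<in> T l ` span S"
        unfolding T by (simp add: N_L J_def preimage_bundle_def)
    next
      show "continuous_on (Sigma UNIV (preimage_bundle L V)) (\<lambda>(l, x). blinfun_apply (N l) (x, 0))"
        unfolding case_prod_unfold
        by (intro continuous_intros continuous_on_compose2[OF continuous_N]) auto
    qed (auto simp: blinfun.add_right[symmetric] blinfun.scaleR_right[symmetric])
    show "bundle_hom UNIV (\<lambda>l. T l ` span S) (preimage_bundle L V) (\<lambda>l z. fst (K l z))"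
      unfolding bundle_hom_def
    proof (intro conjI ballI allI)
      fix l z assume "z \<in> T l ` span S"
      then show "fst (K l z) \<in> preimage_bundle L V l"
        unfolding T by (simp add: preimage_bundle_def L_fst_K zero_prod_def[symmetric])
    next
      show "continuous_on (Sigma UNIV (\<lambda>l. T l ` span S)) (\<lambda>(l, z). fst (K l z))"
        unfolding case_prod_unfold by (intro continuous_intros continuous_K)
    qed (auto simp: linear_add[OF linear_K] linear_scale[OF linear_K])
    show "fst (K l (blinfun_apply (N l) (x, 0))) = x" for l x by simp
    fix l z assume "z \<in> T l ` span S"
    then have "Q l z = z" "snd (K l z) = 0" unfolding T by (auto simp: J_def)
    then show "blinfun_apply (N l) (fst (K l z), 0) = z"
      using N_K[of l z] by (metis prod.collapse)
  qed
  have sp: "subspace (preimage_bundle L V l)" for l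
    using linear_subspace_vimage[OF bounded_linear.linear[OF blinfun.bounded_linear_right] sub]
    by (simp add: preimage_bundle_def vimage_def)
  show ?thesis by (rule vector_bundle_iso[OF vb iso sp])
qed

lemma KO_triple_index:
  assumes V: "transversal L V"
  shows "KO_triple \<Lambda>\<^sub>0 (preimage_bundle L V, product_bundle V, \<lambda>l. blinfun_apply (L l))"
proof -
  have h: "bundle_hom UNIV (preimage_bundle L V) (product_bundle V) (\<lambda>l. blinfun_apply (L l))"
    unfolding bundle_hom_def
  proof (intro conjI)
    show "continuous_on (Sigma UNIV (preimage_bundle L V)) (\<lambda>(l, x). blinfun_apply (L l) x)"
      unfolding case_prod_unfold
      by (intro continuous_intros continuous_on_compose2[OF continuous_L]) auto
  qed (auto simp: preimage_bundle_def product_bundle_def blinfun.add_right blinfun.scaleR_right)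
  define k where "k l y = inv (blinfun_apply (L l)) y" for l y
  have inj: "inj (blinfun_apply (L l))" if "l \<in> \<Lambda>\<^sub>0" for l
    using L_bounded_below[OF that] inj_bounded_below by blast
  have k1: "k l (blinfun_apply (L l) x) = x" if "l \<in> \<Lambda>\<^sub>0" for l x
    unfolding k_def by (rule inv_f_f[OF inj[OF that]])
  have k2: "blinfun_apply (L l) (k l y) = y" if "l \<in> \<Lambda>\<^sub>0" for l y
    unfolding k_def by (rule f_inv_into_f) (simp add: L_surj[OF that])
  have k: "bundle_hom \<Lambda>\<^sub>0 (product_bundle V) (preimage_bundle L V) k"
    unfolding bundle_hom_def
  proof (intro conjI ballI allI)
    fix l assume l: "l \<in> \<Lambda>\<^sub>0"
    fix u v and r :: real
    show "k l (u + v) = k l u + k l v"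
      by (rule injD[OF inj[OF l]]) (simp add: k2[OF l] blinfun.add_right)
    show "k l (r *\<^sub>R u) = r *\<^sub>R k l u"
      by (rule injD[OF inj[OF l]]) (simp add: k2[OF l] blinfun.scaleR_right)
    show "u \<in> product_bundle V l \<Longrightarrow> k l u \<in> preimage_bundle L V l"
      by (simp add: preimage_bundle_def product_bundle_def k2[OF l])
  next
    have "continuous_on (Sigma \<Lambda>\<^sub>0 (\<lambda>l. range (blinfun_apply (L l))))
        (\<lambda>p. inv (blinfun_apply (L (fst p))) (snd p))"
      by (rule continuous_on_inverse_bounded_below[OF continuous_on_subset[OF continuous_L] L_bounded_below]) auto
    then have "continuous_on (Sigma \<Lambda>\<^sub>0 (product_bundle V)) (\<lambda>p. inv (blinfun_apply (L (fst p))) (snd p))"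
      by (rule continuous_on_subset) (auto simp: L_surj)
    then show "continuous_on (Sigma \<Lambda>\<^sub>0 (product_bundle V)) (\<lambda>(l, y). k l y)"
      by (simp add: k_def case_prod_unfold)
  qed
  have "bundle_iso \<Lambda>\<^sub>0 (preimage_bundle L V) (product_bundle V) (\<lambda>l. blinfun_apply (L l))"
    by (rule bundle_isoI[OF bundle_hom_subset[OF h] k]) (auto simp: k1 k2)
  then show ?thesis
    using h vector_bundle_preimage[OF V] vector_bundle_product[of V] V
    by (simp add: transversal_def)
qed

text \<open>\<open>\<phi>\<close> sends (x, c) to the data (y, a, b) of x plus the correction given
  by D c; its jump is c and its source y lies in V. From c = J(y, a, b) = J(y, 0, 0) + b - a one
  reads off a - b = J(y, 0, 0) - c: the map of the boundary triple is a function of y and c alone,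
  which is \<open>\<psi>\<close>. So the index triple plus the identity of R^d is isomorphic to the
  boundary triple plus the identity of V.\<close>

lemma KO_equiv_index_boundary:
  assumes V: "transversal L V"
  shows "KO_equiv \<Lambda>\<^sub>0 (preimage_bundle L V, product_bundle V, \<lambda>l. blinfun_apply (L l))
     (boundary_bundle, product_bundle UNIV, \<lambda>l (u, v). u - v)"
proof (rule KO_equiv_stable_iso[OF KO_triple_index[OF V] KO_triple_boundary])
  note sub = subspace_transversal[OF V]
  obtain D where D: "\<And>l. linear (D l)" "\<And>l c. J l (D l c) = c" "\<And>l c. Q l (D l c) = D l c"
    "\<And>l c. fst (D l c) \<in> V" "\<And>c. continuous_on UNIV (\<lambda>l. D l c)"
    by (rule right_inverse_J[OF V]) blast
  have contD: "continuous_on X (\<lambda>p. D (g p) (h p))"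
    if "continuous_on X g" "continuous_on X h" for X and g :: "'z::topological_space \<Rightarrow> 'l" and h
    by (rule continuous_on_linear_family[OF D(1) D(5) that])
  let ?\<eta> = "(product_bundle UNIV, product_bundle UNIV, \<lambda>l u. u) :: ('l, 'c, 'c) triple"
  let ?\<theta> = "(product_bundle V, product_bundle V, \<lambda>l u. u) :: ('l, 'y, 'y) triple"
  show "trivial_triple ?\<eta>" "trivial_triple ?\<theta>"
    using V by (simp_all add: vector_bundle_product finite_dim_subspace_UNIV transversal_def bundle_iso_id)
  \<comment> \<open>The components of the data are permuted, boundary values first and source last,
    to match the bundle E^u + E^s + V.\<close>
  define \<phi> where "\<phi> l w = (snd (blinfun_apply (N l) (fst w, 0) + D l (snd w)), blinfun_apply (L l) (fst w) + fst (D l (snd w)))"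
    for l and w :: "'x \<times> 'c"
  define \<phi>' where "\<phi>' l w = (let z = K l (snd w, fst w) in (fst z - fst (K l (D l (snd z))), snd z))"
    for l and w :: "('c \<times> 'c) \<times> 'y"
  \<comment> \<open>\<open>fst w\<close> stands for L x and \<open>snd w\<close> for c. The second
    component is then the source y, the first is the value of a - b forced by y and c.\<close>
  define \<psi> where "\<psi> l w = (J l (fst w + fst (D l (snd w)), 0, 0) - snd w, fst w + fst (D l (snd w)))"
    for l and w :: "'y \<times> 'c"
  \<comment> \<open>The relation a - b = J(y, 0, 0) - c is solved for c, and the source of D c is
    removed from y.\<close>
  define \<psi>' where "\<psi>' l w = (let c = J l (snd w, 0, 0) - fst w in (snd w - fst (D l c), c))"
    for l and w :: "'c \<times> 'y"
  have J0: "J l (x + y, 0, 0) = J l (x, 0, 0) + J l (y, 0, 0)" "J l (r *\<^sub>R x, 0, 0) = r *\<^sub>R J l (x, 0, 0)" for l x y r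
    using linear_add[OF linear_J, of l "(x, 0, 0)" "(y, 0, 0)"]
      linear_scale[OF linear_J, of l r "(x, 0, 0)"] by simp_all
  have z: "blinfun_apply (N l) (fst w, 0) + D l (snd w) = (snd (\<phi> l w), fst (\<phi> l w))" for l w
    by (simp add: \<phi>_def prod_eq_iff N_L)
  have Kz: "K l (snd (\<phi> l w), fst (\<phi> l w)) = (fst w, 0) + K l (D l (snd w))" for l w
    unfolding z[symmetric] by (simp add: linear_add[OF linear_K])
  have Qz: "Q l (snd (\<phi> l w), fst (\<phi> l w)) = (snd (\<phi> l w), fst (\<phi> l w))" for l w
    unfolding z[symmetric] by (simp add: linear_add[OF linear_Q] D)
  have snd_K_D: "snd (K l (D l c)) = c" for l c using D(2) by (simp add: J_def)
  have lin_\<phi>: "\<phi> l (u + v) = \<phi> l u + \<phi> l v" "\<phi> l (r *\<^sub>R u) = r *\<^sub>R \<phi> l u" for l u v r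
  proof -
    have "blinfun_apply (N l) (fst u + fst v, 0) = blinfun_apply (N l) (fst u, 0) + blinfun_apply (N l) (fst v, 0)"
      "blinfun_apply (N l) (r *\<^sub>R fst u, 0) = r *\<^sub>R blinfun_apply (N l) (fst u, 0)"
      by (simp_all add: blinfun.add_right[symmetric] blinfun.scaleR_right[symmetric])
    then show "\<phi> l (u + v) = \<phi> l u + \<phi> l v" "\<phi> l (r *\<^sub>R u) = r *\<^sub>R \<phi> l u"
      by (simp_all add: \<phi>_def linear_add[OF D(1)] linear_scale[OF D(1)] blinfun.add_right
          blinfun.scaleR_right scaleR_add_right)
  qed
  have "bundle_iso UNIV (bundle_sum (preimage_bundle L V) (product_bundle (UNIV :: 'c set)))
      (bundle_sum boundary_bundle (product_bundle V)) \<phi>"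
  proof (rule bundle_isoI)
    show "bundle_hom UNIV (bundle_sum (preimage_bundle L V) (product_bundle (UNIV :: 'c set)))
        (bundle_sum boundary_bundle (product_bundle V)) \<phi>"
      unfolding bundle_hom_def
    proof (intro conjI ballI allI lin_\<phi>)
      fix l :: 'l and w assume w: "w \<in> bundle_sum (preimage_bundle L V) (product_bundle (UNIV :: 'c set)) l"
      have "fst (\<phi> l w) \<in> boundary_bundle l"
        using Qz[of l w] by (simp add: Q_def bundle_sum_def prod_eq_iff range_Pu_iff range_Ps_iff mem_Times_iff)
      moreover have "snd (\<phi> l w) \<in> V"
        using w by (auto simp: \<phi>_def bundle_sum_def preimage_bundle_def intro!: subspace_add[OF sub] D)
      ultimately show "\<phi> l w \<in> bundle_sum boundary_bundle (product_bundle V) l"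
        by (cases "\<phi> l w") (simp add: bundle_sum_def product_bundle_def)
    next
      show "continuous_on (Sigma UNIV (bundle_sum (preimage_bundle L V) (product_bundle (UNIV :: 'c set)))) (\<lambda>(l, w). \<phi> l w)"
        unfolding case_prod_unfold \<phi>_def
        by (intro continuous_intros contD continuous_on_compose2[OF continuous_N]
            continuous_on_compose2[OF continuous_L]) auto
    qed
    show "bundle_hom UNIV (bundle_sum boundary_bundle (product_bundle V))
        (bundle_sum (preimage_bundle L V) (product_bundle (UNIV :: 'c set))) \<phi>'"
      unfolding bundle_hom_def
    proof (intro conjI ballI allI)
      fix l :: 'l and w assume w: "w \<in> bundle_sum boundary_bundle (product_bundle V) l"
      have "fst (K l (snd w, fst w)) - fst (K l (D l (snd (K l (snd w, fst w))))) \<in> preimage_bundle L V l"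
        using w D(2)[of l "snd (K l (snd w, fst w))"] subspace_diff[OF sub]
        by (auto simp: preimage_bundle_def blinfun.diff_right L_fst_K J_def bundle_sum_def product_bundle_def D)
      then show "\<phi>' l w \<in> bundle_sum (preimage_bundle L V) (product_bundle (UNIV :: 'c set)) l"
        by (simp add: \<phi>'_def bundle_sum_def product_bundle_def Let_def)
    next
      fix l u v and r :: real
      show "\<phi>' l (u + v) = \<phi>' l u + \<phi>' l v" "\<phi>' l (r *\<^sub>R u) = r *\<^sub>R \<phi>' l u"
        using linear_add[OF linear_K, of l "(snd u, fst u)" "(snd v, fst v)"]
          linear_scale[OF linear_K, of l r "(snd u, fst u)"]
        by (simp_all add: \<phi>'_def Let_def linear_add[OF D(1)] linear_scale[OF D(1)]
            linear_add[OF linear_K] linear_scale[OF linear_K] scaleR_diff_right)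
    next
      show "continuous_on (Sigma UNIV (bundle_sum boundary_bundle (product_bundle V))) (\<lambda>(l, w). \<phi>' l w)"
        unfolding case_prod_unfold \<phi>'_def Let_def
        by (intro continuous_intros contD continuous_K)
    qed
    show "\<phi>' l (\<phi> l w) = w" for l w
      by (simp add: \<phi>'_def Kz snd_K_D)
    fix l :: 'l and w assume w: "w \<in> bundle_sum boundary_bundle (product_bundle V) l"
    have e: "(fst (\<phi>' l w), 0) + K l (D l (snd (\<phi>' l w))) = K l (snd w, fst w)"
      by (simp add: \<phi>'_def Let_def prod_eq_iff snd_K_D)
    have "(snd (\<phi> l (\<phi>' l w)), fst (\<phi> l (\<phi>' l w))) = blinfun_apply (N l) ((fst (\<phi>' l w), 0) + K l (D l (snd (\<phi>' l w))))"
      by (simp add: z[symmetric] blinfun.add_right D)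
    also have "\<dots> = (snd w, fst w)"
      using w unfolding e by (auto simp: Q_def bundle_sum_def)
    finally show "\<phi> l (\<phi>' l w) = w" by (simp add: prod_eq_iff)
  qed
  moreover have "bundle_iso UNIV (bundle_sum (product_bundle V) (product_bundle (UNIV :: 'c set)))
      (bundle_sum (product_bundle (UNIV :: 'c set)) (product_bundle V)) \<psi>"
  proof (rule bundle_isoI)
    show "bundle_hom UNIV (bundle_sum (product_bundle V) (product_bundle (UNIV :: 'c set)))
        (bundle_sum (product_bundle (UNIV :: 'c set)) (product_bundle V)) \<psi>"
      unfolding bundle_hom_def
    proof (intro conjI ballI allI)
      fix l :: 'l and w assume w: "w \<in> bundle_sum (product_bundle V) (product_bundle (UNIV :: 'c set)) l"
      show "\<psi> l w \<in> bundle_sum (product_bundle (UNIV :: 'c set)) (product_bundle V) l"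
        using w by (auto simp: \<psi>_def bundle_sum_def product_bundle_def intro!: subspace_add[OF sub] D)
    next
      fix l u v and r :: real
      show "\<psi> l (u + v) = \<psi> l u + \<psi> l v" "\<psi> l (r *\<^sub>R u) = r *\<^sub>R \<psi> l u"
        by (simp_all add: \<psi>_def linear_add[OF D(1)] linear_scale[OF D(1)] J0 algebra_simps)
    next
      show "continuous_on (Sigma UNIV (bundle_sum (product_bundle V) (product_bundle (UNIV :: 'c set)))) (\<lambda>(l, w). \<psi> l w)"
        unfolding case_prod_unfold \<psi>_def
        by (intro continuous_intros contD continuous_J)
    qed
    show "bundle_hom UNIV (bundle_sum (product_bundle (UNIV :: 'c set)) (product_bundle V))
        (bundle_sum (product_bundle V) (product_bundle (UNIV :: 'c set))) \<psi>'"
      unfolding bundle_hom_def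
    proof (intro conjI ballI allI)
      fix l :: 'l and w assume w: "w \<in> bundle_sum (product_bundle (UNIV :: 'c set)) (product_bundle V) l"
      show "\<psi>' l w \<in> bundle_sum (product_bundle V) (product_bundle (UNIV :: 'c set)) l"
        using w by (auto simp: \<psi>'_def Let_def bundle_sum_def product_bundle_def intro!: subspace_diff[OF sub] D)
    next
      fix l u v and r :: real
      show "\<psi>' l (u + v) = \<psi>' l u + \<psi>' l v" "\<psi>' l (r *\<^sub>R u) = r *\<^sub>R \<psi>' l u"
        by (simp_all add: \<psi>'_def Let_def linear_add[OF D(1)] linear_diff[OF D(1)] linear_scale[OF D(1)] J0 algebra_simps)
    next
      show "continuous_on (Sigma UNIV (bundle_sum (product_bundle (UNIV :: 'c set)) (product_bundle V))) (\<lambda>(l, w). \<psi>' l w)"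
        unfolding case_prod_unfold \<psi>'_def Let_def
        by (intro continuous_intros contD continuous_J)
    qed
    show "\<psi>' l (\<psi> l w) = w" "\<psi> l (\<psi>' l u) = u" for l w u
      by (simp_all add: \<psi>_def \<psi>'_def Let_def prod_eq_iff)
  qed
  \<comment> \<open>The square commutes over the whole base, not only over
    \<open>\<Lambda>\<^sub>0\<close>.\<close>
  moreover have "(case \<phi> l (x, c) of (u, v) \<Rightarrow> (case u of (a, b) \<Rightarrow> a - b, v)) = \<psi> l (blinfun_apply (L l) x, c)" for l x c
  proof -
    obtain a b y where p: "\<phi> l (x, c) = ((a, b), y)" by (metis prod.collapse)
    have y: "y = blinfun_apply (L l) x + fst (D l c)" using p by (simp add: \<phi>_def)
    have ab: "Pu l a = a" "Ps l b = b" using Qz[of l "(x, c)"] by (simp_all add: p Q_def)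
    have "J l (y, a, b) = c" using Kz[of l "(x, c)"] by (simp add: p J_def snd_K_D)
    then have "J l (y, 0, 0) - c = a - b" using J_decompose[of l y a b] by (simp add: ab algebra_simps)
    then show ?thesis by (simp add: p y \<psi>_def)
  qed
  ultimately show "triple_iso \<Lambda>\<^sub>0
     (triple_sum (preimage_bundle L V, product_bundle V, \<lambda>l. blinfun_apply (L l)) ?\<eta>)
     (triple_sum (boundary_bundle, product_bundle (UNIV :: 'c set), \<lambda>l (u, v). u - v) ?\<theta>)"
    unfolding triple_sum.simps triple_iso.simps
    by (intro exI[of _ \<phi>] exI[of _ \<psi>] conjI) auto
qed

end

section \<open>Fredholm index 0 and invertibility over the subspace\<close>

context boundary_family begin

text \<open>Both dimensions are constant on the connected base, and at a point of
  \<open>\<Lambda>\<^sub>0\<close> the two ranges are complementary. This identity is what makes the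
  index vanish everywhere.\<close>

lemma dim_sum_boundary: "dim (range (Pu l)) + dim (range (Ps l)) = DIM('c)"
proof -
  obtain m where m: "m \<in> \<Lambda>\<^sub>0" using \<Lambda>\<^sub>0_nonempty by blast
  have "dim (range (Pu l)) = dim (range (Pu m))"
    by (rule connected_local_const[OF connected UNIV_I UNIV_I])
      (blast intro: dim_range_projection_locally_constant linear_Pu Pu_idem continuous_Pu)
  moreover have "dim (range (Ps l)) = dim (range (Ps m))"
    by (rule connected_local_const[OF connected UNIV_I UNIV_I])
      (blast intro: dim_range_projection_locally_constant linear_Ps Ps_idem continuous_Ps)
  moreover have "dim {x + y |x y. x \<in> range (Pu m) \<and> y \<in> range (Ps m)} + dim (range (Pu m) \<inter> range (Ps m))
      = dim (range (Pu m)) + dim (range (Ps m))"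
    by (rule dim_sums_Int[OF subspace_Pu subspace_Ps])
  moreover have "{x + y |x y. x \<in> range (Pu m) \<and> y \<in> range (Ps m)} = UNIV"
    using \<Lambda>\<^sub>0_sum[OF m] by blast
  ultimately show ?thesis by (simp add: \<Lambda>\<^sub>0_Int[OF m])
qed

text \<open>A homogeneous solution with boundary values a and b has the jump b - a, so the source of
  this pure jump is cancelled by an image under L.\<close>

lemma fst_N_jump: "fst (blinfun_apply (N l) (0, b - a)) \<in> range (blinfun_apply (L l))"
  if "Pu l a = a" "Ps l b = b"
proof -
  have "J l (0, a, b) = b - a" using that by (simp add: J_boundary)
  then have "fst (blinfun_apply (N l) (0, b - a)) = blinfun_apply (L l) (- fst (K l (0, a, b)))"
    using L_fst_K[of l "(0, a, b)"] by (simp add: blinfun.minus_right)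
  then show ?thesis by blast
qed

lemma fredholm_index_0_L: "fredholm_index_0 (L l)"
proof -
  \<comment> \<open>The range of \<open>L\<^sub>\<lambda>\<close> is \<open>{f. J(f, 0, 0) \<in> S}\<close>; it is complemented by the image of \<open>S\<^sup>\<bottom>\<close> under
    \<open>\<kappa> c = (w' - A w)\<close>, where \<open>w\<close> is the pure jump \<open>c\<close>.\<close>
  define S where "S = {x + y |x y. x \<in> range (Pu l) \<and> y \<in> range (Ps l)}"
  \<comment> \<open>A sum of subspaces is also their set of differences; in this form its elements
    are the jumps of homogeneous solutions.\<close>
  have S_iff: "c \<in> S \<longleftrightarrow> (\<exists>a b. Pu l a = a \<and> Ps l b = b \<and> c = b - a)" for c
  proof
    assume "c \<in> S"
    then obtain a b where "c = Pu l a + Ps l b"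
      by (auto simp: S_def)
    then show "\<exists>a b. Pu l a = a \<and> Ps l b = b \<and> c = b - a"
      by (intro exI[of _ "- Pu l a"] exI[of _ "Ps l b"]) (simp add: linear_neg[OF linear_Pu])
  next
    assume "\<exists>a b. Pu l a = a \<and> Ps l b = b \<and> c = b - a"
    then obtain a b where ab: "Pu l a = a" "Ps l b = b" "c = b - a" by blast
    then have "c = Pu l (- a) + Ps l b" by (simp add: linear_neg[OF linear_Pu])
    then show "c \<in> S" unfolding S_def by blast
  qed
  have subS: "subspace S"
    unfolding S_def by (rule subspace_sums[OF subspace_Pu subspace_Ps])
  define Z where "Z = {y \<in> UNIV. \<forall>x\<in>S. orthogonal x y}"
  define \<kappa> where "\<kappa> c = fst (blinfun_apply (N l) (0, c))" for c
  have lin\<kappa>: "linear \<kappa>"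
  proof -
    have "blinfun_apply (N l) (0, u + v) = blinfun_apply (N l) (0, u) + blinfun_apply (N l) (0, v)"
      "blinfun_apply (N l) (0, r *\<^sub>R u) = r *\<^sub>R blinfun_apply (N l) (0, u)" for u v r
      by (simp_all add: blinfun.add_right[symmetric] blinfun.scaleR_right[symmetric])
    then show ?thesis by (simp add: linear_iff \<kappa>_def)
  qed
  have range_iff: "f \<in> range (blinfun_apply (L l)) \<longleftrightarrow> J l (f, 0, 0) \<in> S" for f
  proof
    assume "f \<in> range (blinfun_apply (L l))"
    then obtain x where x: "f = blinfun_apply (L l) x" by blast
    define a b where "a = fst (snd (blinfun_apply (N l) (x, 0)))" and "b = snd (snd (blinfun_apply (N l) (x, 0)))"
    have N: "blinfun_apply (N l) (x, 0) = (f, a, b)"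
      by (simp add: x a_def b_def prod_eq_iff N_L)
    have ab: "Pu l a = a" "Ps l b = b" using Q_N[of l "(x, 0)"] by (simp_all add: N Q_def)
    have "0 = J l (f, a, b)" unfolding N[symmetric] by (simp add: J_def)
    then have "J l (f, 0, 0) = a - b"
      using J_decompose[of l f a b] by (simp add: ab) (metis add_diff_cancel_right')
    then have "J l (f, 0, 0) = - b - (- a)" by simp
    then show "J l (f, 0, 0) \<in> S"
      unfolding S_iff using ab
      by (intro exI[of _ "- a"] exI[of _ "- b"]) (simp add: linear_neg[OF linear_Pu] linear_neg[OF linear_Ps])
  next
    assume "J l (f, 0, 0) \<in> S"
    then obtain a b where ab: "Pu l a = a" "Ps l b = b" "J l (f, 0, 0) = b - a" unfolding S_iff by blast
    obtain x where "fst (blinfun_apply (N l) (0, b - a)) = blinfun_apply (L l) x"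
      using fst_N_jump[OF ab(1,2)] by blast
    then have "f = blinfun_apply (L l) (fst (K l (f, 0, 0)) + x)"
      using L_fst_K[of l "(f, 0, 0)"] by (simp add: ab(3) blinfun.add_right)
    then show "f \<in> range (blinfun_apply (L l))" by blast
  qed
  have \<kappa>_range: "\<kappa> s \<in> range (blinfun_apply (L l))" if "s \<in> S" for s
    using that fst_N_jump unfolding S_iff \<kappa>_def by blast
  have \<kappa>_S: "c \<in> S" if "\<kappa> c \<in> range (blinfun_apply (L l))" for c
  proof -
    obtain x where x: "\<kappa> c = blinfun_apply (L l) x" using \<open>\<kappa> c \<in> _\<close> by blast
    obtain y a b where N: "blinfun_apply (N l) (- x, c) = (y, a, b)" by (metis prod.collapse)
    have "y = 0" using fst_N[of l "- x" c] x by (simp add: N \<kappa>_def blinfun.minus_right)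
    then have "c = b - a" using jump N by blast
    moreover have "Pu l a = a" "Ps l b = b" using Q_N[of l "(- x, c)"] by (simp_all add: N Q_def)
    ultimately show ?thesis unfolding S_iff by blast
  qed
  have SO: "c = 0" if "c \<in> S" "c \<in> Z" for c
    using that by (auto simp: Z_def orthogonal_def)
  have subO: "subspace Z"
    by (auto simp: Z_def subspace_def orthogonal_clauses)
  \<comment> \<open>The kernel consists of the homogeneous solutions without jump; these have one
    boundary value a, common to both sides.\<close>
  have ker: "{x. blinfun_apply (L l) x = 0} = (\<lambda>a. fst (K l (0, a, a))) ` (range (Pu l) \<inter> range (Ps l))"
  proof (intro equalityI subsetI; (elim CollectE imageE)?)
    fix x assume "blinfun_apply (L l) x = 0"
    then obtain a b where N: "blinfun_apply (N l) (x, 0) = (0, a, b)"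
      using N_L[of l x] by (metis prod.collapse)
    then have "a = b" using jump by fastforce
    moreover have "Pu l a = a" "Ps l b = b" using Q_N[of l "(x, 0)"] by (simp_all add: N Q_def)
    moreover have "fst (K l (0, a, b)) = x" unfolding N[symmetric] by simp
    ultimately show "x \<in> (\<lambda>a. fst (K l (0, a, a))) ` (range (Pu l) \<inter> range (Ps l))"
      by (intro image_eqI[of _ _ a]) (auto simp: range_Pu_iff range_Ps_iff)
  next
    fix x a assume x: "x = fst (K l (0, a, a))" and a: "a \<in> range (Pu l) \<inter> range (Ps l)"
    have "J l (0, a, a) = 0" using a by (simp add: J_boundary range_Pu_iff range_Ps_iff)
    then show "x \<in> {x. blinfun_apply (L l) x = 0}"
      by (simp add: x L_fst_K zero_prod_def[symmetric])
  qed
  have linK: "linear (\<lambda>a. fst (K l (0, a, a)))"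
  proof -
    have "K l (0, u + v, u + v) = K l (0, u, u) + K l (0, v, v)" "K l (0, r *\<^sub>R u, r *\<^sub>R u) = r *\<^sub>R K l (0, u, u)" for u v r
      by (simp_all add: linear_add[OF linear_K, symmetric] linear_scale[OF linear_K, symmetric])
    then show ?thesis by (simp add: linear_iff)
  qed
  have sub_Int: "subspace (range (Pu l) \<inter> range (Ps l))"
    by (intro subspace_inter subspace_Pu subspace_Ps)
  have injK: "inj_on (\<lambda>a. fst (K l (0, a, a))) (range (Pu l) \<inter> range (Ps l))"
  proof (rule linear_injective_on_subspace_0[THEN iffD2, OF linK sub_Int], intro ballI impI)
    fix a assume a: "a \<in> range (Pu l) \<inter> range (Ps l)" "fst (K l (0, a, a)) = 0"
    then have "Q l (0, a, a) = (0, a, a)" "J l (0, a, a) = 0"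
      by (simp_all add: Q_def J_boundary range_Pu_iff range_Ps_iff)
    then have "K l (0, a, a) = 0" using a by (simp add: J_def prod_eq_iff)
    then show "a = 0" using N_K[of l "(0, a, a)"] \<open>Q l (0, a, a) = (0, a, a)\<close>
      by (simp add: zero_prod_def[symmetric]) (simp add: zero_prod_def)
  qed
  have inj\<kappa>: "inj_on \<kappa> Z"
  proof (rule linear_injective_on_subspace_0[THEN iffD2, OF lin\<kappa> subO], intro ballI impI)
    fix c assume "c \<in> Z" "\<kappa> c = 0"
    then show "c = 0" using SO \<kappa>_S[of c] by (metis blinfun.zero_right rangeI)
  qed
  show ?thesis
    unfolding fredholm_index_0_def
  proof (intro conjI exI[of _ "\<kappa> ` Z"] allI)
    have "range (blinfun_apply (L l)) = (\<lambda>f. J l (f, 0, 0)) -` S" using range_iff by blast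
    then show "closed (range (blinfun_apply (L l)))"
      using closed_vimage[OF closed_subspace[OF subS] linear_continuous_on[OF bounded_linear_J]] by simp
    show "finite_dim_subspace {x. blinfun_apply (L l) x = 0}"
      unfolding ker by (intro finite_dim_subspace_image finite_dim_subspace_subspace linK sub_Int)
    show "finite_dim_subspace (\<kappa> ` Z)"
      by (intro finite_dim_subspace_image finite_dim_subspace_subspace lin\<kappa> subO)
    show "range (blinfun_apply (L l)) \<inter> \<kappa> ` Z = {0}"
    proof (intro equalityI subsetI)
      fix f assume "f \<in> range (blinfun_apply (L l)) \<inter> \<kappa> ` Z"
      then obtain c where f: "f \<in> range (blinfun_apply (L l))" "f = \<kappa> c" "c \<in> Z" by blast
      have "c = 0" using f by (intro SO[OF \<kappa>_S]) simp_all
      then show "f \<in> {0}" using f linear_0[OF lin\<kappa>] by simp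
    next
      fix f :: 'y assume "f \<in> {0}"
      then show "f \<in> range (blinfun_apply (L l)) \<inter> \<kappa> ` Z"
        using linear_0[OF lin\<kappa>] subspace_0[OF subO] by (auto intro: image_eqI[of _ _ 0])
    qed
    \<comment> \<open>Index 0 amounts to dim (E^u \<inter> E^s) = d - dim (E^u + E^s), which follows
      from dim E^u + dim E^s = d.\<close>
    show "dim {x. blinfun_apply (L l) x = 0} = dim (\<kappa> ` Z)"
    proof -
      have "dim {x. blinfun_apply (L l) x = 0} = dim (range (Pu l) \<inter> range (Ps l))"
        unfolding ker by (rule dim_image_inj_on[OF linK sub_Int injK])
      moreover have "dim (\<kappa> ` Z) = dim Z" by (rule dim_image_inj_on[OF lin\<kappa> subO inj\<kappa>])
      moreover have "dim Z + dim S = DIM('c)"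
        using dim_subspace_orthogonal_to_vectors[OF subS subspace_UNIV subset_UNIV] by (simp add: Z_def)
      moreover have "dim S + dim (range (Pu l) \<inter> range (Ps l)) = dim (range (Pu l)) + dim (range (Ps l))"
        unfolding S_def by (rule dim_sums_Int[OF subspace_Pu subspace_Ps])
      ultimately show ?thesis using dim_sum_boundary[of l] by linarith
    qed
    fix y
    \<comment> \<open>The jump of the solution with source y is split: the source of its part in
      \<open>S\<close> lies in the range of L, its part in \<open>Z\<close> gives the component in
      the complement.\<close>
    define c where "c = J l (y, 0, 0)"
    obtain s o' where so: "s \<in> S" "o' \<in> Z" "c = s + o'"
    proof -
      obtain s o' where "s \<in> span S" "\<And>w. w \<in> span S \<Longrightarrow> orthogonal o' w" "c = s + o'"
        using orthogonal_subspace_decomp_exists[of S c] by metis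
      then show ?thesis
        using span_eq_iff[THEN iffD2, OF subS] by (intro that[of s o']) (auto simp: Z_def orthogonal_commute)
    qed
    obtain x where x: "\<kappa> s = blinfun_apply (L l) x" using \<kappa>_range[OF so(1)] by blast
    have "y = blinfun_apply (L l) (fst (K l (y, 0, 0)) + x) + \<kappa> o'"
      using L_fst_K[of l "(y, 0, 0)"] linear_add[OF lin\<kappa>, of s o'] x
      by (simp add: c_def[symmetric] so(3) blinfun.add_right \<kappa>_def)
    then show "\<exists>x. \<exists>w\<in>\<kappa> ` Z. y = blinfun_apply (L l) x + w"
      using so(2) by blast
  qed
qed

lemma invertible_op_L:
  assumes l: "l \<in> \<Lambda>\<^sub>0"
  shows "invertible_op (L l)"
proof -
  obtain C where C: "\<And>x. norm x \<le> C * norm (blinfun_apply (L l) x)"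
    using L_bounded_below[OF l] by blast
  have inj: "inj (blinfun_apply (L l))" by (rule inj_bounded_below[OF C])
  define T where "T = inv (blinfun_apply (L l))"
  have LT: "blinfun_apply (L l) (T y) = y" for y
    unfolding T_def by (rule f_inv_into_f) (simp add: L_surj[OF l])
  have TL: "T (blinfun_apply (L l) x) = x" for x
    unfolding T_def by (rule inv_f_f[OF inj])
  have "bounded_linear T"
  proof (rule bounded_linear_intro[where K=C])
    show "T (x + y) = T x + T y" for x y
      by (rule injD[OF inj]) (simp add: LT blinfun.add_right)
    show "T (r *\<^sub>R x) = r *\<^sub>R T x" for r x
      by (rule injD[OF inj]) (simp add: LT blinfun.scaleR_right)
    show "norm (T y) \<le> norm y * C" for y
      using C[of "T y"] by (simp add: LT mult.commute)
  qed
  then have "blinfun_apply (Blinfun T) = T" by (rule bounded_linear_Blinfun_apply)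
  then show ?thesis
    unfolding invertible_op_def
    by (intro exI[of _ "Blinfun T"] conjI blinfun_eqI) (simp_all add: LT TL)
qed

text \<open>The definition picks V by \<open>SOME\<close>; a transversal V exists by compactness,
  and the equivalence holds for whichever is picked. Membership in \<open>KO\<close> shows that the
  common value is not the default \<open>{}\<close>.\<close>

theorem index_bundle_boundary:
  "index_bundle \<Lambda>\<^sub>0 L = KO_class \<Lambda>\<^sub>0 (boundary_bundle, product_bundle UNIV, \<lambda>l (u, v). u - v)"
  "index_bundle \<Lambda>\<^sub>0 L \<in> KO \<Lambda>\<^sub>0"
proof -
  have "transversal L (SOME V. transversal L V)"
    using exists_transversal by (rule someI_ex)
  then have "KO_equiv \<Lambda>\<^sub>0 (preimage_bundle L (SOME V. transversal L V),
      product_bundle (SOME V. transversal L V), \<lambda>l. blinfun_apply (L l))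
     (boundary_bundle, product_bundle UNIV, \<lambda>l (u, v). u - v)"
    by (rule KO_equiv_index_boundary)
  moreover have "fredholm_pair \<Lambda>\<^sub>0 L"
    unfolding fredholm_pair_def using continuous_L fredholm_index_0_L invertible_op_L by blast
  ultimately show *: "index_bundle \<Lambda>\<^sub>0 L = KO_class \<Lambda>\<^sub>0 (boundary_bundle, product_bundle UNIV, \<lambda>l (u, v). u - v)"
    unfolding index_bundle_def Let_def by (simp add: KO_class_eq)
  show "index_bundle \<Lambda>\<^sub>0 L \<in> KO \<Lambda>\<^sub>0"
    unfolding * by (rule KO_class_in_KO[OF KO_triple_boundary])
qed

end

section \<open>Primitives of locally integrable functions\<close>

text \<open>Local absolute continuity, expressed by integrals over intervals so that
  differentiability almost everywhere never enters. \<open>g\<close> is determined by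
  \<open>F\<close> only up to null sets.\<close>

definition primitive :: "(real \<Rightarrow> 'b::euclidean_space) \<Rightarrow> (real \<Rightarrow> 'b) \<Rightarrow> bool" where
  "primitive F g \<longleftrightarrow> g \<in> borel_measurable borel \<and>
     (\<forall>a b. set_integrable lborel {a..b} g) \<and>
     (\<forall>a b. a \<le> b \<longrightarrow> F b - F a = (LINT t:{a..b}|lborel. g t))"

lemma primitiveD:
  assumes "primitive F g"
  shows "g \<in> borel_measurable borel" "set_integrable lborel {a..b} g"
    "a \<le> b \<Longrightarrow> F b - F a = (LINT t:{a..b}|lborel. g t)"
  using assms by (auto simp: primitive_def)

lemma primitive_henstock:
  assumes "primitive F g"
  shows "g integrable_on {a..b}" and "a \<le> b \<Longrightarrow> F b = F a + integral {a..b} g"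
proof -
  note * = set_borel_integral_eq_integral[OF primitiveD(2)[OF assms], of a b]
  show "g integrable_on {a..b}" by (rule *)
  show "a \<le> b \<Longrightarrow> F b = F a + integral {a..b} g"
    using primitiveD(3)[OF assms, of a b] *(2) by (simp add: algebra_simps)
qed

lemma primitive_continuous:
  assumes "primitive F g"
  shows "continuous_on UNIV F"
proof (rule continuous_at_imp_continuous_on, rule ballI)
  fix x :: real
  have "continuous_on {x - 1..x + 1} (\<lambda>t. F (x - 1) + integral {x - 1..t} g)"
    by (intro continuous_intros indefinite_integral_continuous_1 primitive_henstock(1)[OF assms])
  then have "continuous_on {x - 1..x + 1} F"
    by (rule continuous_on_eq) (simp add: primitive_henstock(2)[OF assms, of "x - 1", symmetric])
  then show "isCont F x"
    by (rule continuous_on_interior) (simp add: interior_atLeastAtMost_real)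
qed

lemma primitiveI_continuous:
  assumes F: "\<And>t. (F has_vector_derivative g t) (at t)" and g: "continuous_on UNIV g"
  shows "primitive F g"
  unfolding primitive_def
proof (intro conjI allI impI)
  show "g \<in> borel_measurable borel" by (rule borel_measurable_continuous_onI[OF g])
  show "set_integrable lborel {a..b} g" for a b
    by (rule borel_integrable_atLeastAtMost'[OF continuous_on_subset[OF g]]) simp
  show "F b - F a = (LINT t:{a..b}|lborel. g t)" if "a \<le> b" for a b
    unfolding set_lebesgue_integral_def
    by (rule integral_FTC_atLeastAtMost[symmetric, OF that has_vector_derivative_at_within[OF F]
          continuous_on_subset[OF g]]) simp
qed

lemma primitive_has_vector_derivative:
  assumes F: "primitive F g" and g: "continuous_on UNIV g"
  shows "(F has_vector_derivative g t) (at t)"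
proof -
  have "((\<lambda>u. integral {t - 1..u} g) has_vector_derivative g t) (at t within {t - 1..t + 1})"
    by (rule integral_has_vector_derivative[OF continuous_on_subset[OF g]]) auto
  then have "((\<lambda>u. F (t - 1) + integral {t - 1..u} g) has_vector_derivative 0 + g t) (at t within {t - 1..t + 1})"
    by (intro has_vector_derivative_add has_vector_derivative_const)
  then have "(F has_vector_derivative 0 + g t) (at t within {t - 1..t + 1})"
    by (rule has_vector_derivative_transform[rotated 2])
      (simp_all add: primitive_henstock(2)[OF F, of "t - 1", symmetric])
  then show ?thesis
    by (simp add: at_within_interior[of t "{t - 1..t + 1}"] interior_atLeastAtMost_real)
qed

lemma primitive_AE_cong:
  assumes F: "primitive F g" and g': "g' \<in> borel_measurable borel" and eq: "AE t in lborel. g t = g' t"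
  shows "primitive F g'"
proof -
  have [measurable]: "g \<in> borel_measurable borel" using F by (simp add: primitive_def)
  note [measurable] = g'
  have "set_integrable lborel {a..b} g'" for a b
    using primitiveD(2)[OF F, of a b] unfolding set_integrable_def
    by (rule integrable_cong_AE_imp) (use eq in auto)
  moreover have "(LINT t:{a..b}|lborel. g t) = (LINT t:{a..b}|lborel. g' t)" for a b
    unfolding set_lebesgue_integral_def by (rule integral_cong_AE) (use eq in auto)
  ultimately show ?thesis using F g' by (simp add: primitive_def)
qed

lemma primitive_bounded_linear:
  assumes h: "bounded_linear h" and F: "primitive F g"
  shows "primitive (\<lambda>t. h (F t)) (\<lambda>t. h (g t))"
proof -
  interpret bounded_linear h by fact
  have [measurable]: "g \<in> borel_measurable borel" using F by (simp add: primitive_def)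
  have [measurable]: "h \<in> borel_measurable borel"
    by (intro borel_measurable_continuous_onI linear_continuous_on h)
  have "set_integrable lborel {a..b} (\<lambda>t. h (g t))"
    "(LINT t:{a..b}|lborel. h (g t)) = h (LINT t:{a..b}|lborel. g t)" for a b
    using integrable_bounded_linear[OF h primitiveD(2)[OF F, unfolded set_integrable_def, of a b]]
      integral_bounded_linear[OF h primitiveD(2)[OF F, unfolded set_integrable_def, of a b]]
    by (simp_all add: set_integrable_def set_lebesgue_integral_def scaleR)
  then show ?thesis using F by (simp add: primitive_def diff[symmetric])
qed

lemma primitive_add:
  assumes F: "primitive F g" and G: "primitive G h"
  shows "primitive (\<lambda>t. F t + G t) (\<lambda>t. g t + h t)"
  using assms unfolding primitive_def
  by (auto simp: set_integral_add algebra_simps)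

lemma primitive_diff:
  assumes F: "primitive F g" and G: "primitive G h"
  shows "primitive (\<lambda>t. F t - G t) (\<lambda>t. g t - h t)"
  using primitive_add[OF F primitive_bounded_linear[OF bounded_linear_minus[OF bounded_linear_ident] G]]
  by simp

lemma primitive_reflect:
  assumes F: "primitive F g"
  shows "primitive (\<lambda>t. F (- t)) (\<lambda>t. - g (- t))"
proof -
  have [measurable]: "g \<in> borel_measurable borel" using F by (simp add: primitive_def)
  have *: "indicator {a..b} (- t) = (indicator {- b..- a} t :: real)" for a b t :: real
    by (auto simp: indicator_def)
  have "set_integrable lborel {a..b} (\<lambda>t. g (- t))" for a b
    using primitiveD(2)[OF F, of "- b" "- a"]
    lborel_integrable_real_affine_iff[of "-1" "\<lambda>t. indicator {- b..- a} t *\<^sub>R g t" 0]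
    unfolding set_integrable_def by (simp add: *)
  moreover have "(LINT t:{a..b}|lborel. - g (- t)) = F (- b) - F (- a)" if "a \<le> b" for a b
    using primitiveD(3)[OF F, of "- b" "- a"] that
      lborel_integral_real_affine[of "-1" "\<lambda>t. indicator {- b..- a} t *\<^sub>R g t" 0]
    unfolding set_lebesgue_integral_def by (simp add: *) (metis minus_diff_eq)
  ultimately show ?thesis
    unfolding primitive_def by (auto simp: set_integrable_def)
qed

lemma set_integral_combine:
  fixes g :: "real \<Rightarrow> 'b::euclidean_space"
  assumes g: "\<And>a b. set_integrable lborel {a..b} g" and "a \<le> b" "b \<le> c"
  shows "(LINT t:{a..c}|lborel. g t) = (LINT t:{a..b}|lborel. g t) + (LINT t:{b..c}|lborel. g t)"
  using Henstock_Kurzweil_Integration.integral_combine[OF assms(2,3) set_borel_integral_eq_integral(1)[OF g]]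
    set_borel_integral_eq_integral(2)[OF g] by simp

text \<open>Increments across 0 add up because the two primitives agree there. Solutions on the two
  half-lines become functions on the line in this way.\<close>

lemma primitive_glue:
  assumes F: "primitive F g" and G: "primitive G h" and eq: "F 0 = G 0"
  shows "primitive (\<lambda>t. if t \<le> 0 then F t else G t) (\<lambda>t. if t \<le> 0 then g t else h t)"
    (is "primitive ?F ?g")
proof -
  have [measurable]: "g \<in> borel_measurable borel" "h \<in> borel_measurable borel"
    using F G by (simp_all add: primitive_def)
  have m: "?g \<in> borel_measurable borel" by measurable
  have int: "set_integrable lborel {a..b} ?g" for a b
  proof -
    have "set_integrable lborel ({a..b} \<inter> {..0}) ?g = set_integrable lborel ({a..b} \<inter> {..0}) g"
      "set_integrable lborel ({a..b} \<inter> {0<..}) ?g = set_integrable lborel ({a..b} \<inter> {0<..}) h"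
      unfolding set_integrable_def
      by (intro Bochner_Integration.integrable_cong refl; auto simp: indicator_def)+
    moreover have "set_integrable lborel ({a..b} \<inter> {..0}) g" "set_integrable lborel ({a..b} \<inter> {0<..}) h"
      by (rule set_integrable_subset[OF primitiveD(2)[OF F, of a b]]
          set_integrable_subset[OF primitiveD(2)[OF G, of a b]]; simp)+
    ultimately have "set_integrable lborel (({a..b} \<inter> {..0}) \<union> ({a..b} \<inter> {0<..})) ?g"
      by (intro set_integrable_Un) auto
    also have "({a..b} \<inter> {..0}) \<union> ({a..b} \<inter> {0<..}) = {a..b}" by auto
    finally show ?thesis .
  qed
  have neg: "(LINT t:{a..b}|lborel. ?g t) = F b - F a" if "a \<le> b" "b \<le> 0" for a b
    using primitiveD(3)[OF F that(1)] that(2)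
    by (simp add: set_lebesgue_integral_def cong: Bochner_Integration.integral_cong)
      (auto intro!: Bochner_Integration.integral_cong simp: indicator_def)
  have pos: "(LINT t:{a..b}|lborel. ?g t) = G b - G a" if "a \<le> b" "0 \<le> a" for a b
  proof -
    have "(LINT t:{a..b}|lborel. ?g t) = (LINT t:{a..b}|lborel. h t)"
      unfolding set_lebesgue_integral_def
    proof (rule integral_cong_AE)
      \<comment> \<open>For a = 0 the integrands may differ at the single point 0, where
        \<open>?g\<close> follows the left branch.\<close>
      show "AE t in lborel. indicator {a..b} t *\<^sub>R ?g t = indicator {a..b} t *\<^sub>R h t"
        by (rule eventually_mono[OF AE_lborel_singleton[of "0::real"]])
          (use that(2) in \<open>auto simp: indicator_def\<close>)
    qed measurable
    then show ?thesis using primitiveD(3)[OF G that(1)] by simp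
  qed
  have "?F b - ?F a = (LINT t:{a..b}|lborel. ?g t)" if "a \<le> b" for a b
  proof -
    consider "b \<le> 0" | "0 \<le> a" | "a < 0" "0 < b" by linarith
    then show ?thesis
    proof cases
      case 1 then show ?thesis using neg[of a b] that by simp
    next
      case 2 then show ?thesis using pos[of a b] that eq by (cases "a = 0"; cases "b = 0") auto
    next
      case 3 then show ?thesis
        using set_integral_combine[OF int, of a 0 b] neg[of a 0] pos[of 0 b] eq by simp
    qed
  qed
  then show ?thesis using m int by (auto simp: primitive_def)
qed

section \<open>Product rule and uniqueness of the derivative of a primitive\<close>

lemma set_integrable_prod:
  fixes prod :: "'a::euclidean_space \<Rightarrow> 'b::euclidean_space \<Rightarrow> 'c::euclidean_space"
    and g :: "real \<Rightarrow> 'b"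
  assumes bl: "bounded_bilinear prod" and H: "continuous_on UNIV H"
    and g: "g \<in> borel_measurable borel" "set_integrable lborel {a..b} g"
  shows "set_integrable lborel {a..b} (\<lambda>t. prod (H t) (g t))"
    and "(\<lambda>t. prod (H t) (g t)) \<in> borel_measurable borel"
proof -
  interpret bounded_bilinear prod by fact
  note [measurable] = g(1) borel_measurable_continuous_onI[OF H]
  have "continuous_on UNIV (\<lambda>p. prod (fst p) (snd p))"
    by (intro continuous_on continuous_intros)
  from borel_measurable_continuous_Pair[OF borel_measurable_continuous_onI[OF H] g(1) this]
  show m [measurable]: "(\<lambda>t. prod (H t) (g t)) \<in> borel_measurable borel" .
  obtain K where K: "K > 0" "\<And>a b. norm (prod a b) \<le> norm a * norm b * K" using pos_bounded by blast
  have "\<exists>M. \<forall>t\<in>{a..b}. norm (H t) \<le> M"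
    using compact_imp_bounded[OF compact_continuous_image[OF continuous_on_subset[OF H subset_UNIV] compact_Icc], of a b]
    by (auto simp: bounded_iff)
  then obtain M where M: "\<And>t. t \<in> {a..b} \<Longrightarrow> norm (H t) \<le> M" by blast
  have "set_integrable lborel {a..b} (\<lambda>t. (M * K) *\<^sub>R g t)"
    using g(2) by (intro set_integrable_scaleR_right)
  then show "set_integrable lborel {a..b} (\<lambda>t. prod (H t) (g t))" unfolding set_integrable_def
  proof (rule Bochner_Integration.integrable_bound)
    show "AE t in lborel. norm (indicator {a..b} t *\<^sub>R prod (H t) (g t)) \<le> norm (indicator {a..b} t *\<^sub>R (M * K) *\<^sub>R g t)"
    proof (rule AE_I2)
      fix t show "norm (indicator {a..b} t *\<^sub>R prod (H t) (g t)) \<le> norm (indicator {a..b} t *\<^sub>R (M * K) *\<^sub>R g t)"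
      proof (cases "t \<in> {a..b}")
        case True
        have "norm (prod (H t) (g t)) \<le> norm (H t) * norm (g t) * K" by (rule K)
        also have "\<dots> \<le> M * norm (g t) * K"
          using K(1) M[OF True] by (intro mult_right_mono) auto
        also have "\<dots> \<le> \<bar>M * K\<bar> * norm (g t)"
          using mult_right_mono[OF abs_ge_self[of "M * K"] norm_ge_zero[of "g t"]] by (simp add: mult_ac)
        finally show ?thesis using True by simp
      qed simp
    qed
  qed measurable
qed

lemma primitive_prod:
  fixes prod :: "'a::euclidean_space \<Rightarrow> 'b::euclidean_space \<Rightarrow> 'c::euclidean_space"
  assumes bl: "bounded_bilinear prod" and F: "primitive F g"
    and H: "\<And>t. (H has_vector_derivative H' t) (at t)" and H': "continuous_on UNIV H'"
  shows "primitive (\<lambda>t. prod (H t) (F t)) (\<lambda>t. prod (H' t) (F t) + prod (H t) (g t))"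
proof -
  interpret bounded_bilinear prod by fact
  have contH: "continuous_on UNIV H"
    using H by (auto intro!: continuous_at_imp_continuous_on has_vector_derivative_continuous)
  note contF = primitive_continuous[OF F]
  have [measurable]: "g \<in> borel_measurable borel" using F by (simp add: primitive_def)
  have [measurable]: "H \<in> borel_measurable borel" "H' \<in> borel_measurable borel" "F \<in> borel_measurable borel"
    by (auto intro!: borel_measurable_continuous_onI contH H' contF)
  have cp: "continuous_on UNIV (\<lambda>p. prod (fst p) (snd p))"
    by (intro continuous_on continuous_intros)
  have mp [measurable]: "(\<lambda>t. prod (u t) (v t)) \<in> borel_measurable M"
    if "u \<in> borel_measurable M" "v \<in> borel_measurable M" for u v and M :: "'z measure"
    by (rule borel_measurable_continuous_Pair[OF that cp])
  obtain K where K: "K > 0" "\<And>a b. norm (prod a b) \<le> norm a * norm b * K" using pos_bounded by blast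
  note PH = primitiveI_continuous[OF H H']
  have bound: "\<exists>M. \<forall>t\<in>{a..b}. norm (q t) \<le> M" if "continuous_on UNIV q"
    for a b and q :: "real \<Rightarrow> 'z::real_normed_vector"
    using compact_imp_bounded[OF compact_continuous_image[OF continuous_on_subset[OF that subset_UNIV] compact_Icc], of a b]
    by (auto simp: bounded_iff)
  have int: "set_integrable lborel {a..b} (\<lambda>t. prod (H t) (g t))" for a b
    using primitiveD(1,2)[OF F] by (rule set_integrable_prod(1)[OF bl contH])
  have int': "set_integrable lborel {a..b} (\<lambda>t. prod (H' t) (F t))" for a b
    by (intro borel_integrable_atLeastAtMost' continuous_on continuous_on_subset[OF H'] continuous_on_subset[OF contF]) auto
  have "prod (H b) (F b) - prod (H a) (F a) = (LINT t:{a..b}|lborel. prod (H' t) (F t) + prod (H t) (g t))"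
    if ab: "a \<le> b" for a b
  proof -
    \<comment> \<open>Fubini on the triangle \<open>a \<le> s \<le> r \<le> b\<close>.\<close>
    define k where "k s r = indicator {a..b} s *\<^sub>R indicator {s..b} r *\<^sub>R prod (H' r) (g s)" for s r :: real
    have k': "k s r = indicator {a..b} r *\<^sub>R indicator {a..r} s *\<^sub>R prod (H' r) (g s)" for s r
      by (auto simp: k_def indicator_def)
    obtain M where M: "\<And>t. t \<in> {a..b} \<Longrightarrow> norm (H' t) \<le> M" using bound[OF H', of a b] by blast
    have M0: "M \<ge> 0" using order_trans[OF norm_ge_zero M[of a]] ab by simp
    have ii: "integrable lborel (indicat_real {a..b})"
      by (rule integrable_real_indicator) (auto simp: emeasure_lborel_Icc_eq)
    have "integrable (lborel \<Otimes>\<^sub>M lborel) (\<lambda>p. norm (indicator {a..b} (fst p) *\<^sub>R g (fst p)) * (indicator {a..b} (snd p) * (M * K)))"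
    proof (rule lborel_pair.Fubini_integrable)
      have "(\<lambda>x. LINT y|lborel. norm (norm (indicator {a..b} x *\<^sub>R g x) * (indicator {a..b} y * (M * K))))
          = (\<lambda>x. norm (indicator {a..b} x *\<^sub>R g x) * ((b - a) * (M * K)))"
        using K(1) M0 ab by (simp add: abs_mult)
      then show "integrable lborel (\<lambda>x. LINT y|lborel. norm (norm (indicator {a..b} (fst (x, y)) *\<^sub>R g (fst (x, y))) * (indicator {a..b} (snd (x, y)) * (M * K))))"
        unfolding fst_conv snd_conv
        using integrable_mult_left[OF integrable_norm[OF primitiveD(2)[OF F, of a b, unfolded set_integrable_def]],
            of "(b - a) * (M * K)"] by simp
    qed (simp_all add: ii)
    then have "integrable (lborel \<Otimes>\<^sub>M lborel) (\<lambda>(s, r). k s r)"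
    proof (rule Bochner_Integration.integrable_bound)
      show "(\<lambda>(s, r). k s r) \<in> borel_measurable (lborel \<Otimes>\<^sub>M lborel)"
      proof -
        have "(\<lambda>(s, r). k s r) = (\<lambda>p. (if a \<le> fst p \<and> fst p \<le> b \<and> fst p \<le> snd p \<and> snd p \<le> b then 1 else 0) *\<^sub>R prod (H' (snd p)) (g (fst p)))"
          by (auto simp: k_def fun_eq_iff indicator_def)
        also have "\<dots> \<in> borel_measurable (lborel \<Otimes>\<^sub>M lborel)" by measurable
        finally show ?thesis .
      qed
      show "AE p in lborel \<Otimes>\<^sub>M lborel. norm (case p of (s, r) \<Rightarrow> k s r) \<le> norm (norm (indicator {a..b} (fst p) *\<^sub>R g (fst p)) * (indicator {a..b} (snd p) * (M * K)))"
      proof (rule AE_I2)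
        fix p :: "real \<times> real"
        obtain s r where p: "p = (s, r)" by fastforce
        have "norm (k s r) \<le> indicat_real {a..b} s * norm (g s) * (indicat_real {a..b} r * (M * K))"
        proof (cases "a \<le> s \<and> s \<le> r \<and> r \<le> b")
          case True
          have "norm (prod (H' r) (g s)) \<le> norm (H' r) * norm (g s) * K" by (rule K)
          also have "\<dots> \<le> M * norm (g s) * K"
            using K(1) M[of r] True by (intro mult_right_mono) auto
          finally show ?thesis using True K(1) M0 by (simp add: k_def mult_ac)
        next
          case False
          then have "k s r = 0" by (auto simp: k_def indicator_def)
          then show ?thesis using K(1) M0 by simp
        qed
        then show "norm (case p of (s, r) \<Rightarrow> k s r) \<le> norm (norm (indicator {a..b} (fst p) *\<^sub>R g (fst p)) * (indicator {a..b} (snd p) * (M * K)))"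
          using K(1) M0 by (simp add: p abs_mult)
      qed
    qed
    \<comment> \<open>Integrating first in s yields H'(r) (F r - F a), first in r yields (H b - H s)
      g s. Equating the two integrals is integration by parts.\<close>
    then have fub: "(LINT r|lborel. LINT s|lborel. k s r) = (LINT s|lborel. LINT r|lborel. k s r)"
      by (rule lborel_pair.Fubini_integral)
    have i1: "(LINT s|lborel. k s r) = indicator {a..b} r *\<^sub>R prod (H' r) (F r - F a)" for r
    proof (cases "r \<in> {a..b}")
      case True
      have "(LINT s|lborel. k s r) = (LINT s|lborel. prod (H' r) (indicator {a..r} s *\<^sub>R g s))"
        using True by (simp add: k' scaleR_right)
      also have "\<dots> = prod (H' r) (LINT s:{a..r}|lborel. g s)"
        unfolding set_lebesgue_integral_def
        by (rule integral_bounded_linear[OF bounded_linear_right primitiveD(2)[OF F, unfolded set_integrable_def]])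
      finally show ?thesis using True primitiveD(3)[OF F, of a r] by simp
    qed (simp add: k')
    have i2: "(LINT r|lborel. k s r) = indicator {a..b} s *\<^sub>R prod (H b - H s) (g s)" for s
    proof (cases "s \<in> {a..b}")
      case True
      have "(LINT r|lborel. k s r) = (LINT r|lborel. prod (indicator {s..b} r *\<^sub>R H' r) (g s))"
        using True by (simp add: k_def scaleR_left)
      also have "\<dots> = prod (LINT r:{s..b}|lborel. H' r) (g s)"
        unfolding set_lebesgue_integral_def
        by (rule integral_bounded_linear[OF bounded_linear_left primitiveD(2)[OF PH, unfolded set_integrable_def]])
      finally show ?thesis using True primitiveD(3)[OF PH, of s b] by simp
    qed (simp add: k_def)
    have e1: "(LINT r:{a..b}|lborel. prod (H' r) (F r - F a)) =
        (LINT r:{a..b}|lborel. prod (H' r) (F r)) - prod (H b - H a) (F a)"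
    proof -
      have l: "set_integrable lborel {a..b} (\<lambda>r. prod (H' r) (F a))"
        "(LINT r:{a..b}|lborel. prod (H' r) (F a)) = prod (H b - H a) (F a)"
        using primitiveD(2,3)[OF primitive_bounded_linear[OF bounded_linear_left PH, of "F a"], of a b] ab
        by (auto simp: diff_left)
      show ?thesis unfolding diff_right by (subst set_integral_diff[OF int' l(1)]) (simp add: l(2))
    qed
    have e2: "(LINT s:{a..b}|lborel. prod (H b - H s) (g s)) =
        prod (H b) (F b - F a) - (LINT s:{a..b}|lborel. prod (H s) (g s))"
    proof -
      have l: "set_integrable lborel {a..b} (\<lambda>s. prod (H b) (g s))"
        "(LINT s:{a..b}|lborel. prod (H b) (g s)) = prod (H b) (F b - F a)"
        using primitiveD(2,3)[OF primitive_bounded_linear[OF bounded_linear_right F, of "H b"], of a b] ab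
        by (auto simp: diff_right)
      show ?thesis unfolding diff_left by (subst set_integral_diff[OF l(1) int]) (simp add: l(2))
    qed
    have "(LINT r:{a..b}|lborel. prod (H' r) (F r - F a)) = (LINT s:{a..b}|lborel. prod (H b - H s) (g s))"
      using fub unfolding i1 i2 set_lebesgue_integral_def .
    then show ?thesis
      unfolding e1 e2 by (subst set_integral_add[OF int' int]) (simp add: diff_left diff_right algebra_simps)
  qed
  moreover have "set_integrable lborel {a..b} (\<lambda>t. prod (H' t) (F t) + prod (H t) (g t))" for a b
    by (intro set_integral_add int int')
  moreover have "(\<lambda>t. prod (H' t) (F t) + prod (H t) (g t)) \<in> borel_measurable borel" by measurable
  ultimately show ?thesis by (auto simp: primitive_def)
qed

text \<open>Equal integrals over all intervals extend to all Borel sets by induction, and integrable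
  functions with the same integrals over all Borel sets agree almost everywhere. Truncation to
  [-n, n] supplies integrability.\<close>

lemma primitive_unique_derivative:
  fixes g h :: "real \<Rightarrow> 'b::euclidean_space"
  assumes g: "primitive F g" and h: "primitive F h"
  shows "AE t in lborel. g t = h t"
proof -
  have "AE t in lborel. indicator {- real n..real n} t *\<^sub>R g t = indicator {- real n..real n} t *\<^sub>R h t" for n
  proof (rule sigma_finite_measure.density_unique_banach[OF lborel.sigma_finite_measure_axioms])
    let ?I = "{- real n..real n}"
    show i: "integrable lborel (\<lambda>t. indicator ?I t *\<^sub>R g t)" "integrable lborel (\<lambda>t. indicator ?I t *\<^sub>R h t)"
      using primitiveD(2)[OF g] primitiveD(2)[OF h] by (simp_all add: set_integrable_def)
    fix A :: "real set" assume "A \<in> sets lborel"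
    then have "A \<in> sets borel" by simp
    then show "(LINT t:A|lborel. indicator ?I t *\<^sub>R g t) = (LINT t:A|lborel. indicator ?I t *\<^sub>R h t)"
    proof (induction A rule: borel_set_induct)
      case empty
      show ?case by (simp add: set_lebesgue_integral_def)
    next
      case (interval a b)
      have "(LINT t:{a..b}|lborel. indicator ?I t *\<^sub>R k t) = F (max (max a (- real n)) (min b (real n))) - F (max a (- real n))"
        if k: "primitive F k" for k
      proof -
        have "(LINT t:{a..b}|lborel. indicator ?I t *\<^sub>R k t) = (LINT t:{max a (- real n)..min b (real n)}|lborel. k t)"
          unfolding set_lebesgue_integral_def
          by (rule Bochner_Integration.integral_cong) (auto simp: indicator_def)
        then show ?thesis
          using primitiveD(3)[OF k, of "max a (- real n)" "min b (real n)"]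
          by (cases "max a (- real n) \<le> min b (real n)") (auto simp: max_absorb1 max_absorb2 set_lebesgue_integral_def[of _ "{}"])
      qed
      then show ?case using g h by simp
    next
      case (compl A)
      have *: "(LINT t:- A|lborel. f t) = (LINT t|lborel. f t) - (LINT t:A|lborel. f t)"
        if f: "integrable lborel f" for f :: "real \<Rightarrow> 'b"
      proof -
        have "(LINT t|lborel. f t) = (LINT t:A \<union> - A|lborel. f t)"
          by (simp add: set_lebesgue_integral_def)
        also have "\<dots> = (LINT t:A|lborel. f t) + (LINT t:- A|lborel. f t)"
          using compl.hyps f by (intro set_integral_Un) (auto simp: set_integrable_def intro!: integrable_mult_indicator)
        finally show ?thesis by simp
      qed
      have "(LINT t|lborel. indicator ?I t *\<^sub>R g t) = (LINT t|lborel. indicator ?I t *\<^sub>R h t)"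
        using primitiveD(3)[OF g, of "- real n" "real n"] primitiveD(3)[OF h, of "- real n" "real n"]
        by (simp add: set_lebesgue_integral_def)
      then show ?case using *[OF i(1)] *[OF i(2)] compl.IH by simp
    next
      case (union A)
      have "(LINT t:(\<Union>i. A i)|lborel. f t) = suminf (\<lambda>i. LINT t:A i|lborel. f t)"
        if f: "integrable lborel f" for f :: "real \<Rightarrow> 'b"
        using union.hyps f
        by (intro lebesgue_integral_countable_add)
          (auto simp: disjoint_family_on_def set_integrable_def intro!: integrable_mult_indicator)
      from this[OF i(1)] this[OF i(2)] show ?case using union.IH by simp
    qed
  qed
  then have "AE t in lborel. \<forall>n. indicator {- real n..real n} t *\<^sub>R g t = indicator {- real n..real n} t *\<^sub>R h t"
    by (subst AE_all_countable) blast
  then show ?thesis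
  proof eventually_elim
    case (elim t)
    obtain n where "\<bar>t\<bar> \<le> real n" using real_arch_simple by blast
    then show ?case using elim[rule_format, of n] by (simp add: indicator_def abs_le_iff split: if_splits)
  qed
qed

lemma exists_primitive:
  fixes g :: "real \<Rightarrow> 'b::euclidean_space"
  assumes "g \<in> borel_measurable borel" and g: "\<And>a b. set_integrable lborel {a..b} g"
  shows "\<exists>F. primitive F g"
proof -
  define F where "F t = (if 0 \<le> t then (LINT s:{0..t}|lborel. g s) else - (LINT s:{t..0}|lborel. g s))" for t
  have 0: "(LINT s:{t..t}|lborel. g s) = 0" for t
    using set_borel_integral_eq_integral(2)[OF g, of t t] by simp
  have "F b - F a = (LINT t:{a..b}|lborel. g t)" if "a \<le> b" for a b
  proof -
    consider "0 \<le> a" | "a < 0" "0 \<le> b" | "b < 0" by linarith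
    then show ?thesis
    proof cases
      case 1
      then show ?thesis using set_integral_combine[OF g, of 0 a b] that by (simp add: F_def)
    next
      case 2
      then show ?thesis using set_integral_combine[OF g, of a 0 b] by (simp add: F_def)
    next
      case 3
      then show ?thesis using set_integral_combine[OF g, of a b 0] that by (simp add: F_def)
    qed
  qed
  then show ?thesis using assms unfolding primitive_def by blast
qed

section \<open>Test functions and the lemma of du Bois-Reymond\<close>

lemma test_functionE:
  assumes "test_function \<phi>"
  obtains R where "R > 0" "\<And>t. R \<le> \<bar>t\<bar> \<Longrightarrow> \<phi> t = 0" "\<And>t. R \<le> \<bar>t\<bar> \<Longrightarrow> deriv \<phi> t = 0"
    "\<And>t. (\<phi> has_vector_derivative deriv \<phi> t) (at t)" "continuous_on UNIV (deriv \<phi>)"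
proof -
  obtain R where R: "\<And>t. R < \<bar>t\<bar> \<Longrightarrow> \<phi> t = 0" and
    diff: "\<And>t. \<phi> differentiable (at t)" and cont': "continuous_on UNIV (deriv \<phi>)"
    using assms by (auto simp: test_function_def)
  have d: "(\<phi> has_field_derivative deriv \<phi> t) (at t)" for t
    using diff[of t] by (simp add: DERIV_deriv_iff_real_differentiable)
  have 0: "deriv \<phi> t = 0" if t: "R < \<bar>t\<bar>" for t
  proof -
    have "open {s::real. R < \<bar>s\<bar>}"
      by (intro open_Collect_less continuous_intros)
    then have "(\<phi> has_field_derivative 0) (at t)"
      by (rule has_field_derivative_transform_within_open[where f="\<lambda>_. 0", rotated])
        (auto simp: R t)
    then show ?thesis by (rule DERIV_imp_deriv)
  qed
  \<comment> \<open>The radius |R| + 1 is positive, and \<open>\<phi>\<close> and its derivative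
    vanish already where |t| equals it.\<close>
  show ?thesis
    by (rule that[of "\<bar>R\<bar> + 1"]) (auto simp: R 0 cont' has_real_derivative_iff_has_vector_derivative[symmetric] d)
qed

lemma primitive_test_function:
  assumes F: "primitive F g" and \<phi>: "test_function \<phi>"
  shows "integrable lborel (\<lambda>t. deriv \<phi> t *\<^sub>R F t)" "integrable lborel (\<lambda>t. \<phi> t *\<^sub>R g t)"
    and "(LINT t|lborel. deriv \<phi> t *\<^sub>R F t) = - (LINT t|lborel. \<phi> t *\<^sub>R g t)"
proof -
  obtain R where R: "R > 0" "\<And>t. R \<le> \<bar>t\<bar> \<Longrightarrow> \<phi> t = 0" "\<And>t. R \<le> \<bar>t\<bar> \<Longrightarrow> deriv \<phi> t = 0"
    "\<And>t. (\<phi> has_vector_derivative deriv \<phi> t) (at t)" "continuous_on UNIV (deriv \<phi>)"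
    by (rule test_functionE[OF \<phi>]) blast
  note P = primitive_prod[OF bounded_bilinear_scaleR F R(4,5)]
  have i1: "set_integrable lborel {-R..R} (\<lambda>t. deriv \<phi> t *\<^sub>R F t)"
    by (intro borel_integrable_atLeastAtMost' continuous_intros continuous_on_subset[OF R(5)]
        continuous_on_subset[OF primitive_continuous[OF F]]) auto
  have i2: "set_integrable lborel {-R..R} (\<lambda>t. \<phi> t *\<^sub>R g t)"
    using set_integral_diff(1)[OF primitiveD(2)[OF P, of "-R" R] i1] by simp
  have e1: "indicator {-R..R} t *\<^sub>R deriv \<phi> t *\<^sub>R F t = deriv \<phi> t *\<^sub>R F t" for t
    using R(3)[of t] by (cases "t \<in> {-R..R}") auto
  have e2: "indicator {-R..R} t *\<^sub>R \<phi> t *\<^sub>R g t = \<phi> t *\<^sub>R g t" for t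
    using R(2)[of t] by (cases "t \<in> {-R..R}") auto
  show "integrable lborel (\<lambda>t. deriv \<phi> t *\<^sub>R F t)" "integrable lborel (\<lambda>t. \<phi> t *\<^sub>R g t)"
    using i1 i2 by (simp_all only: set_integrable_def e1 e2)
  have "0 = (LINT t:{-R..R}|lborel. deriv \<phi> t *\<^sub>R F t + \<phi> t *\<^sub>R g t)"
    using primitiveD(3)[OF P, of "-R" R] R(1) R(2)[of R] R(2)[of "-R"] by simp
  also have "\<dots> = (LINT t|lborel. deriv \<phi> t *\<^sub>R F t) + (LINT t|lborel. \<phi> t *\<^sub>R g t)"
    unfolding set_integral_add(2)[OF i1 i2] by (simp only: set_lebesgue_integral_def e1 e2)
  finally show "(LINT t|lborel. deriv \<phi> t *\<^sub>R F t) = - (LINT t|lborel. \<phi> t *\<^sub>R g t)"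
    by (simp add: eq_neg_iff_add_eq_0)
qed

text \<open>The primitive starting with 0 at -R returns to 0 at R because the total integral
  vanishes; only then is its support compact.\<close>

lemma test_function_antiderivative:
  fixes \<psi> :: "real \<Rightarrow> real"
  assumes \<psi>: "continuous_on UNIV \<psi>" and R: "R > 0" "\<And>t. R \<le> \<bar>t\<bar> \<Longrightarrow> \<psi> t = 0"
    and 0: "(LINT t|lborel. \<psi> t) = 0"
  obtains \<phi> where "test_function \<phi>" "deriv \<phi> = \<psi>"
proof -
  have i: "set_integrable lborel {a..b} \<psi>" for a b
    by (intro borel_integrable_atLeastAtMost' continuous_on_subset[OF \<psi>]) simp
  obtain F where F: "primitive F \<psi>"
    using exists_primitive[OF borel_measurable_continuous_onI[OF \<psi>] i] by blast
  define \<phi> where "\<phi> t = F t - F (- R)" for t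
  have d: "(\<phi> has_field_derivative \<psi> t) (at t)" for t
    unfolding \<phi>_def has_real_derivative_iff_has_vector_derivative
    by (rule has_vector_derivative_diff[OF primitive_has_vector_derivative[OF F \<psi>] has_vector_derivative_const, simplified])
  have z: "(LINT t:{a..b}|lborel. \<psi> t) = 0" if "\<And>t. t \<in> {a..b} \<Longrightarrow> \<psi> t = 0" for a b
    unfolding set_lebesgue_integral_def
    by (rule integral_eq_zero_AE, rule AE_I2) (use that in \<open>auto simp: indicator_def\<close>)
  have "\<phi> t = 0" if t: "R < \<bar>t\<bar>" for t
  proof (cases "t < 0")
    case True
    then have "F (- R) - F t = (LINT s:{t..- R}|lborel. \<psi> s)"
      using t by (intro primitiveD(3)[OF F]) auto
    also have "\<dots> = 0" by (rule z) (use R in auto)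
    finally show ?thesis by (simp add: \<phi>_def)
  next
    case False
    then have "\<phi> t = (LINT s:{- R..t}|lborel. \<psi> s)"
      unfolding \<phi>_def using t R(1) by (intro primitiveD(3)[OF F]) auto
    also have "\<dots> = (LINT s|lborel. \<psi> s)"
      unfolding set_lebesgue_integral_def
    proof (rule Bochner_Integration.integral_cong[OF refl])
      show "indicator {- R..t} s *\<^sub>R \<psi> s = \<psi> s" for s
        using R(2)[of s] t False by (cases "s \<in> {- R..t}") auto
    qed
    finally show ?thesis using 0 by simp
  qed
  moreover have D: "deriv \<phi> = \<psi>" using d by (auto intro: DERIV_imp_deriv)
  moreover have "\<phi> differentiable at t" for t using d real_differentiable_def by blast
  ultimately have "test_function \<phi>" using \<psi> unfolding test_function_def by blast
  then show ?thesis using D by (rule that)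
qed

text \<open>For a \<le> b a trapezoid: 1 on [a, b] and falling to 0 at distance 1/(n + 1). The
  supports stay in one bounded set and the functions tend pointwise to the indicator of
  [a, b].\<close>

definition tent :: "real \<Rightarrow> real \<Rightarrow> nat \<Rightarrow> real \<Rightarrow> real" where
  "tent a b n t = max 0 (1 - real (Suc n) * max 0 (max (a - t) (t - b)))"

lemma continuous_tent: "continuous_on S (tent a b n)"
  unfolding tent_def by (intro continuous_intros)

lemma tent_support: "\<bar>a\<bar> + \<bar>b\<bar> + 1 \<le> \<bar>t\<bar> \<Longrightarrow> tent a b n t = 0"
proof -
  assume "\<bar>a\<bar> + \<bar>b\<bar> + 1 \<le> \<bar>t\<bar>"
  then have "1 \<le> max 0 (max (a - t) (t - b))" by linarith
  then have "1 * 1 \<le> real (Suc n) * max 0 (max (a - t) (t - b))" by (intro mult_mono) auto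
  then show ?thesis by (simp add: tent_def)
qed

lemma tent_bounds: "0 \<le> tent a b n t" "tent a b n t \<le> 1"
proof -
  have "0 \<le> real (Suc n) * max 0 (max (a - t) (t - b))" by (intro mult_nonneg_nonneg) auto
  then show "tent a b n t \<le> 1" by (simp add: tent_def)
qed (simp add: tent_def)

lemma tent_eq_1: "t \<in> {a..b} \<Longrightarrow> tent a b n t = 1"
proof -
  assume "t \<in> {a..b}"
  then have "max 0 (max (a - t) (t - b)) = 0" by auto
  then show ?thesis by (simp add: tent_def)
qed

lemma tent_tendsto: "(\<lambda>n. tent a b n t) \<longlonglongrightarrow> indicator {a..b} t"
proof (cases "t \<in> {a..b}")
  case True
  then show ?thesis by (simp add: tent_eq_1)
next
  case False
  define d where "d = max 0 (max (a - t) (t - b))"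
  have d: "d > 0" using False by (auto simp: d_def)
  obtain N :: nat where N: "1 / d \<le> real N" using real_arch_simple by blast
  have "\<forall>\<^sub>F n in sequentially. tent a b n t = 0"
    using eventually_ge_at_top[of N]
  proof eventually_elim
    case (elim n)
    then have "1 / d \<le> real (Suc n)" using N by simp
    then show ?case using d by (simp add: tent_def d_def[symmetric] field_simps)
  qed
  then show ?thesis using False by (simp add: tendsto_eventually)
qed

text \<open>A tent minus a multiple of the fixed tent \<open>\<eta>\<close> has mean zero, hence is
  the derivative of a test function. So every tent is orthogonal to u - C, where C is the average of
  u with weight \<open>\<eta>\<close>. In the limit u - C has integral 0 over every interval, so the
  constant 0 is a primitive of it.\<close>

lemma du_Bois_Reymond:
  fixes u :: "real \<Rightarrow> 'b::euclidean_space"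
  assumes [measurable]: "u \<in> borel_measurable borel" and u: "\<And>a b. set_integrable lborel {a..b} u"
    and 0: "\<And>\<phi>. test_function \<phi> \<Longrightarrow> (LINT t|lborel. deriv \<phi> t *\<^sub>R u t) = 0"
  shows "\<exists>C. AE t in lborel. u t = C"
proof -
  have supp: "integrable lborel (\<lambda>t. \<theta> t *\<^sub>R v t)"
    if \<theta>: "continuous_on UNIV \<theta>" "\<And>t. R \<le> \<bar>t\<bar> \<Longrightarrow> \<theta> t = 0" "\<And>t. \<bar>\<theta> t\<bar> \<le> 1"
      and v: "set_integrable lborel {-R..R} v" "v \<in> borel_measurable borel"
    for \<theta> :: "real \<Rightarrow> real" and R and v :: "real \<Rightarrow> 'z::euclidean_space"
    using v(1) unfolding set_integrable_def
  proof (rule Bochner_Integration.integrable_bound)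
    have [measurable]: "\<theta> \<in> borel_measurable borel" "v \<in> borel_measurable borel"
      using \<theta>(1) v(2) by (auto intro: borel_measurable_continuous_onI)
    show "(\<lambda>t. \<theta> t *\<^sub>R v t) \<in> borel_measurable lborel" by measurable
    show "AE t in lborel. norm (\<theta> t *\<^sub>R v t) \<le> norm (indicator {-R..R} t *\<^sub>R v t)"
    proof (rule AE_I2)
      show "norm (\<theta> t *\<^sub>R v t) \<le> norm (indicator {-R..R} t *\<^sub>R v t)" for t
        using \<theta>(2)[of t] mult_right_mono[OF \<theta>(3)[of t] norm_ge_zero[of "v t"]]
        by (cases "t \<in> {-R..R}") auto
    qed
  qed
  define \<eta> where "\<eta> = tent 0 1 0"
  have tu: "integrable lborel (\<lambda>t. tent a b n t *\<^sub>R u t)" for a b n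
    by (rule supp[OF continuous_tent tent_support _ u]) (use tent_bounds[of a b n] in auto)
  have t1: "integrable lborel (tent a b n)" for a b n
    using supp[OF continuous_tent[of _ a b n] tent_support _ borel_integrable_atLeastAtMost'[of _ _ "\<lambda>_. 1::real"]]
      tent_bounds[of a b n] by (simp add: continuous_intros)
  have "1 \<le> (LINT t|lborel. \<eta> t)"
  proof -
    have "(LINT t|lborel. indicator {0..1::real} t) \<le> (LINT t|lborel. \<eta> t)"
    proof (rule Bochner_Integration.integral_mono)
      show "integrable lborel (indicat_real {0..1::real})"
        by (rule integrable_real_indicator) auto
      show "integrable lborel \<eta>" unfolding \<eta>_def by (rule t1)
      show "indicator {0..1} t \<le> \<eta> t" for t
        using tent_bounds[of 0 1 0 t] tent_eq_1[of t 0 1 0] by (cases "t \<in> {0..1}") (simp_all add: \<eta>_def)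
    qed
    then show ?thesis by simp
  qed
  then have \<eta>: "(LINT t|lborel. \<eta> t) > 0" by linarith
  define C where "C = (1 / (LINT t|lborel. \<eta> t)) *\<^sub>R (LINT t|lborel. \<eta> t *\<^sub>R u t)"
  have "(LINT t|lborel. tent a b n t *\<^sub>R u t) = (LINT t|lborel. tent a b n t) *\<^sub>R C" for a b n
  proof -
    define q where "q = (LINT t|lborel. tent a b n t) / (LINT t|lborel. \<eta> t)"
    define \<psi> where "\<psi> t = tent a b n t - q * \<eta> t" for t
    have i: "(LINT t|lborel. \<psi> t) = 0"
      using \<eta> t1[of a b n] t1[of 0 1 0] by (simp add: \<psi>_def q_def \<eta>_def)
    have c: "continuous_on UNIV \<psi>"
      unfolding \<psi>_def \<eta>_def by (intro continuous_intros continuous_tent)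
    have s: "\<psi> t = 0" if "\<bar>a\<bar> + \<bar>b\<bar> + 2 \<le> \<bar>t\<bar>" for t
      using that tent_support[of a b t n] tent_support[of 0 1 t 0] by (simp add: \<psi>_def \<eta>_def)
    have r: "0 < \<bar>a\<bar> + \<bar>b\<bar> + 2" by simp
    obtain \<phi> where \<phi>: "test_function \<phi>" "deriv \<phi> = \<psi>"
      by (rule test_function_antiderivative[OF c r s i])
    have "0 = (LINT t|lborel. tent a b n t *\<^sub>R u t - q *\<^sub>R (\<eta> t *\<^sub>R u t))"
      using 0[OF \<phi>(1)] by (simp add: \<phi>(2) \<psi>_def scaleR_diff_left)
    also have "\<dots> = (LINT t|lborel. tent a b n t *\<^sub>R u t) - q *\<^sub>R (LINT t|lborel. \<eta> t *\<^sub>R u t)"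
      using tu[of a b n] tu[of 0 1 0] by (simp add: \<eta>_def del: scaleR_scaleR)
    finally show ?thesis by (simp add: q_def C_def)
  qed
  then have z: "(LINT t|lborel. tent a b n t *\<^sub>R (u t - C)) = 0" for a b n
    using tu[of a b n] t1[of a b n] by (simp add: scaleR_diff_right)
  have v: "set_integrable lborel {a..b} (\<lambda>t. u t - C)" for a b
    by (intro set_integral_diff(1) u borel_integrable_atLeastAtMost' continuous_intros)
  have "primitive (\<lambda>_. 0) (\<lambda>t. u t - C)"
    unfolding primitive_def
  proof (intro conjI allI impI v)
    fix a b :: real
    define R where "R = \<bar>a\<bar> + \<bar>b\<bar> + 1"
    have "(\<lambda>n. LINT t|lborel. tent a b n t *\<^sub>R (u t - C)) \<longlonglongrightarrow> (LINT t|lborel. indicator {a..b} t *\<^sub>R (u t - C))"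
    proof (rule integral_dominated_convergence[where w = "\<lambda>t. norm (indicator {- R..R} t *\<^sub>R (u t - C))"])
      show "integrable lborel (\<lambda>t. norm (indicator {- R..R} t *\<^sub>R (u t - C)))"
        using v[of "- R" R] unfolding set_integrable_def by (rule integrable_norm)
      show "AE t in lborel. (\<lambda>n. tent a b n t *\<^sub>R (u t - C)) \<longlonglongrightarrow> indicator {a..b} t *\<^sub>R (u t - C)"
        by (intro AE_I2 tendsto_intros tent_tendsto)
      show "AE t in lborel. norm (tent a b n t *\<^sub>R (u t - C)) \<le> norm (indicator {- R..R} t *\<^sub>R (u t - C))" for n
      proof (rule AE_I2)
        show "norm (tent a b n t *\<^sub>R (u t - C)) \<le> norm (indicator {- R..R} t *\<^sub>R (u t - C))" for t
          using tent_support[of a b t n] tent_bounds[of a b n t]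
            mult_right_mono[of "tent a b n t" 1 "norm (u t - C)"]
          by (cases "t \<in> {- R..R}") (auto simp: R_def)
      qed
      have [measurable]: "tent a b n \<in> borel_measurable borel" for n
        by (rule borel_measurable_continuous_onI[OF continuous_tent])
      show "(\<lambda>t. indicator {a..b} t *\<^sub>R (u t - C)) \<in> borel_measurable lborel"
        "(\<lambda>t. tent a b n t *\<^sub>R (u t - C)) \<in> borel_measurable lborel" for n by measurable
    qed
    then have "(LINT t|lborel. indicator {a..b} t *\<^sub>R (u t - C)) = 0"
      unfolding z by (simp add: LIMSEQ_const_iff)
    then show "0 - 0 = (LINT t:{a..b}|lborel. u t - C)" by (simp add: set_lebesgue_integral_def)
  qed measurable
  moreover have "primitive (\<lambda>_. 0 :: 'b) (\<lambda>_. 0)"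
    by (rule primitiveI_continuous) auto
  ultimately have "AE t in lborel. u t - C = 0" by (rule primitive_unique_derivative)
  then show ?thesis by auto
qed

section \<open>Representatives of elements of \<open>L\<^sup>2\<close> and \<open>H\<^sup>1\<close>\<close>

lemma L2_rel_refl [simp]: "L2_rel f f \<longleftrightarrow> square_integrable f"
  by (auto simp: L2_rel_def)

lemma L2_obtain_rep:
  obtains f where "square_integrable f" "y = abs_L2 f"
proof (rule that)
  show "square_integrable (rep_L2 y)"
    using Quotient3_rep_reflp[OF Quotient3_L2, of y] by simp
  show "y = abs_L2 (rep_L2 y)"
    using Quotient3_abs_rep[OF Quotient3_L2, of y] by simp
qed

lemma abs_L2_eq_iff:
  "square_integrable f \<Longrightarrow> square_integrable g \<Longrightarrow> abs_L2 f = abs_L2 g \<longleftrightarrow> (AE t in lborel. f t = g t)"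
  using Quotient3_rel[OF Quotient3_L2, of f g] by (auto simp: L2_rel_def)

lemma abs_L2_add:
  "square_integrable f \<Longrightarrow> square_integrable g \<Longrightarrow> abs_L2 f + abs_L2 g = abs_L2 (\<lambda>t. f t + g t)"
  by (simp add: plus_L2.abs_eq)

lemma abs_L2_diff:
  "square_integrable f \<Longrightarrow> square_integrable g \<Longrightarrow> abs_L2 f - abs_L2 g = abs_L2 (\<lambda>t. f t - g t)"
  by (simp add: minus_L2.abs_eq)

lemma abs_L2_scaleR:
  "square_integrable f \<Longrightarrow> c *\<^sub>R abs_L2 f = abs_L2 (\<lambda>t. c *\<^sub>R f t)"
  by (simp add: scaleR_L2.abs_eq)

lemma L2_mult_abs:
  assumes "bounded (range A)" "A \<in> borel_measurable borel" "square_integrable f"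
  shows "L2_mult A (abs_L2 f) = abs_L2 (\<lambda>t. A t *v f t)" and "square_integrable (\<lambda>t. A t *v f t)"
  using assms L2_rel_matrix_mult_fun[of f f A] by (simp_all add: L2_mult.abs_eq matrix_mult_fun_def)

lemma norm_abs_L2:
  "square_integrable f \<Longrightarrow> (norm (abs_L2 f))\<^sup>2 = (LINT t|lborel. (norm (f t))\<^sup>2)"
  by (simp add: power2_norm_eq_inner inner_L2.abs_eq)

lemma square_integrable_iff_nn_integral:
  "square_integrable f \<longleftrightarrow> f \<in> borel_measurable borel \<and> (\<integral>\<^sup>+ t. ennreal ((norm (f t))\<^sup>2) \<partial>lborel) < \<infinity>"
  unfolding square_integrable_def by (auto simp: integrable_iff_bounded)

lemma nn_integral_abs_L2:
  "square_integrable f \<Longrightarrow> (\<integral>\<^sup>+ t. ennreal ((norm (f t))\<^sup>2) \<partial>lborel) = ennreal ((norm (abs_L2 f))\<^sup>2)"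
  unfolding norm_abs_L2 by (intro nn_integral_eq_integral) (auto simp: square_integrable_def)

lemma norm_abs_L2_le:
  assumes "f \<in> borel_measurable borel" "C \<ge> 0"
    and "(\<integral>\<^sup>+ t. ennreal ((norm (f t))\<^sup>2) \<partial>lborel) \<le> ennreal (C\<^sup>2)"
  shows "square_integrable f" "norm (abs_L2 f) \<le> C"
proof -
  show f: "square_integrable f"
    unfolding square_integrable_iff_nn_integral using assms by (auto intro: le_less_trans)
  have "(norm (abs_L2 f))\<^sup>2 \<le> C\<^sup>2"
    using assms(3) unfolding nn_integral_abs_L2[OF f] by (subst (asm) ennreal_le_iff) auto
  then show "norm (abs_L2 f) \<le> C" using assms(2) by (rule power2_le_imp_le)
qed

lemma norm_abs_L2_mono:
  assumes f: "f \<in> borel_measurable borel" and g: "square_integrable g"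
    and le: "\<And>t. norm (f t) \<le> norm (g t)"
  shows "square_integrable f" "norm (abs_L2 f) \<le> norm (abs_L2 g)"
proof -
  have "(\<integral>\<^sup>+ t. ennreal ((norm (f t))\<^sup>2) \<partial>lborel) \<le> (\<integral>\<^sup>+ t. ennreal ((norm (g t))\<^sup>2) \<partial>lborel)"
    using le by (intro nn_integral_mono ennreal_leI power_mono) auto
  then have "(\<integral>\<^sup>+ t. ennreal ((norm (f t))\<^sup>2) \<partial>lborel) \<le> ennreal ((norm (abs_L2 g))\<^sup>2)"
    by (simp add: nn_integral_abs_L2[OF g])
  from norm_abs_L2_le[OF f norm_ge_zero this]
  show "square_integrable f" "norm (abs_L2 f) \<le> norm (abs_L2 g)" by auto
qed

lemma square_integrable_AE_cong:
  assumes "square_integrable f" "g \<in> borel_measurable borel" "AE t in lborel. f t = g t"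
  shows "square_integrable g"
proof -
  have "integrable lborel (\<lambda>t. (norm (g t))\<^sup>2)"
    by (rule integrable_cong_AE_imp[of _ "\<lambda>t. (norm (f t))\<^sup>2"])
      (use assms in \<open>auto simp: square_integrable_def\<close>)
  then show ?thesis using assms by (simp add: square_integrable_def)
qed

lemma square_integrable_indicator: "square_integrable (indicat_real {a..b})"
proof -
  have "(\<lambda>t. (norm (indicat_real {a..b} t))\<^sup>2) = indicat_real {a..b}"
    by (auto simp: fun_eq_iff indicator_def)
  then show ?thesis
    unfolding square_integrable_def by (auto intro!: integrable_real_indicator simp: emeasure_lborel_Icc_eq)
qed

lemma square_integrable_set_integrable:
  fixes f :: "real \<Rightarrow> 'b::euclidean_space"
  shows "square_integrable f \<Longrightarrow> set_integrable lborel {a..b} f"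
  unfolding set_integrable_def by (rule square_integrable_scaleR_fun[OF square_integrable_indicator])

text \<open>\<open>\<rho>\<close> is scalar and \<open>f\<close> is vector valued, so Cauchy-Schwarz
  is applied to their pointwise norms in the scalar L^2 space.\<close>

lemma norm_integral_scaleR_le:
  fixes f :: "real \<Rightarrow> 'b::euclidean_space"
  assumes \<rho>: "square_integrable \<rho>" and f: "square_integrable f"
  shows "norm (LINT t|lborel. \<rho> t *\<^sub>R f t) \<le> norm (abs_L2 \<rho>) * norm (abs_L2 f)"
proof -
  define a where "a t = \<bar>\<rho> t\<bar>" for t
  define b where "b t = norm (f t)" for t
  have [measurable]: "\<rho> \<in> borel_measurable borel" "f \<in> borel_measurable borel"
    using \<rho> f by (simp_all add: square_integrable_def)
  have m: "a \<in> borel_measurable borel" "b \<in> borel_measurable borel"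
    unfolding a_def[abs_def] b_def[abs_def] by measurable
  have ab: "square_integrable a" "square_integrable b"
    "norm (abs_L2 a) \<le> norm (abs_L2 \<rho>)" "norm (abs_L2 b) \<le> norm (abs_L2 f)"
    using norm_abs_L2_mono[OF m(1) \<rho>] norm_abs_L2_mono[OF m(2) f] by (simp_all add: a_def b_def)
  have "norm (LINT t|lborel. \<rho> t *\<^sub>R f t) \<le> (LINT t|lborel. norm (\<rho> t *\<^sub>R f t))"
    by (rule integral_norm_bound)
  also have "\<dots> = abs_L2 a \<bullet> abs_L2 b"
    using ab by (simp add: inner_L2.abs_eq a_def b_def)
  also have "\<dots> \<le> norm (abs_L2 a) * norm (abs_L2 b)" by (rule norm_cauchy_schwarz)
  also have "\<dots> \<le> norm (abs_L2 \<rho>) * norm (abs_L2 f)" by (intro mult_mono ab) auto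
  finally show ?thesis .
qed

lemma weak_derivative_abs:
  assumes "square_integrable f" "square_integrable g"
  shows "weak_derivative (abs_L2 f) (abs_L2 g) \<longleftrightarrow>
    (\<forall>\<phi>. test_function \<phi> \<longrightarrow> (LINT t|lborel. deriv \<phi> t *\<^sub>R f t) = - (LINT t|lborel. \<phi> t *\<^sub>R g t))"
  using assms by (simp add: weak_derivative.abs_eq)

text \<open>For any primitive U of g the difference f - U has weak derivative 0, hence is constant
  almost everywhere.\<close>

lemma weak_derivative_imp_primitive:
  assumes f: "square_integrable f" and g: "square_integrable g"
    and w: "weak_derivative (abs_L2 f) (abs_L2 g)"
  obtains F where "primitive F g" "AE t in lborel. f t = F t"
proof -
  have [measurable]: "f \<in> borel_measurable borel" "g \<in> borel_measurable borel"
    using f g by (simp_all add: square_integrable_def)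
  obtain U where U: "primitive U g"
    using exists_primitive[OF _ square_integrable_set_integrable[OF g]] by auto
  have [measurable]: "U \<in> borel_measurable borel"
    by (rule borel_measurable_continuous_onI[OF primitive_continuous[OF U]])
  have "\<exists>C. AE t in lborel. f t - U t = C"
  proof (rule du_Bois_Reymond)
    show "set_integrable lborel {a..b} (\<lambda>t. f t - U t)" for a b
      by (intro set_integral_diff(1) square_integrable_set_integrable[OF f] borel_integrable_atLeastAtMost'
          continuous_on_subset[OF primitive_continuous[OF U]]) simp
    fix \<phi> assume \<phi>: "test_function \<phi>"
    have "(LINT t|lborel. deriv \<phi> t *\<^sub>R f t) = (LINT t|lborel. deriv \<phi> t *\<^sub>R U t)"
      using w \<phi> primitive_test_function(3)[OF U \<phi>] by (simp add: weak_derivative_abs[OF f g])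
    then show "(LINT t|lborel. deriv \<phi> t *\<^sub>R (f t - U t)) = 0"
      using primitive_test_function(1)[OF U \<phi>]
        square_integrable_scaleR_fun[OF test_function_square_integrable(2)[OF \<phi>] f]
      by (simp add: scaleR_diff_right)
  qed measurable
  then obtain C where C: "AE t in lborel. f t - U t = C" by blast
  have "primitive (\<lambda>t. U t + C) (\<lambda>t. g t + 0)"
    by (intro primitive_add U primitiveI_continuous) auto
  moreover have "AE t in lborel. f t = U t + C" using C by eventually_elim auto
  ultimately show ?thesis by (intro that[of "\<lambda>t. U t + C"]) auto
qed

lemma primitive_imp_weak_derivative:
  "primitive F g \<Longrightarrow> square_integrable F \<Longrightarrow> square_integrable g \<Longrightarrow> weak_derivative (abs_L2 F) (abs_L2 g)"
  by (simp add: weak_derivative_abs primitive_test_function(3))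

text \<open>Ties an element of \<open>H1\<close> to its absolutely continuous representative F and
  to a representative g of its derivative. Pointwise values, which a class in \<open>L2\<close> does
  not have, are taken from F.\<close>

definition represents :: "'b::euclidean_space H1 \<Rightarrow> (real \<Rightarrow> 'b) \<Rightarrow> (real \<Rightarrow> 'b) \<Rightarrow> bool" where
  "represents x F g \<longleftrightarrow> square_integrable F \<and> square_integrable g \<and> primitive F g \<and>
     H1_fun x = abs_L2 F \<and> H1_deriv x = abs_L2 g"

lemma H1_obtain_rep:
  obtains F g where "represents x F g"
proof -
  have w: "weak_derivative (H1_fun x) (H1_deriv x)"
    using Rep_H1[of x] by (simp add: H1_fun.rep_eq H1_deriv.rep_eq case_prod_unfold)
  obtain f where f: "square_integrable f" "H1_fun x = abs_L2 f" by (rule L2_obtain_rep)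
  obtain g where g: "square_integrable g" "H1_deriv x = abs_L2 g" by (rule L2_obtain_rep)
  obtain F where F: "primitive F g" "AE t in lborel. f t = F t"
    using weak_derivative_imp_primitive[OF f(1) g(1)] w f(2) g(2) by auto
  have sF: "square_integrable F"
    by (rule square_integrable_AE_cong[OF f(1) borel_measurable_continuous_onI[OF primitive_continuous[OF F(1)]] F(2)])
  then show ?thesis
    using F f g abs_L2_eq_iff[OF f(1) sF] by (intro that[of F g]) (simp add: represents_def)
qed

lemma H1_from_primitive:
  assumes "primitive F g" "square_integrable F" "square_integrable g"
  obtains x where "represents x F g"
proof
  have "(abs_L2 F, abs_L2 g) \<in> {(x, y). weak_derivative x y}"
    using primitive_imp_weak_derivative[OF assms] by simp
  then show "represents (Abs_H1 (abs_L2 F, abs_L2 g)) F g"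
    using assms by (simp add: represents_def H1_fun.rep_eq H1_deriv.rep_eq Abs_H1_inverse)
qed

lemma H1_eqI: "H1_fun x = H1_fun y \<Longrightarrow> H1_deriv x = H1_deriv y \<Longrightarrow> x = y"
  by (simp add: H1_fun.rep_eq H1_deriv.rep_eq Rep_H1_inject[symmetric] prod_eq_iff)

lemma represents_norm_le: "represents x F g \<Longrightarrow> norm x \<le> norm (abs_L2 F) + norm (abs_L2 g)"
  unfolding represents_def norm_H1_eq using norm_Pair_le by metis

lemma represents_add: "represents x F g \<Longrightarrow> represents y G h \<Longrightarrow> represents (x + y) (\<lambda>t. F t + G t) (\<lambda>t. g t + h t)"
  by (simp add: represents_def square_integrable_add primitive_add abs_L2_add[symmetric]
      linear_add[OF bounded_linear.linear[OF bounded_linear_H1_fun]]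
      linear_add[OF bounded_linear.linear[OF bounded_linear_H1_deriv]])

lemma represents_scaleR: "represents x F g \<Longrightarrow> represents (c *\<^sub>R x) (\<lambda>t. c *\<^sub>R F t) (\<lambda>t. c *\<^sub>R g t)"
  by (simp add: represents_def square_integrable_scaleR abs_L2_scaleR[symmetric]
      primitive_bounded_linear[OF bounded_linear_scaleR_right]
      linear_scale[OF bounded_linear.linear[OF bounded_linear_H1_fun]]
      linear_scale[OF bounded_linear.linear[OF bounded_linear_H1_deriv]])

text \<open>
  Integrating \<open>((t - 1) F(t))'\<close> over \<open>[0, 1]\<close> shows that the value at 0 depends only on the classes of
  \<open>F\<close> and \<open>F'\<close>, and that it is bounded by their norms.
\<close>

lemma primitive_at_0:
  assumes F: "primitive F g"
  shows "F 0 = (LINT t:{0..1}|lborel. F t) + (LINT t:{0..1}|lborel. (t - 1) *\<^sub>R g t)"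
    and "set_integrable lborel {0..1} (\<lambda>t. (t - 1) *\<^sub>R g t)"
proof -
  have P: "primitive (\<lambda>t. (t - 1) *\<^sub>R F t) (\<lambda>t. 1 *\<^sub>R F t + (t - 1) *\<^sub>R g t)"
    by (rule primitive_prod[OF bounded_bilinear_scaleR F])
      (auto intro!: derivative_eq_intros simp: has_real_derivative_iff_has_vector_derivative[symmetric])
  have i1: "set_integrable lborel {0..1} F"
    by (intro borel_integrable_atLeastAtMost' continuous_on_subset[OF primitive_continuous[OF F]]) simp
  show i2: "set_integrable lborel {0..1} (\<lambda>t. (t - 1) *\<^sub>R g t)"
    using set_integral_diff(1)[OF primitiveD(2)[OF P, of 0 1] i1] by simp
  have "F 0 = (LINT t:{0..1}|lborel. F t + (t - 1) *\<^sub>R g t)"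
    using primitiveD(3)[OF P, of 0 1] by simp
  then show "F 0 = (LINT t:{0..1}|lborel. F t) + (LINT t:{0..1}|lborel. (t - 1) *\<^sub>R g t)"
    by (simp add: set_integral_add(2)[OF i1 i2])
qed

text \<open>Any representation may be taken: the value of F at 0 is given by integrals of F and g
  over [0, 1], hence depends only on their classes.\<close>

definition H1_ev0 :: "'b::euclidean_space H1 \<Rightarrow> 'b" where
  "H1_ev0 x = (SOME v. \<exists>F g. represents x F g \<and> v = F 0)"

lemma primitive_value_unique:
  assumes F: "primitive F g" and G: "primitive G h"
    and "AE t in lborel. F t = G t" "AE t in lborel. g t = h t"
  shows "F 0 = G 0"
proof -
  have [measurable]: "g \<in> borel_measurable borel" "h \<in> borel_measurable borel"
    "F \<in> borel_measurable borel" "G \<in> borel_measurable borel"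
    using F G primitive_continuous[OF F] primitive_continuous[OF G]
    by (auto simp: primitive_def intro: borel_measurable_continuous_onI)
  have "(LINT t:{0..1}|lborel. F t) = (LINT t:{0..1}|lborel. G t)"
    "(LINT t:{0..1}|lborel. (t - 1) *\<^sub>R g t) = (LINT t:{0..1}|lborel. (t - 1) *\<^sub>R h t)"
    unfolding set_lebesgue_integral_def using assms(3,4) by (intro integral_cong_AE; auto)+
  then show ?thesis using primitive_at_0[OF F] primitive_at_0[OF G] by simp
qed

lemma H1_ev0_eq:
  assumes "represents x F g"
  shows "H1_ev0 x = F 0"
proof -
  have "\<exists>v G h. represents x G h \<and> v = G 0" using assms by blast
  then have "\<exists>G h. represents x G h \<and> H1_ev0 x = G 0" unfolding H1_ev0_def by (rule someI_ex)
  then obtain G h where G: "represents x G h" "H1_ev0 x = G 0" by blast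
  then have "F 0 = G 0"
    using assms abs_L2_eq_iff[of F G] abs_L2_eq_iff[of g h]
    by (intro primitive_value_unique[of F g G h]) (auto simp: represents_def)
  then show ?thesis using G by simp
qed

lemma bounded_linear_H1_ev0: "bounded_linear (H1_ev0 :: 'b::euclidean_space H1 \<Rightarrow> 'b)"
proof -
  let ?\<rho> = "indicat_real {0..1}"
  \<comment> \<open>The indicator of [0, 1] and \<open>\<sigma>\<close> are the weights of F and g
    in the integral formula for the value at 0; their L^2 norms bound the evaluation.\<close>
  define \<sigma> where "\<sigma> t = indicat_real {0..1} t * (t - 1)" for t
  have m: "\<sigma> \<in> borel_measurable lborel"
    unfolding \<sigma>_def[abs_def] by measurable
  have \<sigma>: "square_integrable \<sigma>"
    by (rule square_integrable_dominated[OF m square_integrable_indicator[of 0 1], of 1])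
      (auto simp: \<sigma>_def indicator_def)
  show ?thesis
  proof (rule bounded_linear_intro[where K="norm (abs_L2 ?\<rho>) + norm (abs_L2 \<sigma>)"])
    fix x y :: "'b H1" and c :: real
    obtain F g where x: "represents x F g" by (rule H1_obtain_rep)
    obtain G h where y: "represents y G h" by (rule H1_obtain_rep)
    show "H1_ev0 (x + y) = H1_ev0 x + H1_ev0 y"
      by (simp add: H1_ev0_eq[OF represents_add[OF x y]] H1_ev0_eq[OF x] H1_ev0_eq[OF y])
    show "H1_ev0 (c *\<^sub>R x) = c *\<^sub>R H1_ev0 x"
      by (simp add: H1_ev0_eq[OF represents_scaleR[OF x]] H1_ev0_eq[OF x])
    have F: "square_integrable F" "square_integrable g" "primitive F g" using x by (simp_all add: represents_def)
    have "norm (H1_ev0 x) \<le> norm (LINT t|lborel. ?\<rho> t *\<^sub>R F t) + norm (LINT t|lborel. \<sigma> t *\<^sub>R g t)"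
      unfolding H1_ev0_eq[OF x] primitive_at_0(1)[OF F(3)] set_lebesgue_integral_def
      using norm_triangle_ineq by (auto simp: \<sigma>_def)
    also have "\<dots> \<le> norm (abs_L2 ?\<rho>) * norm (abs_L2 F) + norm (abs_L2 \<sigma>) * norm (abs_L2 g)"
      by (intro add_mono norm_integral_scaleR_le square_integrable_indicator \<sigma> F)
    also have "\<dots> \<le> norm (abs_L2 ?\<rho>) * norm x + norm (abs_L2 \<sigma>) * norm x"
      using x norm_fst_le[of "H1_fun x" "H1_deriv x"] norm_snd_le[of "H1_deriv x" "H1_fun x"]
      by (intro add_mono mult_left_mono) (auto simp: represents_def norm_H1_eq)
    finally show "norm (H1_ev0 x) \<le> norm x * (norm (abs_L2 ?\<rho>) + norm (abs_L2 \<sigma>))"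
      by (simp add: algebra_simps)
  qed
qed

section \<open>Linear differential equations\<close>

lemma norm_matrix_vector_le:
  fixes M :: "real^'n^'m"
  shows "norm (M *v x) \<le> norm M * norm x * (real CARD('m) * real CARD('n))"
proof -
  have "\<bar>M $ i $ j\<bar> \<le> norm M" for i j
    using component_le_norm_cart[of "M $ i" j] Finite_Cartesian_Product.norm_nth_le[of M i] by linarith
  then have "onorm ((*v) M) \<le> real CARD('m) * real CARD('n) * norm M"
    by (rule onorm_le_matrix_component)
  then have "onorm ((*v) M) * norm x \<le> real CARD('m) * real CARD('n) * norm M * norm x"
    by (intro mult_right_mono) auto
  moreover have "norm (M *v x) \<le> onorm ((*v) M) * norm x"
    by (rule onorm) (rule matrix_vector_mul_bounded_linear)
  ultimately show ?thesis by (simp add: mult_ac)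
qed

lemma bounded_bilinear_matrix_vector:
  "bounded_bilinear ((*v) :: real^'n^'m \<Rightarrow> real^'n \<Rightarrow> real^'m)"
proof
  show "\<exists>K. \<forall>(M :: real^'n^'m) x. norm (M *v x) \<le> norm M * norm x * K"
    using norm_matrix_vector_le by blast
qed (auto simp: matrix_vector_mult_add_rdistrib matrix_vector_right_distrib scaleR_matrix_vector_assoc[symmetric]
    matrix_vector_mult_scaleR)

lemmas bounded_linear_matrix_vector_left = bounded_bilinear.bounded_linear_left[OF bounded_bilinear_matrix_vector]

lemma continuous_on_det:
  fixes M :: "'a::topological_space \<Rightarrow> real^'n^'n"
  assumes "\<And>i j. continuous_on S (\<lambda>t. M t $ i $ j)"
  shows "continuous_on S (\<lambda>t. det (M t))"
  unfolding det_def by (intro continuous_intros assms)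

text \<open>Cramer's rule: the components of the solution y of M y = b are quotients of
  determinants, which are polynomials in the entries of M and b.\<close>

lemma continuous_on_inverse_matrix_vector:
  fixes M N :: "'a::topological_space \<Rightarrow> real^'n^'n"
  assumes M: "continuous_on S M" and inv: "\<And>t. N t ** M t = mat 1" "\<And>t. M t ** N t = mat 1"
  shows "continuous_on S (\<lambda>t. N t *v b)"
proof -
  have c: "continuous_on S (\<lambda>t. M t $ i $ j)" for i j
    by (intro continuous_intros M)
  have d: "det (M t) \<noteq> 0" for t
    using inv invertible_det_nz[of "M t"] unfolding invertible_def by blast
  have "M t *v (N t *v b) = b" for t
    by (simp add: matrix_vector_mul_assoc inv)
  then have e: "N t *v b = (\<chi> k. det (\<chi> i j. if j = k then b $ i else M t $ i $ j) / det (M t))" for t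
    using cramer[OF d[of t], of "N t *v b" b] by simp
  have dd: "continuous_on S (\<lambda>t. det (\<chi> i j. if j = k then b $ i else M t $ i $ j))" for k
  proof (rule continuous_on_det)
    show "continuous_on S (\<lambda>t. (\<chi> i j. if j = k then b $ i else M t $ i $ j) $ i $ j)" for i j
      by (cases "j = k") (auto simp: c intro: continuous_intros)
  qed
  show ?thesis
    unfolding e
    by (rule continuous_on_vec_lambda, rule continuous_on_divide, rule dd, rule continuous_on_det, rule c, simp add: d)
qed

lemma continuous_on_matrix_vectorI:
  fixes N :: "'a::topological_space \<Rightarrow> real^'n^'m"
  assumes "\<And>b. continuous_on S (\<lambda>t. N t *v b)"
  shows "continuous_on S N"
proof -
  have e: "N = (\<lambda>t. \<chi> i j. (N t *v axis j 1) $ i)"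
    by (simp add: fun_eq_iff vec_eq_iff matrix_vector_mult_basis column_def)
  show ?thesis
    by (subst e) (intro continuous_on_vec_lambda continuous_intros assms)
qed

section \<open>Transition matrices, uniqueness and variation of constants\<close>

locale linear_system =
  fixes A :: "real \<Rightarrow> real^'n^'n" and \<Phi> :: "real \<Rightarrow> real \<Rightarrow> real^'n^'n"
  assumes continuous_A: "continuous_on UNIV A" and bounded_A: "bounded (range A)"
    and transition: "transition_matrix A \<Phi>"
begin

lemma Phi_same [simp]: "\<Phi> s s = mat 1"
  using transition by (simp add: transition_matrix_def)

lemma Phi_matrix_derivative: "((\<lambda>r. \<Phi> r s) has_vector_derivative A t ** \<Phi> t s) (at t)"
  using transition by (simp add: transition_matrix_def)

lemma Phi_derivative: "((\<lambda>r. \<Phi> r s *v x) has_vector_derivative A t *v (\<Phi> t s *v x)) (at t)"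
  using bounded_linear.has_vector_derivative[OF bounded_linear_matrix_vector_left Phi_matrix_derivative]
  by (simp add: matrix_vector_mul_assoc)

text \<open>With C a bound for A, the product of y . y and exp(-2Ct) is nonincreasing and that with
  exp(2Ct) is nondecreasing. The first settles the times after s, the second those before.\<close>

lemma Gronwall_zero:
  assumes y: "\<And>t. (y has_vector_derivative A t *v y t) (at t)" and "y s = 0"
  shows "y t = 0"
proof -
  obtain C where C: "C \<ge> 0" "\<And>t x. norm (A t *v x) \<le> C * norm x"
    by (rule bounded_range_matrix_vector[OF bounded_A]) blast
  have in1: "\<bar>y t \<bullet> (A t *v y t)\<bar> \<le> C * (y t \<bullet> y t)" for t
  proof -
    have "\<bar>y t \<bullet> (A t *v y t)\<bar> \<le> norm (y t) * norm (A t *v y t)" by (rule Cauchy_Schwarz_ineq2)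
    also have "\<dots> \<le> norm (y t) * (C * norm (y t))" by (intro mult_left_mono C) auto
    finally show ?thesis by (simp add: dot_square_norm power2_eq_square mult_ac)
  qed
  have d: "((\<lambda>t. y t \<bullet> y t) has_field_derivative 2 * (y t \<bullet> (A t *v y t))) (at t)" for t
    using bounded_bilinear.has_vector_derivative[OF bounded_bilinear_inner y y, of t]
    by (simp add: has_real_derivative_iff_has_vector_derivative inner_commute)
  have e: "((\<lambda>t. (y t \<bullet> y t) * exp (c * t)) has_field_derivative
      (2 * (y t \<bullet> (A t *v y t)) + c * (y t \<bullet> y t)) * exp (c * t)) (at t)" for t c
    by (rule derivative_eq_intros d refl | simp add: algebra_simps)+
  show ?thesis
  proof (cases "s \<le> t")
    case True
    have "(y t \<bullet> y t) * exp ((- 2 * C) * t) \<le> (y s \<bullet> y s) * exp ((- 2 * C) * s)"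
    proof (rule DERIV_nonpos_imp_nonincreasing[OF True, of "\<lambda>t. (y t \<bullet> y t) * exp ((- 2 * C) * t)"])
      fix r
      have "2 * (y r \<bullet> (A r *v y r)) + (- 2 * C) * (y r \<bullet> y r) \<le> 0" using in1[of r] by linarith
      then show "\<exists>z. ((\<lambda>t. (y t \<bullet> y t) * exp ((- 2 * C) * t)) has_real_derivative z) (at r) \<and> z \<le> 0"
        using e[of "- 2 * C" r] by (intro exI conjI) (assumption, simp add: mult_nonpos_nonneg)
    qed
    then have "(y t \<bullet> y t) * exp ((- 2 * C) * t) \<le> 0" using assms(2) by simp
    then have "y t \<bullet> y t \<le> 0" by (simp add: mult_le_0_iff not_le[symmetric])
    then show ?thesis using inner_ge_zero[of "y t"] by (metis antisym inner_eq_zero_iff)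
  next
    case False
    have "(y t \<bullet> y t) * exp ((2 * C) * t) \<le> (y s \<bullet> y s) * exp ((2 * C) * s)"
    proof (rule DERIV_nonneg_imp_nondecreasing[of t s "\<lambda>t. (y t \<bullet> y t) * exp ((2 * C) * t)"])
      show "t \<le> s" using False by simp
      fix r
      have "0 \<le> 2 * (y r \<bullet> (A r *v y r)) + (2 * C) * (y r \<bullet> y r)" using in1[of r] by linarith
      then show "\<exists>z. ((\<lambda>t. (y t \<bullet> y t) * exp ((2 * C) * t)) has_real_derivative z) (at r) \<and> 0 \<le> z"
        using e[of "2 * C" r] by (intro exI conjI) (assumption, simp)
    qed
    then have "(y t \<bullet> y t) * exp ((2 * C) * t) \<le> 0" using assms(2) by simp
    then have "y t \<bullet> y t \<le> 0" by (simp add: mult_le_0_iff not_le[symmetric])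
    then show ?thesis using inner_ge_zero[of "y t"] by (metis antisym inner_eq_zero_iff)
  qed
qed

lemma solution_eq:
  assumes y: "\<And>t. (y has_vector_derivative A t *v y t) (at t)"
  shows "y t = \<Phi> t s *v y s"
proof -
  have "((\<lambda>t. y t - \<Phi> t s *v y s) has_vector_derivative A t *v (y t - \<Phi> t s *v y s)) (at t)" for t
    using has_vector_derivative_diff[OF y Phi_derivative[of s "y s" t]]
    by (simp add: matrix_vector_mult_diff_distrib)
  from Gronwall_zero[OF this, of s t] show ?thesis by simp
qed

lemma Phi_cocycle: "\<Phi> t s *v (\<Phi> s r *v x) = \<Phi> t r *v x"
  using solution_eq[OF Phi_derivative, of t r x s] by simp

lemma Phi_cocycle_matrix: "\<Phi> t s ** \<Phi> s r = \<Phi> t r"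
  by (simp add: matrix_eq matrix_vector_mul_assoc[symmetric] Phi_cocycle)

lemma continuous_Phi: "continuous_on UNIV (\<lambda>t. \<Phi> t s)"
  by (intro continuous_at_imp_continuous_on ballI has_vector_derivative_continuous[OF Phi_matrix_derivative])

text \<open>\<open>transition_matrix\<close> asserts regularity in the first argument only. In the
  second one \<Phi>(t, s) is the inverse of \<Phi>(s, t), and inversion is continuous.\<close>

lemma continuous_Phi_inverse: "continuous_on UNIV (\<lambda>s. \<Phi> t s)"
  by (rule continuous_on_matrix_vectorI, rule continuous_on_inverse_matrix_vector[OF continuous_Phi[of t]])
    (simp_all add: Phi_cocycle_matrix)

lemma continuous_A_Phi: "continuous_on UNIV (\<lambda>t. A t ** \<Phi> t s)"
proof (rule continuous_on_matrix_vectorI)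
  show "continuous_on UNIV (\<lambda>t. (A t ** \<Phi> t s) *v b)" for b
    unfolding matrix_vector_mul_assoc[symmetric]
    by (intro bounded_bilinear.continuous_on[OF bounded_bilinear_matrix_vector] continuous_A continuous_Phi continuous_intros)
qed

text \<open>The product rule for \<Phi>(t, 0) I(t); the derivative of I contributes \<Phi>(t, 0)
  \<Phi>(0, t) f(t) = f(t).\<close>

lemma variation_of_constants:
  assumes I: "primitive I (\<lambda>s. \<Phi> 0 s *v f s)" and f: "f \<in> borel_measurable borel"
  shows "primitive (\<lambda>t. \<Phi> t 0 *v I t) (\<lambda>t. A t *v (\<Phi> t 0 *v I t) + f t)"
  using primitive_prod[OF bounded_bilinear_matrix_vector I Phi_matrix_derivative[of 0] continuous_A_Phi]
  by (simp add: matrix_vector_mul_assoc[symmetric] Phi_cocycle)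

lemma exists_Phi_primitive:
  assumes "f \<in> borel_measurable borel" "\<And>a b. set_integrable lborel {a..b} f"
  obtains I where "primitive I (\<lambda>s. \<Phi> 0 s *v f s)" "I 0 = v"
proof -
  have "\<exists>I. primitive I (\<lambda>s. \<Phi> 0 s *v f s)"
    using set_integrable_prod[OF bounded_bilinear_matrix_vector continuous_Phi_inverse[of 0] assms]
    by (intro exists_primitive)
  then obtain I where I: "primitive I (\<lambda>s. \<Phi> 0 s *v f s)" by blast
  have "primitive (\<lambda>_. v - I 0) (\<lambda>_. 0)" by (rule primitiveI_continuous) auto
  from primitive_add[OF I this] show ?thesis by (intro that[of "\<lambda>t. I t + (v - I 0)"]) simp_all
qed

text \<open>The equation is known only for t \<ge> 0. Continuing F to the left by the solution
  through \<open>F 0\<close> gives a function to which uniqueness on the whole line applies.\<close>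

lemma homogeneous_half_line:
  assumes F: "primitive F g" and g: "AE t in lborel. 0 \<le> t \<longrightarrow> g t = A t *v F t" and t: "0 \<le> t"
  shows "F t = \<Phi> t 0 *v F 0"
proof -
  have P0: "primitive (\<lambda>t. \<Phi> t 0 *v F 0) (\<lambda>t. A t *v (\<Phi> t 0 *v F 0))"
    by (intro primitiveI_continuous Phi_derivative bounded_bilinear.continuous_on[OF bounded_bilinear_matrix_vector]
        continuous_A continuous_Phi continuous_intros)
  define G where "G t = (if t \<le> 0 then \<Phi> t 0 *v F 0 else F t)" for t
  have G: "primitive G (\<lambda>t. if t \<le> 0 then A t *v (\<Phi> t 0 *v F 0) else g t)"
    unfolding G_def by (rule primitive_glue[OF P0 F]) simp
  have c: "continuous_on UNIV (\<lambda>t. A t *v G t)"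
    by (intro bounded_bilinear.continuous_on[OF bounded_bilinear_matrix_vector] continuous_A primitive_continuous[OF G])
  have "primitive G (\<lambda>t. A t *v G t)"
    by (rule primitive_AE_cong[OF G borel_measurable_continuous_onI[OF c]])
      (use g in \<open>eventually_elim, auto simp: G_def\<close>)
  then have "G t = \<Phi> t 0 *v G 0"
    by (intro solution_eq primitive_has_vector_derivative c)
  then show ?thesis using t by (cases "t = 0") (simp_all add: G_def)
qed

end

section \<open>Exponential kernels\<close>

lemma nn_integral_exp_abs:
  assumes "\<alpha> > 0"
  shows "(\<integral>\<^sup>+ t. ennreal (exp (- \<alpha> * \<bar>t\<bar>)) \<partial>lborel) < \<infinity>"
proof -
  have lim: "((\<lambda>t. - exp (- \<alpha> * t) / \<alpha>) \<longlongrightarrow> 0) at_top"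
  proof -
    have "filterlim (\<lambda>t. - \<alpha> * t) at_bot at_top"
      using assms by (intro filterlim_tendsto_neg_mult_at_bot[OF tendsto_const]) (auto simp: filterlim_ident)
    then have "((\<lambda>t. exp (- \<alpha> * t)) \<longlongrightarrow> 0) at_top"
      by (rule filterlim_compose[OF exp_at_bot])
    from tendsto_divide[OF tendsto_minus[OF this] tendsto_const[of \<alpha>]] show ?thesis using assms by simp
  qed
  have half: "(\<integral>\<^sup>+ t. ennreal (exp (- \<alpha> * t)) * indicator {0..} t \<partial>lborel) = ennreal (0 - (- exp (- \<alpha> * 0) / \<alpha>))"
    by (rule nn_integral_FTC_atLeast[OF _ _ _ lim])
      (use assms in \<open>auto intro!: derivative_eq_intros\<close>)
  have refl: "(\<integral>\<^sup>+ t. ennreal (exp (\<alpha> * t)) * indicator {..0} t \<partial>lborel)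
      = (\<integral>\<^sup>+ t. ennreal (exp (- \<alpha> * t)) * indicator {0..} t \<partial>lborel)"
    by (subst nn_integral_real_affine[where c = "-1" and t = 0])
      (auto intro!: nn_integral_cong simp: indicator_def)
  have "(\<integral>\<^sup>+ t. ennreal (exp (- \<alpha> * \<bar>t\<bar>)) \<partial>lborel) \<le>
      (\<integral>\<^sup>+ t. ennreal (exp (- \<alpha> * t)) * indicator {0..} t + ennreal (exp (\<alpha> * t)) * indicator {..0} t \<partial>lborel)"
    by (intro nn_integral_mono) (auto simp: indicator_def abs_if)
  also have "\<dots> = (\<integral>\<^sup>+ t. ennreal (exp (- \<alpha> * t)) * indicator {0..} t \<partial>lborel)
      + (\<integral>\<^sup>+ t. ennreal (exp (\<alpha> * t)) * indicator {..0} t \<partial>lborel)"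
    by (rule nn_integral_add) measurable
  also have "\<dots> < \<infinity>" unfolding refl half by simp
  finally show ?thesis .
qed

lemma integrable_exp_abs: "\<alpha> > 0 \<Longrightarrow> integrable lborel (\<lambda>t::real. exp (- \<alpha> * \<bar>t\<bar>))"
  unfolding integrable_iff_bounded using nn_integral_exp_abs by auto

lemma square_integrable_exp_abs:
  fixes \<alpha> :: real
  assumes "\<alpha> > 0"
  shows "square_integrable (\<lambda>t. exp (- \<alpha> * \<bar>t - s\<bar>))"
proof -
  have "(\<lambda>t. (norm (exp (- \<alpha> * \<bar>t - s\<bar>)))\<^sup>2) = (\<lambda>t. exp (- (2 * \<alpha>) * \<bar>- s + 1 * t\<bar>))"
    by (simp add: fun_eq_iff power2_eq_square exp_add[symmetric] algebra_simps)
  then show ?thesis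
    unfolding square_integrable_def
    using lborel_integrable_real_affine[OF integrable_exp_abs[of "2 * \<alpha>"], of 1 "- s"] assms by simp
qed

text \<open>With the kernel written as the square of exp(-\<alpha>|t - s|/2), Cauchy-Schwarz bounds
  m(t)^2 by E times the convolution of the kernel with f^2, where E is the integral of the kernel.
  Tonelli then contributes the second factor E.\<close>

lemma Young_inequality_exponential:
  fixes f :: "real \<Rightarrow> real"
  assumes \<alpha>: "\<alpha> > 0" and f: "square_integrable f" and f0: "\<And>t. 0 \<le> f t"
  defines "m \<equiv> \<lambda>t. LINT s|lborel. exp (- \<alpha> * \<bar>t - s\<bar>) * f s"
  shows "square_integrable m" "norm (abs_L2 m) \<le> (LINT t|lborel. exp (- \<alpha> * \<bar>t\<bar>)) * norm (abs_L2 f)"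
proof -
  note [measurable] = square_integrable_measurable[OF f]
  define E where "E = (LINT t|lborel. exp (- \<alpha> * \<bar>t\<bar>))"
  have E0: "E \<ge> 0" unfolding E_def by (intro integral_nonneg_AE) auto
  have E: "(\<integral>\<^sup>+ t. ennreal (exp (- \<alpha> * \<bar>t\<bar>)) \<partial>lborel) = ennreal E"
    unfolding E_def by (rule nn_integral_eq_integral[OF integrable_exp_abs[OF \<alpha>]]) auto
  have shift: "(\<integral>\<^sup>+ t. ennreal (exp (- \<alpha> * \<bar>t - s\<bar>)) \<partial>lborel) = ennreal E" for s
    unfolding E[symmetric] by (subst nn_integral_real_affine[where c = 1 and t = s]) auto
  have shift': "(\<integral>\<^sup>+ s. ennreal (exp (- \<alpha> * \<bar>t - s\<bar>)) \<partial>lborel) = ennreal E" for t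
    using shift[of t] by (simp add: abs_minus_commute)
  have int: "integrable lborel (\<lambda>s. exp (- \<alpha> * \<bar>t - s\<bar>) * f s)" for t
    using square_integrable_scaleR_fun[OF square_integrable_exp_abs[OF \<alpha>, of t] f]
    by (simp add: abs_minus_commute)
  have meas: "m \<in> borel_measurable borel"
    unfolding m_def by measurable
  have m0: "0 \<le> m t" for t unfolding m_def using f0 by (intro integral_nonneg_AE) auto
  have m_le: "ennreal ((norm (m t))\<^sup>2) \<le> ennreal E * (\<integral>\<^sup>+ s. ennreal (exp (- \<alpha> * \<bar>t - s\<bar>)) * ennreal ((norm (f s))\<^sup>2) \<partial>lborel)" for t
  proof -
    have "ennreal (m t) = (\<integral>\<^sup>+ s. ennreal (exp (- \<alpha> * \<bar>t - s\<bar>) * f s) \<partial>lborel)"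
      unfolding m_def using f0 by (intro nn_integral_eq_integral[symmetric] int) auto
    also have "\<dots> = (\<integral>\<^sup>+ s. ennreal (exp (- (\<alpha> / 2) * \<bar>t - s\<bar>)) * ennreal (exp (- (\<alpha> / 2) * \<bar>t - s\<bar>) * f s) \<partial>lborel)"
      using f0 by (intro nn_integral_cong) (simp add: ennreal_mult[symmetric] mult.assoc[symmetric] exp_add[symmetric])
    finally have "(ennreal (m t))\<^sup>2 \<le> (\<integral>\<^sup>+ s. (ennreal (exp (- (\<alpha> / 2) * \<bar>t - s\<bar>)))\<^sup>2 \<partial>lborel) *
        (\<integral>\<^sup>+ s. (ennreal (exp (- (\<alpha> / 2) * \<bar>t - s\<bar>) * f s))\<^sup>2 \<partial>lborel)"
      using Cauchy_Schwarz_nn_integral[of "\<lambda>s. ennreal (exp (- (\<alpha> / 2) * \<bar>t - s\<bar>))" lborel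
          "\<lambda>s. ennreal (exp (- (\<alpha> / 2) * \<bar>t - s\<bar>) * f s)"] by simp
    also have "(\<lambda>s. (ennreal (exp (- (\<alpha> / 2) * \<bar>t - s\<bar>)))\<^sup>2) = (\<lambda>s. ennreal (exp (- \<alpha> * \<bar>t - s\<bar>)))"
      by (simp add: fun_eq_iff power2_eq_square ennreal_mult[symmetric] exp_add[symmetric])
    also have "(\<lambda>s. (ennreal (exp (- (\<alpha> / 2) * \<bar>t - s\<bar>) * f s))\<^sup>2) = (\<lambda>s. ennreal (exp (- \<alpha> * \<bar>t - s\<bar>)) * ennreal ((norm (f s))\<^sup>2))"
    proof
      fix s
      have "(exp (- (\<alpha> / 2) * \<bar>t - s\<bar>) * f s)\<^sup>2 = exp (- \<alpha> * \<bar>t - s\<bar>) * (norm (f s))\<^sup>2"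
        by (simp add: power_mult_distrib exp_double[symmetric])
      then show "(ennreal (exp (- (\<alpha> / 2) * \<bar>t - s\<bar>) * f s))\<^sup>2 = ennreal (exp (- \<alpha> * \<bar>t - s\<bar>)) * ennreal ((norm (f s))\<^sup>2)"
        using f0[of s] by (simp add: ennreal_power ennreal_mult[symmetric])
    qed
    finally show ?thesis using m0[of t] shift'[of t] by (simp add: ennreal_power)
  qed
  have "(\<integral>\<^sup>+ t. ennreal ((norm (m t))\<^sup>2) \<partial>lborel) \<le>
      (\<integral>\<^sup>+ t. ennreal E * (\<integral>\<^sup>+ s. ennreal (exp (- \<alpha> * \<bar>t - s\<bar>)) * ennreal ((norm (f s))\<^sup>2) \<partial>lborel) \<partial>lborel)"
    by (intro nn_integral_mono m_le)
  also have "\<dots> = ennreal E * (\<integral>\<^sup>+ t. \<integral>\<^sup>+ s. ennreal (exp (- \<alpha> * \<bar>t - s\<bar>)) * ennreal ((norm (f s))\<^sup>2) \<partial>lborel \<partial>lborel)"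
    by (rule nn_integral_cmult) measurable
  also have "(\<integral>\<^sup>+ t. \<integral>\<^sup>+ s. ennreal (exp (- \<alpha> * \<bar>t - s\<bar>)) * ennreal ((norm (f s))\<^sup>2) \<partial>lborel \<partial>lborel)
      = (\<integral>\<^sup>+ s. \<integral>\<^sup>+ t. ennreal (exp (- \<alpha> * \<bar>t - s\<bar>)) * ennreal ((norm (f s))\<^sup>2) \<partial>lborel \<partial>lborel)"
    by (rule lborel_pair.Fubini'[symmetric]) measurable
  also have "\<dots> = (\<integral>\<^sup>+ s. ennreal E * ennreal ((norm (f s))\<^sup>2) \<partial>lborel)"
    by (intro nn_integral_cong, subst nn_integral_multc) (simp_all only: shift, measurable)
  also have "\<dots> = ennreal E * ennreal ((norm (abs_L2 f))\<^sup>2)"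
    by (subst nn_integral_cmult) (auto simp: nn_integral_abs_L2[OF f, symmetric])
  finally have "(\<integral>\<^sup>+ t. ennreal ((norm (m t))\<^sup>2) \<partial>lborel) \<le> ennreal ((E * norm (abs_L2 f))\<^sup>2)"
    using E0 by (simp add: ennreal_mult[symmetric] power_mult_distrib power2_eq_square mult_ac)
  from norm_abs_L2_le[OF meas _ this]
  show "square_integrable m" "norm (abs_L2 m) \<le> (LINT t|lborel. exp (- \<alpha> * \<bar>t\<bar>)) * norm (abs_L2 f)"
    using E0 by (auto simp: E_def)
qed

section \<open>Exponential dichotomies on a half-line\<close>

locale half_line_dichotomy = linear_system A \<Phi>
  for A :: "real \<Rightarrow> real^'n^'n" and \<Phi> :: "real \<Rightarrow> real \<Rightarrow> real^'n^'n" +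
  fixes P :: "real \<Rightarrow> real^'n^'n"
  assumes dichotomy: "exp_dichotomy \<Phi> {0..} P"
begin

lemma P_idem: "P 0 *v (P 0 *v x) = P 0 *v x"
  using dichotomy by (simp add: exp_dichotomy_def invariant_projector_def matrix_vector_mul_assoc)

lemma P_invariant: "0 \<le> t \<Longrightarrow> 0 \<le> s \<Longrightarrow> \<Phi> t s *v (P s *v x) = P t *v (\<Phi> t s *v x)"
  using dichotomy by (simp add: exp_dichotomy_def invariant_projector_def matrix_vector_mul_assoc)

text \<open>Invariance moves the projector past \<Phi>, so that the bounds speak of projected
  solutions. The absolute values make both exponentials instances of one convolution kernel.\<close>

lemma dichotomy_bounds:
  obtains K \<alpha> where "K \<ge> 1" "\<alpha> > 0"
    "\<And>t s x. 0 \<le> s \<Longrightarrow> s \<le> t \<Longrightarrow> norm (P t *v (\<Phi> t s *v x)) \<le> K * exp (- \<alpha> * \<bar>t - s\<bar>) * norm x"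
    "\<And>t s x. 0 \<le> s \<Longrightarrow> s \<le> t \<Longrightarrow> norm (\<Phi> s t *v x - P s *v (\<Phi> s t *v x)) \<le> K * exp (- \<alpha> * \<bar>s - t\<bar>) * norm x"
proof -
  obtain K \<alpha> where K: "K \<ge> 1" "\<alpha> > 0" and
    "\<forall>t\<in>{0..}. \<forall>s\<in>{0..}. s \<le> t \<longrightarrow> onorm ((*v) (\<Phi> t s ** P s)) \<le> K * exp (- \<alpha> * (t - s)) \<and>
        onorm ((*v) (\<Phi> s t ** (mat 1 - P t))) \<le> K * exp (- \<alpha> * (t - s))"
    using dichotomy unfolding exp_dichotomy_def by (elim exE conjE)
  then have b: "onorm ((*v) (\<Phi> t s ** P s)) \<le> K * exp (- \<alpha> * (t - s)) \<and>
        onorm ((*v) (\<Phi> s t ** (mat 1 - P t))) \<le> K * exp (- \<alpha> * (t - s))"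
    if "0 \<le> s" "s \<le> t" for t s using that by simp
  have o: "norm (M *v x) \<le> c * norm x" if "onorm ((*v) M) \<le> c" for M :: "real^'n^'n" and x c
    using onorm[OF matrix_vector_mul_bounded_linear, of M x] mult_right_mono[OF that norm_ge_zero[of x]] by linarith
  show ?thesis
  proof (rule that[OF K])
    fix t s :: real and x assume ts: "0 \<le> s" "s \<le> t"
    show "norm (P t *v (\<Phi> t s *v x)) \<le> K * exp (- \<alpha> * \<bar>t - s\<bar>) * norm x"
      using o[OF conjunct1[OF b[OF ts]], of x] ts
      by (simp add: matrix_vector_mul_assoc[symmetric] P_invariant)
    show "norm (\<Phi> s t *v x - P s *v (\<Phi> s t *v x)) \<le> K * exp (- \<alpha> * \<bar>s - t\<bar>) * norm x"
      using o[OF conjunct2[OF b[OF ts]], of x] ts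
      by (simp add: matrix_vector_mul_assoc[symmetric] matrix_vector_mult_diff_rdistrib
          matrix_vector_mult_diff_distrib P_invariant abs_minus_commute)
  qed
qed

text \<open>The bound for the complementary projector between 0 and t gives norm (x - P x) \<le> K
  norm (\<Phi>(t, 0) x), so a decaying solution starts with x = P x. The other bound makes the
  solutions starting in the range of P decay.\<close>

lemma stable_space_eq: "stable_space \<Phi> = range ((*v) (P 0))"
proof -
  obtain K \<alpha> where K: "K \<ge> 1" "\<alpha> > 0"
    "\<And>t s x. 0 \<le> s \<Longrightarrow> s \<le> t \<Longrightarrow> norm (P t *v (\<Phi> t s *v x)) \<le> K * exp (- \<alpha> * \<bar>t - s\<bar>) * norm x"
    "\<And>t s x. 0 \<le> s \<Longrightarrow> s \<le> t \<Longrightarrow> norm (\<Phi> s t *v x - P s *v (\<Phi> s t *v x)) \<le> K * exp (- \<alpha> * \<bar>s - t\<bar>) * norm x"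
    by (rule dichotomy_bounds) blast
  show ?thesis
  proof (intro equalityI subsetI)
    fix x assume "x \<in> stable_space \<Phi>"
    then have lim: "((\<lambda>t. \<Phi> t 0 *v x) \<longlongrightarrow> 0) at_top" by (simp add: stable_space_def)
    have "((\<lambda>t. K * norm (\<Phi> t 0 *v x)) \<longlongrightarrow> K * norm (0 :: real^'n)) at_top"
      by (intro tendsto_intros lim)
    moreover have "\<forall>\<^sub>F t in at_top. norm (x - P 0 *v x) \<le> K * norm (\<Phi> t 0 *v x)"
      using eventually_ge_at_top[of 0]
    proof eventually_elim
      case (elim t)
      have "norm (x - P 0 *v x) \<le> K * exp (- \<alpha> * \<bar>0 - t\<bar>) * norm (\<Phi> t 0 *v x)"
        using K(4)[of 0 t "\<Phi> t 0 *v x"] elim by (simp add: Phi_cocycle)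
      also have "\<dots> \<le> K * 1 * norm (\<Phi> t 0 *v x)"
        using K(1,2) elim by (intro mult_right_mono mult_left_mono) auto
      finally show ?case by simp
    qed
    ultimately have "norm (x - P 0 *v x) \<le> K * norm (0 :: real^'n)"
      by (rule tendsto_lowerbound) simp
    then show "x \<in> range ((*v) (P 0))" by (auto intro: range_eqI)
  next
    fix x assume "x \<in> range ((*v) (P 0))"
    then have x: "P 0 *v x = x" using P_idem by auto
    have lim: "((\<lambda>t. K * exp (- \<alpha> * t) * norm x) \<longlongrightarrow> 0) at_top"
    proof -
      have "filterlim (\<lambda>t. - \<alpha> * t) at_bot at_top"
        using K(2) by (intro filterlim_tendsto_neg_mult_at_bot[OF tendsto_const]) (auto simp: filterlim_ident)
      then have "((\<lambda>t. exp (- \<alpha> * t)) \<longlongrightarrow> 0) at_top"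
        by (rule filterlim_compose[OF exp_at_bot])
      from tendsto_mult[OF tendsto_mult[OF tendsto_const[of K] this] tendsto_const[of "norm x"]] show ?thesis by simp
    qed
    have "((\<lambda>t. \<Phi> t 0 *v x) \<longlongrightarrow> 0) at_top"
    proof (rule Lim_null_comparison[OF _ lim])
      show "\<forall>\<^sub>F t in at_top. norm (\<Phi> t 0 *v x) \<le> K * exp (- \<alpha> * t) * norm x"
        using eventually_ge_at_top[of 0]
      proof eventually_elim
        case (elim t)
        then show ?case using K(3)[of 0 t x] P_invariant[of t 0 x] by (simp add: x)
      qed
    qed
    then show "x \<in> stable_space \<Phi>" by (simp add: stable_space_def)
  qed
qed

text \<open>Otherwise the estimate norm (x - P x) \<le> K norm (\<Phi>(t, 0) x) keeps the solution
  away from 0 for all t \<ge> 0, and the integrals of its square over [0, n] are unbounded.\<close>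

lemma L2_solution_stable:
  assumes sq: "square_integrable (\<lambda>t. indicator {0..} t *\<^sub>R (\<Phi> t 0 *v x))"
  shows "P 0 *v x = x"
proof (rule ccontr)
  assume ne: "P 0 *v x \<noteq> x"
  obtain K \<alpha> where K: "K \<ge> 1" "\<alpha> > 0"
    "\<And>t s x. 0 \<le> s \<Longrightarrow> s \<le> t \<Longrightarrow> norm (P t *v (\<Phi> t s *v x)) \<le> K * exp (- \<alpha> * \<bar>t - s\<bar>) * norm x"
    "\<And>t s x. 0 \<le> s \<Longrightarrow> s \<le> t \<Longrightarrow> norm (\<Phi> s t *v x - P s *v (\<Phi> s t *v x)) \<le> K * exp (- \<alpha> * \<bar>s - t\<bar>) * norm x"
    by (rule dichotomy_bounds) blast
  define q where "q = (norm (x - P 0 *v x) / K)\<^sup>2"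
  have q: "q > 0" using ne K(1) by (simp add: q_def)
  have le: "q \<le> (norm (\<Phi> t 0 *v x))\<^sup>2" if "0 \<le> t" for t
  proof -
    have "norm (x - P 0 *v x) \<le> K * exp (- \<alpha> * \<bar>0 - t\<bar>) * norm (\<Phi> t 0 *v x)"
      using K(4)[of 0 t "\<Phi> t 0 *v x"] that by (simp add: Phi_cocycle)
    also have "\<dots> \<le> K * 1 * norm (\<Phi> t 0 *v x)"
      using K(1,2) that by (intro mult_right_mono mult_left_mono) auto
    finally have "norm (x - P 0 *v x) / K \<le> norm (\<Phi> t 0 *v x)" using K(1) by (simp add: field_simps)
    then show ?thesis unfolding q_def using K(1) by (intro power_mono) auto
  qed
  define B where "B = (LINT t|lborel. (norm (indicator {0..} t *\<^sub>R (\<Phi> t 0 *v x)))\<^sup>2)"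
  have "real n * q \<le> B" for n
  proof -
    have "(LINT t|lborel. q * indicator {0..real n} t) \<le> B"
      unfolding B_def
    proof (rule Bochner_Integration.integral_mono)
      show "integrable lborel (\<lambda>t. q * indicator {0..real n} t)"
        by (intro integrable_mult_right integrable_real_indicator) (auto simp: emeasure_lborel_Icc_eq)
      show "integrable lborel (\<lambda>t. (norm (indicator {0..} t *\<^sub>R (\<Phi> t 0 *v x)))\<^sup>2)"
        using sq by (simp add: square_integrable_def)
      show "q * indicator {0..real n} t \<le> (norm (indicator {0..} t *\<^sub>R (\<Phi> t 0 *v x)))\<^sup>2" for t
        using le[of t] by (auto simp: indicator_def)
    qed
    then show ?thesis by (simp add: mult.commute)
  qed
  moreover obtain n where "B / q < real n" using reals_Archimedean2 by blast
  ultimately show False using q by (metis divide_less_eq not_le)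
qed

end

section \<open>Bounded solvability on a half-line\<close>

lemma square_integrable_norm:
  assumes "square_integrable f"
  shows "square_integrable (\<lambda>t. norm (f t))" "norm (abs_L2 (\<lambda>t. norm (f t))) = norm (abs_L2 f)"
proof -
  note [measurable] = square_integrable_measurable[OF assms]
  show s: "square_integrable (\<lambda>t. norm (f t))"
    using assms by (simp add: square_integrable_def)
  have "(norm (abs_L2 (\<lambda>t. norm (f t))))\<^sup>2 = (norm (abs_L2 f))\<^sup>2"
    unfolding norm_abs_L2[OF s] norm_abs_L2[OF assms] by simp
  then show "norm (abs_L2 (\<lambda>t. norm (f t))) = norm (abs_L2 f)" by simp
qed

lemma square_integrable_reflect:
  fixes f :: "real \<Rightarrow> 'b::euclidean_space"
  assumes f: "square_integrable f"
  shows "square_integrable (\<lambda>t. f (- t))" "norm (abs_L2 (\<lambda>t. f (- t))) = norm (abs_L2 f)"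
proof -
  note [measurable] = square_integrable_measurable[OF f]
  have i: "integrable lborel (\<lambda>t. (norm (f (- t)))\<^sup>2)"
    using f lborel_integrable_real_affine[of "\<lambda>t. (norm (f t))\<^sup>2" "-1" 0] by (simp add: square_integrable_def)
  have "(\<lambda>t. f (- t)) \<in> borel_measurable lborel" by simp
  with i show s: "square_integrable (\<lambda>t. f (- t))" by (simp add: square_integrable_def)
  have "(norm (abs_L2 (\<lambda>t. f (- t))))\<^sup>2 = (norm (abs_L2 f))\<^sup>2"
    unfolding norm_abs_L2[OF s] norm_abs_L2[OF f]
    using lborel_integral_real_affine[of "-1" "\<lambda>t. (norm (f t))\<^sup>2" 0] by simp
  then show "norm (abs_L2 (\<lambda>t. f (- t))) = norm (abs_L2 f)" by simp
qed

lemma norm_abs_L2_add_le: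
  "square_integrable f \<Longrightarrow> square_integrable g \<Longrightarrow> norm (abs_L2 (\<lambda>t. f t + g t)) \<le> norm (abs_L2 f) + norm (abs_L2 g)"
  by (simp add: abs_L2_add[symmetric] norm_triangle_ineq)

lemma norm_abs_L2_scaleR:
  "square_integrable f \<Longrightarrow> norm (abs_L2 (\<lambda>t. c *\<^sub>R f t)) = \<bar>c\<bar> * norm (abs_L2 f)"
  by (simp add: abs_L2_scaleR[symmetric])

context half_line_dichotomy
begin

text \<open>Green's function of the dichotomy: v(t) is \<Phi>(t, 0) b plus the integral of \<Phi>(t,
  s) P(s) f(s) over [0, t] minus the integral of \<Phi>(t, s) (1 - P(s)) f(s) over (t, \<infinity>).
  Both kernels are bounded by K exp(-\<alpha>|t - s|), so v is dominated by a multiple of an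
  exponential plus a convolution, which lies in L^2.\<close>

lemma half_line_solution:
  "\<exists>C\<ge>0. \<forall>f b. square_integrable f \<longrightarrow> P 0 *v b = b \<longrightarrow>
    (\<exists>v. primitive v (\<lambda>t. A t *v v t + f t) \<and> P 0 *v v 0 = b \<and>
      norm (v 0) \<le> C * (norm (abs_L2 f) + norm b) \<and>
      square_integrable (\<lambda>t. indicator {0..} t *\<^sub>R v t) \<and>
      norm (abs_L2 (\<lambda>t. indicator {0..} t *\<^sub>R v t)) \<le> C * (norm (abs_L2 f) + norm b))"
proof -
  obtain K \<alpha> where K: "K \<ge> 1" "\<alpha> > 0"
    "\<And>t s x. 0 \<le> s \<Longrightarrow> s \<le> t \<Longrightarrow> norm (P t *v (\<Phi> t s *v x)) \<le> K * exp (- \<alpha> * \<bar>t - s\<bar>) * norm x"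
    "\<And>t s x. 0 \<le> s \<Longrightarrow> s \<le> t \<Longrightarrow> norm (\<Phi> s t *v x - P s *v (\<Phi> s t *v x)) \<le> K * exp (- \<alpha> * \<bar>s - t\<bar>) * norm x"
    by (rule dichotomy_bounds) blast
  define k0 where "k0 t = exp (- \<alpha> * \<bar>t - 0\<bar>)" for t :: real
  have k0: "square_integrable k0" unfolding k0_def[abs_def] by (rule square_integrable_exp_abs[OF K(2)])
  define E where "E = (LINT t|lborel. exp (- \<alpha> * \<bar>t\<bar>))"
  have E0: "E \<ge> 0" unfolding E_def by (intro integral_nonneg_AE) auto
  define N where "N = norm (abs_L2 k0)"
  have N0: "N \<ge> 0" by (simp add: N_def)
  \<comment> \<open>1 accounts for b in v(0), N for the convolution at 0 (Cauchy-Schwarz) and for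
    the L^2 norm of the exponential multiplying b, E for the L^2 norm of the convolution.\<close>
  define C where "C = K * (1 + N + E)"
  have C0: "C \<ge> 0" unfolding C_def using K(1) E0 N0 by (intro mult_nonneg_nonneg) auto
  have ex: "\<exists>v. primitive v (\<lambda>t. A t *v v t + f t) \<and> P 0 *v v 0 = b \<and>
      norm (v 0) \<le> C * (norm (abs_L2 f) + norm b) \<and>
      square_integrable (\<lambda>t. indicator {0..} t *\<^sub>R v t) \<and>
      norm (abs_L2 (\<lambda>t. indicator {0..} t *\<^sub>R v t)) \<le> C * (norm (abs_L2 f) + norm b)"
    if f: "square_integrable f" and b: "P 0 *v b = b" for f b
  proof -
    have fm [measurable]: "f \<in> borel_measurable borel" using f by (simp add: square_integrable_def)
    define g where "g s = \<Phi> 0 s *v f s" for s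
    have g: "set_integrable lborel {x..y} g" "g \<in> borel_measurable borel" for x y
      using set_integrable_prod[OF bounded_bilinear_matrix_vector continuous_Phi_inverse[of 0] fm
          square_integrable_set_integrable[OF f]] by (simp_all add: g_def[abs_def])
    note [measurable] = g(2)
    \<comment> \<open>\<open>p\<close> and \<open>r\<close> are the stable and the unstable part of
      the source, transported to time 0. \<open>r\<close> is integrable over [0, \<infinity>),
      \<open>p\<close> in general only locally.\<close>
    define p where "p s = P 0 *v g s" for s
    define r where "r s = g s - p s" for s
    have Pm: "(*v) (P 0) \<in> borel_measurable borel"
      by (intro borel_measurable_continuous_onI linear_continuous_on matrix_vector_mul_bounded_linear)
    have [measurable]: "p \<in> borel_measurable borel"
      unfolding p_def[abs_def] by (rule measurable_compose[OF g(2) Pm])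
    have [measurable]: "r \<in> borel_measurable borel" unfolding r_def[abs_def] by measurable
    have p: "set_integrable lborel {x..y} p" for x y
      using integrable_bounded_linear[OF matrix_vector_mul_bounded_linear g(1)[unfolded set_integrable_def]]
      by (simp add: set_integrable_def p_def matrix_vector_mult_scaleR)
    have Pr: "P 0 *v r s = 0" for s
      by (simp add: r_def p_def matrix_vector_mult_diff_distrib P_idem)
    define q where "q t s = exp (- \<alpha> * \<bar>t - s\<bar>) * norm (f s)" for t s
    have q: "integrable lborel (q t)" for t
      using square_integrable_scaleR_fun[OF square_integrable_exp_abs[OF K(2), of t] square_integrable_norm(1)[OF f]]
      by (simp add: q_def[abs_def] abs_minus_commute)
    have Phi_p: "norm (\<Phi> t 0 *v p s) \<le> K * q t s" if "0 \<le> s" "s \<le> t" for s t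
      using K(3)[OF that, of "f s"] that by (simp add: p_def g_def P_invariant Phi_cocycle q_def mult.assoc)
    have Phi_r: "norm (\<Phi> t 0 *v r s) \<le> K * q t s" if "0 \<le> t" "t \<le> s" for s t
      using K(4)[OF that, of "f s"] that
      by (simp add: r_def p_def g_def P_invariant Phi_cocycle q_def mult.assoc matrix_vector_mult_diff_distrib)
    have r: "set_integrable lborel {0..} r"
      unfolding set_integrable_def
    proof (rule Bochner_Integration.integrable_bound[OF integrable_mult_right[OF q[of 0], of K]])
      show "AE s in lborel. norm (indicator {0..} s *\<^sub>R r s) \<le> norm (K * q 0 s)"
        using Phi_r[of 0] K(1) by (intro AE_I2) (auto simp: indicator_def q_def)
    qed measurable
    define R0 where "R0 = (LINT s:{0..}|lborel. r s)"
    have PR0: "P 0 *v R0 = 0"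
    proof -
      have "P 0 *v R0 = (LINT s|lborel. P 0 *v (indicator {0..} s *\<^sub>R r s))"
        unfolding R0_def set_lebesgue_integral_def
        by (rule integral_bounded_linear[symmetric, OF matrix_vector_mul_bounded_linear r[unfolded set_integrable_def]])
      also have "\<dots> = 0" by (simp add: matrix_vector_mult_scaleR Pr)
      finally show ?thesis .
    qed
    \<comment> \<open>The unstable initial value - R0 turns the integral of \<open>r\<close> over
      [0, t] into minus the integral over its tail, which removes the growing part.\<close>
    obtain I where I: "primitive I g" "I 0 = b - R0"
      using exists_Phi_primitive[OF fm square_integrable_set_integrable[OF f], of "b - R0"]
      unfolding g_def[abs_def] by metis
    define v where "v t = \<Phi> t 0 *v I t" for t
    have v: "primitive v (\<lambda>t. A t *v v t + f t)"
      unfolding v_def using I(1) by (intro variation_of_constants fm) (simp add: g_def[abs_def])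
    have v0: "P 0 *v v 0 = b"
      by (simp add: v_def I(2) matrix_vector_mult_diff_distrib b PR0)
    define m where "m t = (LINT s|lborel. exp (- \<alpha> * \<bar>t - s\<bar>) * norm (f s))" for t
    have v_le: "norm (v t) \<le> K * (k0 t * norm b + m t)" if t: "0 \<le> t" for t
    proof -
      define z where "z s = indicator {0..t} s *\<^sub>R p s - indicator {t<..} s *\<^sub>R r s" for s
      have rt: "set_integrable lborel {0..t} r" "set_integrable lborel {t<..} r"
        using t by (auto intro: set_integrable_subset[OF r])
      have "R0 = (LINT s:{0..t} \<union> {t<..}|lborel. r s)"
        unfolding R0_def using t by (intro arg_cong[where f = "\<lambda>S. set_lebesgue_integral lborel S r"]) auto
      also have "\<dots> = (LINT s:{0..t}|lborel. r s) + (LINT s:{t<..}|lborel. r s)"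
        by (intro set_integral_Un rt) auto
      finally have R0: "R0 = (LINT s:{0..t}|lborel. r s) + (LINT s:{t<..}|lborel. r s)" .
      have iz: "integrable lborel z"
        unfolding z_def using p rt by (intro Bochner_Integration.integrable_diff) (simp_all add: set_integrable_def)
      have "(LINT s|lborel. z s) = (LINT s:{0..t}|lborel. p s) - (LINT s:{t<..}|lborel. r s)"
        unfolding z_def set_lebesgue_integral_def
        using p rt by (intro Bochner_Integration.integral_diff) (simp_all add: set_integrable_def)
      moreover have s: "(LINT s:{0..t}|lborel. p s) + (LINT s:{0..t}|lborel. r s) = (LINT s:{0..t}|lborel. g s)"
        by (subst set_integral_add(2)[symmetric, OF p rt(1)]) (simp add: r_def)
      moreover have "I t = (b - R0) + (LINT s:{0..t}|lborel. g s)"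
        using primitiveD(3)[OF I(1) t] unfolding I(2) by (metis add.commute diff_add_cancel)
      ultimately have "(LINT s|lborel. z s) = I t - b"
        unfolding R0 s[symmetric] by simp
      then have "v t = \<Phi> t 0 *v b + \<Phi> t 0 *v (LINT s|lborel. z s)"
        by (simp add: v_def matrix_vector_mult_diff_distrib)
      moreover have "\<Phi> t 0 *v (LINT s|lborel. z s) = (LINT s|lborel. \<Phi> t 0 *v z s)"
        by (rule integral_bounded_linear[symmetric, OF matrix_vector_mul_bounded_linear iz])
      moreover have "norm (LINT s|lborel. \<Phi> t 0 *v z s) \<le> (LINT s|lborel. K * q t s)"
      proof (rule Bochner_Integration.integral_norm_bound_integral)
        show "integrable lborel (\<lambda>s. \<Phi> t 0 *v z s)"
          by (rule integrable_bounded_linear[OF matrix_vector_mul_bounded_linear iz])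
        show "integrable lborel (\<lambda>s. K * q t s)" using q by simp
        fix s
        consider "s < 0" | "0 \<le> s" "s \<le> t" | "t < s" by linarith
        then show "norm (\<Phi> t 0 *v z s) \<le> K * q t s"
        proof cases
          case 1 then show ?thesis using t K(1) by (simp add: z_def q_def)
        next
          case 2 then show ?thesis using Phi_p by (simp add: z_def)
        next
          case 3
          then have "\<Phi> t 0 *v z s = - (\<Phi> t 0 *v r s)"
            using matrix_vector_mult_scaleR[of "\<Phi> t 0" "-1" "r s"] by (simp add: z_def)
          then show ?thesis using 3 t Phi_r[of t s] by simp
        qed
      qed
      moreover have "norm (\<Phi> t 0 *v b) \<le> K * (k0 t * norm b)"
        using K(3)[of 0 t b] P_invariant[of t 0 b] t by (simp add: b k0_def mult.assoc)
      ultimately have "norm (v t) \<le> K * (k0 t * norm b) + (LINT s|lborel. K * q t s)"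
        using norm_triangle_ineq[of "\<Phi> t 0 *v b" "\<Phi> t 0 *v (LINT s|lborel. z s)"] by simp
      then show ?thesis by (simp add: m_def q_def algebra_simps)
    qed
    note fn = square_integrable_norm[OF f]
    have m: "square_integrable m" "norm (abs_L2 m) \<le> E * norm (abs_L2 f)"
      using Young_inequality_exponential[OF K(2) fn(1)] fn(2) by (simp_all add: m_def[abs_def] E_def)
    have m0: "m 0 \<le> N * norm (abs_L2 f)"
    proof -
      have "m 0 = (LINT s|lborel. k0 s *\<^sub>R norm (f s))" by (simp add: m_def k0_def)
      also have "\<dots> \<le> norm (LINT s|lborel. k0 s *\<^sub>R norm (f s))" by simp
      also have "\<dots> \<le> norm (abs_L2 k0) * norm (abs_L2 (\<lambda>s. norm (f s)))"
        by (rule norm_integral_scaleR_le[OF k0 fn(1)])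
      finally show ?thesis by (simp add: N_def fn(2))
    qed
    have "K * m 0 \<le> K * (N * norm (abs_L2 f))"
      using K(1) by (intro mult_left_mono m0) auto
    then have "norm (v 0) \<le> K * (norm b + N * norm (abs_L2 f))"
      using v_le[of 0] by (simp add: k0_def algebra_simps)
    also have "\<dots> \<le> C * (norm (abs_L2 f) + norm b)"
    proof -
      have "norm b + N * norm (abs_L2 f) \<le> (1 + N + E) * (norm (abs_L2 f) + norm b)"
        using N0 E0 by (simp add: algebra_simps add_nonneg_nonneg)
      then show ?thesis using K(1) by (simp add: C_def mult.assoc)
    qed
    finally have n0: "norm (v 0) \<le> C * (norm (abs_L2 f) + norm b)" .
    define G where "G t = K *\<^sub>R (norm b *\<^sub>R k0 t + m t)" for t
    have kb: "square_integrable (\<lambda>t. norm b *\<^sub>R k0 t)" by (rule square_integrable_scaleR[OF k0])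
    have kbm: "square_integrable (\<lambda>t. norm b *\<^sub>R k0 t + m t)" by (rule square_integrable_add[OF kb m(1)])
    have G: "square_integrable G" unfolding G_def by (rule square_integrable_scaleR[OF kbm])
    have "norm (abs_L2 G) = K * norm (abs_L2 (\<lambda>t. norm b *\<^sub>R k0 t + m t))"
      unfolding G_def using K(1) by (subst norm_abs_L2_scaleR[OF kbm]) simp
    also have "\<dots> \<le> K * (norm b * N + E * norm (abs_L2 f))"
      using norm_abs_L2_add_le[OF kb m(1)] m(2) K(1) unfolding norm_abs_L2_scaleR[OF k0]
      by (intro mult_left_mono) (auto simp: N_def)
    also have "\<dots> \<le> C * (norm (abs_L2 f) + norm b)"
    proof -
      have "norm b * N + E * norm (abs_L2 f) \<le> (1 + N + E) * (norm (abs_L2 f) + norm b)"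
        using N0 E0 by (simp add: algebra_simps add_nonneg_nonneg)
      then show ?thesis using K(1) by (simp add: C_def mult.assoc)
    qed
    finally have nG: "norm (abs_L2 G) \<le> C * (norm (abs_L2 f) + norm b)" .
    have [measurable]: "v \<in> borel_measurable borel"
      by (rule borel_measurable_continuous_onI[OF primitive_continuous[OF v]])
    have vm: "(\<lambda>t. indicator {0..} t *\<^sub>R v t) \<in> borel_measurable borel" by measurable
    have "norm (indicator {0..} t *\<^sub>R v t) \<le> norm (G t)" for t
    proof (cases "0 \<le> t")
      case True
      then show ?thesis using v_le[of t] by (simp add: G_def mult.commute)
    qed simp
    from norm_abs_L2_mono[OF vm G this]
    show ?thesis using v v0 n0 nG by (intro exI[of _ v]) auto
  qed
  show ?thesis using C0 ex by (intro exI[of _ C] conjI allI impI)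
qed

end

section \<open>Time reversal\<close>

lemma (in linear_system) linear_system_reverse:
  "linear_system (\<lambda>t. - A (- t)) (\<lambda>t s. \<Phi> (- t) (- s))"
proof
  show "continuous_on UNIV (\<lambda>t. - A (- t))"
    by (intro continuous_intros continuous_on_compose2[OF continuous_A]) auto
  show "bounded (range (\<lambda>t. - A (- t)))" using bounded_A by (auto simp: bounded_iff)
  have "((\<lambda>r. \<Phi> (- r) (- s)) has_vector_derivative - A (- t) ** \<Phi> (- t) (- s)) (at t)" for t s
  proof -
    have "(uminus has_vector_derivative - 1) (at t)"
      by (auto intro!: derivative_eq_intros simp: has_real_derivative_iff_has_vector_derivative[symmetric])
    from vector_diff_chain_at[OF this Phi_matrix_derivative[of "- s" "- t"]]
    have "((\<lambda>r. \<Phi> (- r) (- s)) has_vector_derivative - (A (- t) ** \<Phi> (- t) (- s))) (at t)"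
      by (simp add: o_def)
    moreover have "- (A (- t) ** \<Phi> (- t) (- s)) = - A (- t) ** \<Phi> (- t) (- s)"
      by (simp add: vec_eq_iff matrix_matrix_mult_def sum_negf)
    ultimately show ?thesis by simp
  qed
  then show "transition_matrix (\<lambda>t. - A (- t)) (\<lambda>t s. \<Phi> (- t) (- s))"
    using transition unfolding transition_matrix_def by simp
qed

text \<open>Reversing time exchanges the two estimates: the backward decay on the range of 1 - P
  becomes forward decay, so the complementary projector takes the role of P.\<close>

lemma (in linear_system) exp_dichotomy_reverse:
  assumes "exp_dichotomy \<Phi> {..0} P"
  shows "exp_dichotomy (\<lambda>t s. \<Phi> (- t) (- s)) {0..} (\<lambda>t. mat 1 - P (- t))"
proof -
  have idem: "P t *v (P t *v x) = P t *v x" if "t \<le> 0" for t x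
    using assms that by (simp add: exp_dichotomy_def invariant_projector_def matrix_vector_mul_assoc)
  have inv: "\<Phi> t s *v (P s *v x) = P t *v (\<Phi> t s *v x)" if "t \<le> 0" "s \<le> 0" for t s x
    using assms that by (simp add: exp_dichotomy_def invariant_projector_def matrix_vector_mul_assoc)
  obtain K \<alpha> where K: "K \<ge> 1" "\<alpha> > 0" and
    b: "\<forall>t\<in>{..0}. \<forall>s\<in>{..0}. s \<le> t \<longrightarrow> onorm ((*v) (\<Phi> t s ** P s)) \<le> K * exp (- \<alpha> * (t - s)) \<and>
        onorm ((*v) (\<Phi> s t ** (mat 1 - P t))) \<le> K * exp (- \<alpha> * (t - s))"
    using assms unfolding exp_dichotomy_def by (elim exE conjE)
  have "invariant_projector (\<lambda>t s. \<Phi> (- t) (- s)) {0..} (\<lambda>t. mat 1 - P (- t))"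
    unfolding invariant_projector_def
    by (auto simp: matrix_eq matrix_vector_mul_assoc[symmetric] matrix_vector_mult_diff_rdistrib
        matrix_vector_mult_diff_distrib idem inv)
  moreover have "onorm ((*v) (\<Phi> (- t) (- s) ** (mat 1 - P (- s)))) \<le> K * exp (- \<alpha> * (t - s)) \<and>
      onorm ((*v) (\<Phi> (- s) (- t) ** (mat 1 - (mat 1 - P (- t))))) \<le> K * exp (- \<alpha> * (t - s))"
    if "0 \<le> s" "s \<le> t" for t s
    using b[rule_format, of "- s" "- t"] that by simp
  ultimately show ?thesis using K unfolding exp_dichotomy_def by auto
qed

lemma unstable_space_reverse: "unstable_space \<Phi> = stable_space (\<lambda>t s. \<Phi> (- t) (- s))"
  unfolding unstable_space_def stable_space_def by (simp add: filterlim_at_bot_mirror)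

section \<open>The boundary value problem on the line\<close>

text \<open>A function \<open>e\<close> in \<open>H\<^sup>1\<close> with \<open>e(0) = 1\<close>: adding \<open>1\<^bsub>[0, \<infinity>)\<^esub> e c\<close> produces the jump \<open>c\<close> at 0.\<close>

definition e_fun :: "real \<Rightarrow> real" where "e_fun t = (if t \<le> 0 then exp t else exp (- t))"
definition e_deriv :: "real \<Rightarrow> real" where "e_deriv t = (if t \<le> 0 then exp t else - exp (- t))"

lemma e_fun_0 [simp]: "e_fun 0 = 1"
  by (simp add: e_fun_def)

lemma primitive_e: "primitive e_fun e_deriv"
  unfolding e_fun_def[abs_def] e_deriv_def[abs_def]
proof (rule primitive_glue)
  show "primitive exp (exp :: real \<Rightarrow> real)"
    by (rule primitiveI_continuous)
      (auto intro!: derivative_eq_intros continuous_intros simp: has_real_derivative_iff_has_vector_derivative[symmetric])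
  show "primitive (\<lambda>t. exp (- t)) (\<lambda>t. - exp (- t) :: real)"
    by (rule primitiveI_continuous)
      (auto intro!: derivative_eq_intros continuous_intros simp: has_real_derivative_iff_has_vector_derivative[symmetric])
qed simp

lemma square_integrable_e: "square_integrable e_fun" "square_integrable e_deriv"
proof -
  have s: "square_integrable (\<lambda>t. exp (- 1 * \<bar>t - 0\<bar>) :: real)" by (rule square_integrable_exp_abs) simp
  have [measurable]: "e_fun \<in> borel_measurable borel" "e_deriv \<in> borel_measurable borel"
    unfolding e_fun_def[abs_def] e_deriv_def[abs_def] by measurable
  show "square_integrable e_fun" "square_integrable e_deriv"
    by (rule norm_abs_L2_mono(1)[OF _ s]; auto simp: e_fun_def e_deriv_def)+
qed

section \<open>Functions with a jump at 0 and the boundary operator\<close>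

definition jump_lift :: "'b::euclidean_space \<Rightarrow> 'b H1" where
  "jump_lift c = (SOME x. represents x (\<lambda>t. e_fun t *\<^sub>R c) (\<lambda>t. e_deriv t *\<^sub>R c))"

lemma square_integrable_scaleR_const:
  assumes "square_integrable (\<phi> :: real \<Rightarrow> real)"
  shows "square_integrable (\<lambda>t. \<phi> t *\<^sub>R c)"
    and "norm (abs_L2 (\<lambda>t. \<phi> t *\<^sub>R c)) \<le> norm c * norm (abs_L2 \<phi>)"
proof -
  note [measurable] = square_integrable_measurable[OF assms]
  have m: "(\<lambda>t. \<phi> t *\<^sub>R c) \<in> borel_measurable borel" by measurable
  have le: "norm (\<phi> t *\<^sub>R c) \<le> norm (norm c *\<^sub>R \<phi> t)" for t by (simp add: mult.commute)
  from norm_abs_L2_mono[OF m square_integrable_scaleR[OF assms] le] norm_abs_L2_scaleR[OF assms, of "norm c"]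
  show "square_integrable (\<lambda>t. \<phi> t *\<^sub>R c)" "norm (abs_L2 (\<lambda>t. \<phi> t *\<^sub>R c)) \<le> norm c * norm (abs_L2 \<phi>)"
    by simp_all
qed

lemma represents_jump_lift: "represents (jump_lift c) (\<lambda>t. e_fun t *\<^sub>R c) (\<lambda>t. e_deriv t *\<^sub>R c)"
proof -
  obtain x where "represents x (\<lambda>t. e_fun t *\<^sub>R c) (\<lambda>t. e_deriv t *\<^sub>R c)"
    by (rule H1_from_primitive[OF primitive_bounded_linear[OF bounded_linear_scaleR_left primitive_e]
        square_integrable_scaleR_const(1)[OF square_integrable_e(1)]
        square_integrable_scaleR_const(1)[OF square_integrable_e(2)]])
  then show ?thesis unfolding jump_lift_def by (rule someI)
qed

lemma represents_unique: "represents x F g \<Longrightarrow> represents y F g \<Longrightarrow> x = y"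
  by (auto simp: represents_def intro: H1_eqI)

lemma bounded_linear_jump_lift: "bounded_linear (jump_lift :: 'b::euclidean_space \<Rightarrow> 'b H1)"
proof -
  have "jump_lift (c + d) = jump_lift c + jump_lift d" for c d :: 'b
    using represents_add[OF represents_jump_lift represents_jump_lift, of c d] represents_jump_lift[of "c + d"]
    by (intro represents_unique[of _ "\<lambda>t. e_fun t *\<^sub>R (c + d)"]) (simp_all add: scaleR_add_right)
  moreover have "jump_lift (r *\<^sub>R c) = r *\<^sub>R jump_lift c" for r and c :: 'b
    using represents_scaleR[OF represents_jump_lift, of r c] represents_jump_lift[of "r *\<^sub>R c"]
    by (intro represents_unique[of _ "\<lambda>t. e_fun t *\<^sub>R (r *\<^sub>R c)"]) (simp_all add: mult.commute)
  ultimately have "linear (jump_lift :: 'b \<Rightarrow> 'b H1)" by (simp add: linear_iff)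
  then show ?thesis by (simp add: linear_conv_bounded_linear)
qed

text \<open>Written as multiplication by a matrix function, so that it inherits linearity and
  boundedness from \<open>L2_mult\<close>.\<close>

definition cut_off :: "(real^'n) L2 \<Rightarrow> (real^'n) L2" where
  "cut_off = L2_mult (\<lambda>t. indicator {0..} t *\<^sub>R mat 1)"

lemma bounded_linear_cut_off: "bounded_linear cut_off"
  unfolding cut_off_def by (rule bounded_linear_L2_mult)

lemma cut_off_abs:
  assumes "square_integrable f"
  shows "cut_off (abs_L2 f) = abs_L2 (\<lambda>t. indicator {0..} t *\<^sub>R f t)"
    and "square_integrable (\<lambda>t. indicator {0..} t *\<^sub>R f t)"
proof -
  have "range (\<lambda>t::real. indicator {0..} t *\<^sub>R (mat 1 :: real^'n^'n)) \<subseteq> {0, mat 1}"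
    by (auto simp: indicator_def)
  then have b: "bounded (range (\<lambda>t::real. indicator {0..} t *\<^sub>R (mat 1 :: real^'n^'n)))"
    by (rule bounded_subset[rotated]) simp
  have m: "(\<lambda>t::real. indicator {0..} t *\<^sub>R (mat 1 :: real^'n^'n)) \<in> borel_measurable borel" by measurable
  have e: "(\<lambda>t. (indicator {0..} t *\<^sub>R mat 1) *v f t) = (\<lambda>t. indicator {0..} t *\<^sub>R f t)"
    by (simp add: fun_eq_iff scaleR_matrix_vector_assoc[symmetric])
  show "cut_off (abs_L2 f) = abs_L2 (\<lambda>t. indicator {0..} t *\<^sub>R f t)"
    "square_integrable (\<lambda>t. indicator {0..} t *\<^sub>R f t)"
    using L2_mult_abs[OF b m assms] unfolding e cut_off_def by simp_all
qed

text \<open>For w = x + 1_[0,\<infinity>) e c the source on the two half-lines is L x +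
  1_[0,\<infinity>) L(e c), and e(0) = 1 gives w(0-) = x(0) and w(0+) = x(0) + c. The truncated
  function is not in H^1 for c \<noteq> 0, so the cut-off comes after the differential
  operator.\<close>

definition boundary_op :: "(real \<Rightarrow> real^'n^'n) \<Rightarrow> (real^'n^'n) \<Rightarrow> (real^'n^'n) \<Rightarrow>
    (real^'n) H1 \<times> (real^'n) \<Rightarrow> (real^'n) L2 \<times> (real^'n) \<times> (real^'n)" where
  "boundary_op A Pm Pp w =
     (blinfun_apply (diff_op A) (fst w) + cut_off (blinfun_apply (diff_op A) (jump_lift (snd w))),
      H1_ev0 (fst w) - Pm *v H1_ev0 (fst w), Pp *v (H1_ev0 (fst w) + snd w))"

locale line_dichotomy = linear_system A \<Phi>
  for A :: "real \<Rightarrow> real^'n^'n" and \<Phi> :: "real \<Rightarrow> real \<Rightarrow> real^'n^'n" +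
  fixes P_plus P_minus :: "real \<Rightarrow> real^'n^'n"
  assumes dichotomy_plus: "exp_dichotomy \<Phi> {0..} P_plus"
    and dichotomy_minus: "exp_dichotomy \<Phi> {..0} P_minus"
begin

sublocale plus: half_line_dichotomy A \<Phi> P_plus
  by unfold_locales (rule dichotomy_plus)

text \<open>The left half-line is treated by reversing time. Solutions decaying at minus infinity
  then correspond to the range of 1 - P^-.\<close>

sublocale minus: half_line_dichotomy "\<lambda>t. - A (- t)" "\<lambda>t s. \<Phi> (- t) (- s)" "\<lambda>t. mat 1 - P_minus (- t)"
  using linear_system_reverse exp_dichotomy_reverse[OF dichotomy_minus]
  by (simp add: half_line_dichotomy_def half_line_dichotomy_axioms_def)

lemma minus_projector: "(mat 1 - P_minus (- 0)) *v x = x - P_minus 0 *v x"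
  by (simp add: matrix_vector_mult_diff_rdistrib)

lemma minus_idem: "P_minus 0 *v (P_minus 0 *v x) = P_minus 0 *v x"
  using dichotomy_minus by (simp add: exp_dichotomy_def invariant_projector_def matrix_vector_mul_assoc)

lemma A_measurable: "A \<in> borel_measurable borel"
  by (rule borel_measurable_continuous_onI[OF continuous_A])

lemma diff_op_abs:
  assumes "represents x X g"
  shows "blinfun_apply (diff_op A) x = abs_L2 (\<lambda>t. g t - A t *v X t)"
    and "square_integrable (\<lambda>t. g t - A t *v X t)"
  using assms L2_mult_abs[OF bounded_A A_measurable, of X]
  by (simp_all add: diff_op_apply represents_def abs_L2_diff square_integrable_diff)

lemma boundary_op_abs:
  fixes c :: "real^'n"
  assumes x: "represents x X g"
  defines "h \<equiv> \<lambda>t. (g t - A t *v X t) + indicator {0..} t *\<^sub>R (e_deriv t *\<^sub>R c - A t *v (e_fun t *\<^sub>R c))"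
  shows "fst (boundary_op A Pm Pp (x, c)) = abs_L2 h" "square_integrable h"
proof -
  note 1 = diff_op_abs[OF x] and 2 = diff_op_abs[OF represents_jump_lift[of c]]
  show "fst (boundary_op A Pm Pp (x, c)) = abs_L2 h" "square_integrable h"
    using 1 2 cut_off_abs[OF 2(2)]
    by (simp_all add: boundary_op_def h_def abs_L2_add square_integrable_add)
qed

text \<open>X + e c solves the homogeneous equation for t \<ge> 0 and X does for t \<le> 0. Both are
  square integrable, so the dichotomies put their values at 0 into the stable and the unstable
  space.\<close>

lemma homogeneous_boundary:
  assumes x: "represents x X g" and 0: "fst (boundary_op A Pm Pp (x, c)) = 0"
  shows "P_minus 0 *v X 0 = 0" "P_plus 0 *v (X 0 + c) = X 0 + c"
    and "AE t in lborel. g t - A t *v X t + indicator {0..} t *\<^sub>R (e_deriv t *\<^sub>R c - A t *v (e_fun t *\<^sub>R c)) = 0"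
    and "0 \<le> t \<Longrightarrow> X t + e_fun t *\<^sub>R c = \<Phi> t 0 *v (X 0 + c)" "t \<le> 0 \<Longrightarrow> X t = \<Phi> t 0 *v X 0"
proof -
  have X: "primitive X g" "square_integrable X" "square_integrable g" using x by (simp_all add: represents_def)
  have [measurable]: "X \<in> borel_measurable borel" "g \<in> borel_measurable borel" "e_fun \<in> borel_measurable borel"
    "e_deriv \<in> borel_measurable borel"
    using X square_integrable_e by (simp_all add: square_integrable_def)
  have AX [measurable]: "(\<lambda>t. A t *v u t) \<in> borel_measurable borel" if "u \<in> borel_measurable borel" for u
    by (rule measurable_matrix_vector[OF A_measurable that])
  have "abs_L2 (\<lambda>t. (g t - A t *v X t) + indicator {0..} t *\<^sub>R (e_deriv t *\<^sub>R c - A t *v (e_fun t *\<^sub>R c))) = abs_L2 (\<lambda>_. 0)"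
    using boundary_op_abs(1)[OF x, of Pm Pp c] 0 by (simp add: zero_L2_def)
  then show ae: "AE t in lborel. g t - A t *v X t + indicator {0..} t *\<^sub>R (e_deriv t *\<^sub>R c - A t *v (e_fun t *\<^sub>R c)) = 0"
    by (subst (asm) abs_L2_eq_iff[OF boundary_op_abs(2)[OF x]]) auto
  define V where "V t = X t + e_fun t *\<^sub>R c" for t
  have V: "primitive V (\<lambda>t. g t + e_deriv t *\<^sub>R c)"
    unfolding V_def by (intro primitive_add X(1) primitive_bounded_linear[OF bounded_linear_scaleR_left primitive_e])
  have "AE t in lborel. 0 \<le> t \<longrightarrow> g t + e_deriv t *\<^sub>R c = A t *v V t"
    using ae by eventually_elim (auto simp: V_def algebra_simps matrix_vector_right_distrib)
  then have V_eq: "V t = \<Phi> t 0 *v V 0" if "0 \<le> t" for t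
    using homogeneous_half_line[OF V] that by blast
  then show "0 \<le> t \<Longrightarrow> X t + e_fun t *\<^sub>R c = \<Phi> t 0 *v (X 0 + c)" by (simp add: V_def)
  have "square_integrable V"
    unfolding V_def by (intro square_integrable_add X square_integrable_scaleR_const(1)[OF square_integrable_e(1)])
  then have "square_integrable (\<lambda>t. indicator {0..} t *\<^sub>R V t)" by (rule cut_off_abs(2))
  moreover have "(\<lambda>t. indicator {0..} t *\<^sub>R V t) = (\<lambda>t. indicator {0..} t *\<^sub>R (\<Phi> t 0 *v V 0))"
  proof
    show "indicator {0..} t *\<^sub>R V t = indicator {0..} t *\<^sub>R (\<Phi> t 0 *v V 0)" for t
      using V_eq[of t] by (cases "0 \<le> t") simp_all
  qed
  ultimately have "P_plus 0 *v V 0 = V 0" by (intro plus.L2_solution_stable) simp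
  then show "P_plus 0 *v (X 0 + c) = X 0 + c" by (simp add: V_def)
  have "AE t in lborel. t < 0 \<longrightarrow> g t = A t *v X t"
    using ae by eventually_elim auto
  from AE_borel_affine[OF _ _ this, of "-1" 0]
  have "AE t in lborel. 0 < t \<longrightarrow> g (- t) = A (- t) *v X (- t)" by simp
  \<comment> \<open>The cut-off includes t = 0, so the reflected equation is available for t > 0
    only; the missing point is a null set.\<close>
  moreover have "AE t in lborel. t \<noteq> (0::real)" by (rule AE_lborel_singleton)
  ultimately have "AE t in lborel. 0 \<le> t \<longrightarrow> - g (- t) = (- A (- t)) *v X (- t)"
  proof eventually_elim
    case (elim t)
    have "(- A (- t)) *v X (- t) = - (A (- t) *v X (- t))"
      by (simp add: matrix_vector_mult_def vec_eq_iff sum_negf)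
    then show ?case using elim by auto
  qed
  from minus.homogeneous_half_line[OF primitive_reflect[OF X(1)] this]
  have X_eq: "X (- t) = \<Phi> (- t) 0 *v X 0" if "0 \<le> t" for t using that by simp
  then show "t \<le> 0 \<Longrightarrow> X t = \<Phi> t 0 *v X 0" using X_eq[of "- t"] by simp
  have "square_integrable (\<lambda>t. indicator {0..} t *\<^sub>R X (- t))"
    by (intro cut_off_abs(2) square_integrable_reflect X)
  moreover have "(\<lambda>t. indicator {0..} t *\<^sub>R X (- t)) = (\<lambda>t. indicator {0..} t *\<^sub>R (\<Phi> (- t) (- 0) *v X 0))"
  proof
    show "indicator {0..} t *\<^sub>R X (- t) = indicator {0..} t *\<^sub>R (\<Phi> (- t) (- 0) *v X 0)" for t
      using X_eq[of t] by (cases "0 \<le> t") simp_all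
  qed
  ultimately have "(mat 1 - P_minus (- 0)) *v X 0 = X 0" by (intro minus.L2_solution_stable) simp
  then show "P_minus 0 *v X 0 = 0" unfolding minus_projector by simp
qed

text \<open>For zero source the projections in the boundary conditions act as the identity, so a and
  b are the one-sided values themselves.\<close>

lemma boundary_op_jump:
  assumes "boundary_op A (P_minus 0) (P_plus 0) (x, c) = (0, a, b)"
  shows "c = b - a"
proof -
  obtain X g where x: "represents x X g" by (rule H1_obtain_rep)
  have "fst (boundary_op A (P_minus 0) (P_plus 0) (x, c)) = 0" using assms by simp
  note h = homogeneous_boundary(1,2)[OF x this]
  have "a = X 0" "b = X 0 + c"
    using assms h by (auto simp: boundary_op_def H1_ev0_eq[OF x])
  then show ?thesis by simp
qed

text \<open>The jump and both one-sided values vanish, hence so does the homogeneous solution on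
  each half-line.\<close>

lemma boundary_op_eq_0:
  assumes "boundary_op A (P_minus 0) (P_plus 0) (x, c) = 0"
  shows "(x, c) = 0"
proof -
  obtain X g where x: "represents x X g" by (rule H1_obtain_rep)
  have *: "boundary_op A (P_minus 0) (P_plus 0) (x, c) = (0, 0, 0)" using assms by (simp add: zero_prod_def)
  have c: "c = 0" using boundary_op_jump[OF *] by simp
  have "fst (boundary_op A (P_minus 0) (P_plus 0) (x, c)) = 0" using * by simp
  note h = homogeneous_boundary[OF x this]
  have "X 0 = 0" using * h(1) by (simp add: boundary_op_def H1_ev0_eq[OF x])
  then have X: "X t = 0" for t using h(4)[of t] h(5)[of t] c by (cases "0 \<le> t") auto
  have "AE t in lborel. g t = 0" using h(3) by eventually_elim (simp add: c X)
  then have "abs_L2 g = abs_L2 (\<lambda>_. 0)"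
    using x by (subst abs_L2_eq_iff) (auto simp: represents_def)
  moreover have "X = (\<lambda>_. 0)" using X by blast
  moreover have "H1_fun (0 :: (real^'n) H1) = 0" "H1_deriv (0 :: (real^'n) H1) = 0"
    using linear_0[OF bounded_linear.linear[OF bounded_linear_H1_fun]]
      linear_0[OF bounded_linear.linear[OF bounded_linear_H1_deriv]] by auto
  ultimately have "x = 0"
    using x by (intro H1_eqI) (simp_all add: represents_def zero_L2_def)
  then show ?thesis using c by (simp add: zero_prod_def)
qed

text \<open>Solve on each half-line with the prescribed boundary value; the mismatch v 0 - u 0 of
  the two solutions is the jump c, and subtracting e c on the right makes the glued function
  continuous. The estimate is carried along because it becomes the lower bound for the
  operator.\<close>

lemma boundary_op_solvable:
  obtains D where "\<And>y a b. P_minus 0 *v a = 0 \<Longrightarrow> P_plus 0 *v b = b \<Longrightarrow>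
    \<exists>w. boundary_op A (P_minus 0) (P_plus 0) w = (y, a, b) \<and> norm w \<le> D * (norm y + norm a + norm b)"
proof -
  obtain C1 where C1: "C1 \<ge> 0" "\<forall>f b. square_integrable f \<longrightarrow> P_plus 0 *v b = b \<longrightarrow>
    (\<exists>v. primitive v (\<lambda>t. A t *v v t + f t) \<and> P_plus 0 *v v 0 = b \<and>
      norm (v 0) \<le> C1 * (norm (abs_L2 f) + norm b) \<and>
      square_integrable (\<lambda>t. indicator {0..} t *\<^sub>R v t) \<and>
      norm (abs_L2 (\<lambda>t. indicator {0..} t *\<^sub>R v t)) \<le> C1 * (norm (abs_L2 f) + norm b))"
    using plus.half_line_solution by (elim exE conjE)
  obtain C2 where C2: "C2 \<ge> 0" "\<forall>f b. square_integrable f \<longrightarrow> (mat 1 - P_minus (- 0)) *v b = b \<longrightarrow>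
    (\<exists>v. primitive v (\<lambda>t. - A (- t) *v v t + f t) \<and> (mat 1 - P_minus (- 0)) *v v 0 = b \<and>
      norm (v 0) \<le> C2 * (norm (abs_L2 f) + norm b) \<and>
      square_integrable (\<lambda>t. indicator {0..} t *\<^sub>R v t) \<and>
      norm (abs_L2 (\<lambda>t. indicator {0..} t *\<^sub>R v t)) \<le> C2 * (norm (abs_L2 f) + norm b))"
    using minus.half_line_solution by (elim exE conjE)
  obtain B where B: "B \<ge> 0" "\<And>t x. norm (A t *v x) \<le> B * norm x"
    by (rule bounded_range_matrix_vector[OF bounded_A]) blast
  define e1 where "e1 = norm (abs_L2 e_fun)"
  define e2 where "e2 = norm (abs_L2 e_deriv)"
  have e0: "e1 \<ge> 0" "e2 \<ge> 0" by (simp_all add: e1_def e2_def)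
  define C where "C = C1 + C2"
  have C: "C \<ge> 0" using C1 C2 by (simp add: C_def)
  \<comment> \<open>The sum of the bounds for X, for g and for c in terms of norm y + norm a + norm
    b. \<open>B\<close> bounds A, while \<open>e1\<close> and \<open>e2\<close> are the norms of e
    and of its derivative.\<close>
  define D where "D = C + (1 + B) * (C + C * e1) + 1 + C * e2 + B * C * e1"
  have main: "\<exists>w. boundary_op A (P_minus 0) (P_plus 0) w = (y, a, b) \<and> norm w \<le> D * (norm y + norm a + norm b)"
    if a: "P_minus 0 *v a = 0" and b: "P_plus 0 *v b = b" for y a b
  proof -
    define S where "S = norm y + norm a + norm b"
    have S0: "S \<ge> 0" by (simp add: S_def)
    obtain f where f: "square_integrable f" "y = abs_L2 f" by (rule L2_obtain_rep)
    have fm [measurable]: "f \<in> borel_measurable borel" using f by (simp add: square_integrable_def)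
    have [measurable]: "e_fun \<in> borel_measurable borel" "e_deriv \<in> borel_measurable borel"
      using square_integrable_e by (simp_all add: square_integrable_def)
    obtain v where v: "primitive v (\<lambda>t. A t *v v t + f t)" "P_plus 0 *v v 0 = b"
      "norm (v 0) \<le> C1 * (norm y + norm b)" "square_integrable (\<lambda>t. indicator {0..} t *\<^sub>R v t)"
      "norm (abs_L2 (\<lambda>t. indicator {0..} t *\<^sub>R v t)) \<le> C1 * (norm y + norm b)"
      using C1(2)[rule_format, OF f(1) b] unfolding f(2) by blast
    \<comment> \<open>Reversing time in w' = A w + f gives the coefficient - A(-t) and the source -
      f(-t).\<close>
    have fr: "square_integrable (\<lambda>t. - f (- t))" "norm (abs_L2 (\<lambda>t. - f (- t))) = norm y"
      using square_integrable_reflect[OF f(1)] norm_abs_L2_scaleR[OF square_integrable_reflect(1)[OF f(1)], of "-1"]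
      by (simp_all add: square_integrable_uminus f(2))
    have "(mat 1 - P_minus (- 0)) *v a = a" unfolding minus_projector by (simp add: a)
    from C2(2)[rule_format, OF fr(1) this] obtain u' where u': "primitive u' (\<lambda>t. - A (- t) *v u' t + - f (- t))"
      "(mat 1 - P_minus (- 0)) *v u' 0 = a"
      "norm (u' 0) \<le> C2 * (norm y + norm a)" "square_integrable (\<lambda>t. indicator {0..} t *\<^sub>R u' t)"
      "norm (abs_L2 (\<lambda>t. indicator {0..} t *\<^sub>R u' t)) \<le> C2 * (norm y + norm a)"
      unfolding fr(2) by blast
    define u where "u t = u' (- t)" for t
    have neg: "(- M) *v z = - (M *v z)" for M :: "real^'n^'n" and z
      by (simp add: matrix_vector_mult_def vec_eq_iff sum_negf)
    have u: "primitive u (\<lambda>t. A t *v u t + f t)"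
      using primitive_reflect[OF u'(1)] by (simp add: u_def[abs_def] neg add.commute)
    define c where "c = v 0 - u 0"
    define X where "X t = (if t \<le> 0 then u t else v t - e_fun t *\<^sub>R c)" for t
    define g where "g t = (if t \<le> 0 then A t *v u t + f t else A t *v v t + f t - e_deriv t *\<^sub>R c)" for t
    have Xg: "primitive X g"
      unfolding X_def[abs_def] g_def[abs_def]
      by (intro primitive_glue u primitive_diff v(1) primitive_bounded_linear[OF bounded_linear_scaleR_left primitive_e])
        (simp add: c_def)
    have [measurable]: "X \<in> borel_measurable borel" "g \<in> borel_measurable borel"
      using borel_measurable_continuous_onI[OF primitive_continuous[OF Xg]] Xg by (simp_all add: primitive_def)
    have bc: "C1 * (norm y + norm b) + C2 * (norm y + norm a) \<le> C * S"
    proof -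
      have "C1 * (norm y + norm b) \<le> C1 * S" "C2 * (norm y + norm a) \<le> C2 * S"
        using C1(1) C2(1) by (intro mult_left_mono; simp add: S_def)+
      then show ?thesis by (simp add: C_def algebra_simps)
    qed
    have nc: "norm c \<le> C * S"
      using norm_triangle_ineq4[of "v 0" "u 0"] v(3) u'(3) bc by (simp add: c_def u_def)
    let ?V = "\<lambda>t. norm (indicator {0..} t *\<^sub>R v t)"
    let ?U = "\<lambda>t. norm (indicator {0..} (- t) *\<^sub>R u' (- t))"
    let ?E = "\<lambda>t. norm c *\<^sub>R e_fun t"
    note sV = square_integrable_norm[OF v(4)]
    note sU = square_integrable_norm[OF square_integrable_reflect(1)[OF u'(4)]]
    note sE = square_integrable_scaleR[OF square_integrable_e(1), of "norm c"]
    note sVU = square_integrable_add[OF sV(1) sU(1)]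
    note sG = square_integrable_add[OF sVU sE]
    have XG: "norm (X t) \<le> norm (?V t + ?U t + ?E t)" for t
    proof -
      have e: "0 \<le> e_fun t" by (simp add: e_fun_def)
      show ?thesis
      proof (cases "t \<le> 0")
        case True
        then have "norm (X t) \<le> ?V t + ?U t + ?E t" using e by (simp add: X_def u_def)
        then show ?thesis by simp
      next
        case False
        then have "norm (X t) \<le> ?V t + ?U t + ?E t"
          using norm_triangle_ineq4[of "v t" "e_fun t *\<^sub>R c"] e by (simp add: X_def mult.commute)
        then show ?thesis by simp
      qed
    qed
    have Xm: "X \<in> borel_measurable borel" by measurable
    have sX: "square_integrable X" by (rule norm_abs_L2_mono(1)[OF Xm sG XG])
    have "norm (abs_L2 X) \<le> norm (abs_L2 (\<lambda>t. ?V t + ?U t + ?E t))"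
      by (rule norm_abs_L2_mono(2)[OF Xm sG XG])
    also have "\<dots> \<le> norm (abs_L2 ?V) + norm (abs_L2 ?U) + norm (abs_L2 ?E)"
      using norm_abs_L2_add_le[OF sVU sE] norm_abs_L2_add_le[OF sV(1) sU(1)] by linarith
    also have "\<dots> \<le> C * S + (C * S) * e1"
    proof -
      have "norm (abs_L2 ?E) = norm c * e1"
        by (subst norm_abs_L2_scaleR[OF square_integrable_e(1)]) (simp add: e1_def)
      also have "\<dots> \<le> (C * S) * e1" by (intro mult_right_mono nc e0)
      finally show ?thesis
        using v(5) u'(5) bc square_integrable_reflect(2)[OF u'(4)] unfolding sV(2) sU(2) by linarith
    qed
    finally have nX: "norm (abs_L2 X) \<le> C * S + (C * S) * e1" .
    let ?X = "\<lambda>t. B *\<^sub>R norm (X t)"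
    let ?e = "\<lambda>t. norm c *\<^sub>R norm (e_deriv t)"
    let ?b = "\<lambda>t. (B * norm c) *\<^sub>R e_fun t"
    note tX = square_integrable_scaleR[OF square_integrable_norm(1)[OF sX], of B]
    note tf = square_integrable_norm[OF f(1)]
    note te = square_integrable_scaleR[OF square_integrable_norm(1)[OF square_integrable_e(2)], of "norm c"]
    note tb = square_integrable_scaleR[OF square_integrable_e(1), of "B * norm c"]
    note t1 = square_integrable_add[OF tX tf(1)]
    note t2 = square_integrable_add[OF t1 te]
    note t3 = square_integrable_add[OF t2 tb]
    have gG: "norm (g t) \<le> norm (?X t + norm (f t) + ?e t + ?b t)" for t
    proof -
      have e: "0 \<le> e_fun t" by (simp add: e_fun_def)
      have "norm (g t) \<le> B * norm (X t) + norm (f t) + norm c * norm (e_deriv t) + B * norm c * e_fun t"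
      proof (cases "t \<le> 0")
        case True
        have "norm (g t) \<le> norm (A t *v X t) + norm (f t)"
          using True norm_triangle_ineq[of "A t *v u t" "f t"] by (simp add: g_def X_def)
        moreover have "0 \<le> norm c * norm (e_deriv t)" "0 \<le> B * norm c * e_fun t"
          using B(1) e by simp_all
        ultimately show ?thesis using B(2)[of t "X t"] by linarith
      next
        case False
        have "g t = (A t *v X t + f t) - e_deriv t *\<^sub>R c + A t *v (e_fun t *\<^sub>R c)"
          using False by (simp add: g_def X_def matrix_vector_mult_diff_distrib)
        also have "norm \<dots> \<le> norm (A t *v X t) + norm (f t) + norm (e_deriv t *\<^sub>R c) + norm (A t *v (e_fun t *\<^sub>R c))"
          using norm_triangle_ineq[of "(A t *v X t + f t) - e_deriv t *\<^sub>R c" "A t *v (e_fun t *\<^sub>R c)"]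
            norm_triangle_ineq4[of "A t *v X t + f t" "e_deriv t *\<^sub>R c"] norm_triangle_ineq[of "A t *v X t" "f t"]
          by linarith
        also have "\<dots> \<le> B * norm (X t) + norm (f t) + norm c * norm (e_deriv t) + B * norm c * e_fun t"
          using B(2)[of t "X t"] B(2)[of t "e_fun t *\<^sub>R c"] e by (simp add: mult_ac)
        finally show ?thesis .
      qed
      then show ?thesis using B(1) e by simp
    qed
    have gm: "g \<in> borel_measurable borel" by measurable
    have sg: "square_integrable g" by (rule norm_abs_L2_mono(1)[OF gm t3 gG])
    have "norm (abs_L2 g) \<le> norm (abs_L2 (\<lambda>t. ?X t + norm (f t) + ?e t + ?b t))"
      by (rule norm_abs_L2_mono(2)[OF gm t3 gG])
    also have "\<dots> \<le> norm (abs_L2 ?X) + norm (abs_L2 (\<lambda>t. norm (f t))) + norm (abs_L2 ?e) + norm (abs_L2 ?b)"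
      using norm_abs_L2_add_le[OF t2 tb] norm_abs_L2_add_le[OF t1 te] norm_abs_L2_add_le[OF tX tf(1)] by linarith
    also have "\<dots> = B * norm (abs_L2 X) + norm y + norm c * e2 + (B * norm c) * e1"
      unfolding norm_abs_L2_scaleR[OF square_integrable_norm(1)[OF sX]] tf(2)
        norm_abs_L2_scaleR[OF square_integrable_norm(1)[OF square_integrable_e(2)]]
        norm_abs_L2_scaleR[OF square_integrable_e(1)] square_integrable_norm(2)[OF sX]
        square_integrable_norm(2)[OF square_integrable_e(2)]
      using B(1) by (simp add: f(2) e1_def e2_def)
    also have "\<dots> \<le> B * (C * S + (C * S) * e1) + S + (C * S) * e2 + (B * (C * S)) * e1"
      using B(1) nX nc e0 by (intro add_mono mult_left_mono mult_right_mono) (auto simp: S_def)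
    finally have ng: "norm (abs_L2 g) \<le> B * (C * S + (C * S) * e1) + S + (C * S) * e2 + (B * (C * S)) * e1" .
    obtain x where x: "represents x X g" by (rule H1_from_primitive[OF Xg sX sg])
    have "norm (x, c) \<le> norm x + norm c" by (rule norm_Pair_le)
    also have "\<dots> \<le> norm (abs_L2 X) + norm (abs_L2 g) + norm c"
      using represents_norm_le[OF x] by simp
    also have "\<dots> \<le> (C * S + (C * S) * e1) + (B * (C * S + (C * S) * e1) + S + (C * S) * e2 + (B * (C * S)) * e1) + C * S"
      by (intro add_mono nX ng nc)
    also have "\<dots> = D * S" by (simp add: D_def algebra_simps)
    finally have nw: "norm (x, c) \<le> D * S" .
    note h = boundary_op_abs[OF x, where c = c]
    \<comment> \<open>The identity may fail at t = 0, where the cut-off is 1 but g follows the left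
      branch.\<close>
    have "AE t in lborel. (g t - A t *v X t) + indicator {0..} t *\<^sub>R (e_deriv t *\<^sub>R c - A t *v (e_fun t *\<^sub>R c)) = f t"
      by (rule eventually_mono[OF AE_lborel_singleton[of "0::real"]])
        (auto simp: g_def X_def indicator_def matrix_vector_mult_diff_distrib)
    then have "fst (boundary_op A (P_minus 0) (P_plus 0) (x, c)) = y"
      unfolding h(1) f(2) by (subst abs_L2_eq_iff[OF h(2) f(1)])
    moreover have "u 0 - P_minus 0 *v u 0 = a" using u'(2) unfolding minus_projector by (simp add: u_def)
    moreover have "X 0 = u 0" by (simp add: X_def)
    ultimately have "boundary_op A (P_minus 0) (P_plus 0) (x, c) = (y, a, b)"
      using v(2) by (simp add: prod_eq_iff) (simp add: boundary_op_def H1_ev0_eq[OF x] c_def)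
    then show ?thesis using nw unfolding S_def by blast
  qed
  show ?thesis by (rule that[OF main])
qed

end

context line_dichotomy begin

lemma unstable_space_eq: "unstable_space \<Phi> = range (\<lambda>x. x - P_minus 0 *v x)"
  unfolding unstable_space_reverse minus.stable_space_eq minus_projector[abs_def] ..

lemma range_minus_iff: "a \<in> range (\<lambda>x. x - P_minus 0 *v x) \<longleftrightarrow> P_minus 0 *v a = 0"
proof
  show "a \<in> range (\<lambda>x. x - P_minus 0 *v x)" if "P_minus 0 *v a = 0"
    using that by (intro range_eqI[of _ _ a]) simp
qed (auto simp: matrix_vector_mult_diff_distrib minus_idem)

lemma range_plus_iff: "b \<in> range ((*v) (P_plus 0)) \<longleftrightarrow> P_plus 0 *v b = b"
  by (metis plus.P_idem rangeE rangeI)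

end

section \<open>The index bundle of the differential operators\<close>

text \<open>A combination of operators in which only \<open>diff_op A\<close> and the projections on
  R^d x R^d carry parameters, so continuity in operator norm reduces to theirs.\<close>

definition boundary_blinfun :: "(real \<Rightarrow> real^'n^'n) \<Rightarrow> (real^'n^'n) \<Rightarrow> (real^'n^'n) \<Rightarrow>
    ((real^'n) H1 \<times> (real^'n)) \<Rightarrow>\<^sub>L ((real^'n) L2 \<times> (real^'n) \<times> (real^'n))" where
  "boundary_blinfun A Pm Pp =
     (Blinfun (\<lambda>y. (y, 0)) o\<^sub>L ((diff_op A o\<^sub>L Blinfun fst)
       + (Blinfun cut_off o\<^sub>L (diff_op A o\<^sub>L Blinfun (\<lambda>w. jump_lift (snd w))))))
     + (Blinfun (\<lambda>z. (0, z)) o\<^sub>L (Blinfun (\<lambda>z. (fst z - Pm *v fst z, Pp *v snd z))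
       o\<^sub>L Blinfun (\<lambda>w. (H1_ev0 (fst w), H1_ev0 (fst w) + snd w))))"

lemma linear_boundary_projections:
  fixes Pm Pp :: "real^'n^'n"
  shows "linear (\<lambda>z. (fst z - Pm *v fst z, Pp *v snd z))"
  by (simp add: linear_iff matrix_vector_right_distrib matrix_vector_mult_scaleR scaleR_diff_right)

lemma boundary_blinfun_apply:
  fixes A :: "real \<Rightarrow> real^'n^'n"
  shows "blinfun_apply (boundary_blinfun A Pm Pp) w = boundary_op A Pm Pp w"
proof -
  have "bounded_linear (\<lambda>w :: (real^'n) H1 \<times> (real^'n). (H1_ev0 (fst w), H1_ev0 (fst w) + snd w))"
    by (intro bounded_linear_Pair bounded_linear_add bounded_linear_snd
        bounded_linear_compose[OF bounded_linear_H1_ev0 bounded_linear_fst])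
  moreover have "bounded_linear (\<lambda>w :: (real^'n) H1 \<times> (real^'n). jump_lift (snd w))"
    by (rule bounded_linear_compose[OF bounded_linear_jump_lift bounded_linear_snd])
  moreover have "bounded_linear (\<lambda>y :: (real^'n) L2. (y, 0 :: (real^'n) \<times> (real^'n)))"
      "bounded_linear (\<lambda>z :: (real^'n) \<times> (real^'n). (0 :: (real^'n) L2, z))"
    by (intro bounded_linear_Pair bounded_linear_ident bounded_linear_zero)+
  ultimately show ?thesis
    by (simp add: boundary_blinfun_def boundary_op_def blinfun.add_left bounded_linear_Blinfun_apply
        bounded_linear_cut_off bounded_linear_fst blinfun_apply_Blinfun_linear linear_boundary_projections)
qed

lemma continuous_boundary_blinfun:
  assumes A: "continuous_on UNIV (\<lambda>l. diff_op (A l))"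
    and Pm: "continuous_on UNIV Pm" and Pp: "continuous_on UNIV Pp"
  shows "continuous_on UNIV (\<lambda>l. boundary_blinfun (A l) (Pm l) (Pp l))"
proof -
  have "continuous_on UNIV (\<lambda>l. Blinfun (\<lambda>z. (fst z - Pm l *v fst z, Pp l *v snd z)))"
    by (rule continuous_on_Blinfun_family[OF linear_boundary_projections])
      (intro continuous_intros bounded_bilinear.continuous_on[OF bounded_bilinear_matrix_vector] Pm Pp)
  then show ?thesis
    unfolding boundary_blinfun_def
    by (intro continuous_on_add bounded_bilinear.continuous_on[OF bounded_bilinear_blinfun_compose]
        continuous_on_const A)
qed

lemma (in line_dichotomy) boundary_blinfun_properties:
  defines "N \<equiv> boundary_blinfun A (P_minus 0) (P_plus 0)"
  shows "fst (blinfun_apply N (x, 0)) = blinfun_apply (diff_op A) x"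
    and "\<exists>C. \<forall>w. norm w \<le> C * norm (blinfun_apply N w)"
    and "range (blinfun_apply N) = UNIV \<times> range (\<lambda>x. x - P_minus 0 *v x) \<times> range ((*v) (P_plus 0))"
    and "blinfun_apply N (x, c) = (0, a, b) \<Longrightarrow> c = b - a"
proof -
  have N: "blinfun_apply N w = boundary_op A (P_minus 0) (P_plus 0) w" for w
    by (simp add: N_def boundary_blinfun_apply)
  show "fst (blinfun_apply N (x, 0)) = blinfun_apply (diff_op A) x"
    by (simp add: N boundary_op_def linear_0[OF bounded_linear.linear[OF bounded_linear_jump_lift]]
        linear_0[OF bounded_linear.linear[OF bounded_linear_cut_off]])
  show "blinfun_apply N (x, c) = (0, a, b) \<Longrightarrow> c = b - a"
    unfolding N by (rule boundary_op_jump)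
  obtain D where D: "\<And>y a b. P_minus 0 *v a = 0 \<Longrightarrow> P_plus 0 *v b = b \<Longrightarrow>
    \<exists>w. boundary_op A (P_minus 0) (P_plus 0) w = (y, a, b) \<and> norm w \<le> D * (norm y + norm a + norm b)"
    by (rule boundary_op_solvable) blast
  have in_range: "P_minus 0 *v fst (snd (blinfun_apply N w)) = 0"
    "P_plus 0 *v snd (snd (blinfun_apply N w)) = snd (snd (blinfun_apply N w))" for w
    unfolding N boundary_op_def by (simp_all add: matrix_vector_mult_diff_distrib minus_idem plus.P_idem)
  show "\<exists>C. \<forall>w. norm w \<le> C * norm (blinfun_apply N w)"
  proof (intro exI allI)
    fix w
    obtain y a b where yab: "blinfun_apply N w = (y, a, b)" by (metis prod.collapse)
    \<comment> \<open>The estimate is known for some solution w' with the data of w; uniqueness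
      identifies it with w.\<close>
    obtain w' where w': "blinfun_apply N w' = (y, a, b)" "norm w' \<le> D * (norm y + norm a + norm b)"
      using D[of a b y] in_range[of w, unfolded yab] unfolding N by auto
    have "blinfun_apply N (w - w') = 0" using yab w' by (simp add: blinfun.diff_right)
    then have "w - w' = 0" 
      unfolding N by (rule boundary_op_eq_0[of "fst (w - w')" "snd (w - w')", unfolded prod.collapse])
    then have "norm w \<le> D * (norm y + norm a + norm b)" using w'(2) by simp
    also have "\<dots> \<le> \<bar>D\<bar> * (norm y + norm a + norm b)" by (intro mult_right_mono) auto
    also have "\<dots> \<le> \<bar>D\<bar> * (3 * norm (y, a, b))"
      using norm_fst_le[of y "(a, b)"] norm_snd_le[of "(a, b)" y] norm_fst_le[of a b] norm_snd_le[of b a]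
      by (intro mult_left_mono) auto
    finally show "norm w \<le> (\<bar>D\<bar> * 3) * norm (blinfun_apply N w)" by (simp add: yab)
  qed
  show "range (blinfun_apply N) = UNIV \<times> range (\<lambda>x. x - P_minus 0 *v x) \<times> range ((*v) (P_plus 0))"
  proof (intro equalityI subsetI)
    fix z assume "z \<in> range (blinfun_apply N)"
    then obtain w where "z = blinfun_apply N w" by blast
    then show "z \<in> UNIV \<times> range (\<lambda>x. x - P_minus 0 *v x) \<times> range ((*v) (P_plus 0))"
      by (simp add: mem_Times_iff N boundary_op_def)
  next
    fix z assume "z \<in> (UNIV :: (real^'n) L2 set) \<times> range (\<lambda>x. x - P_minus 0 *v x) \<times> range ((*v) (P_plus 0))"
    then have z: "P_minus 0 *v fst (snd z) = 0" "P_plus 0 *v snd (snd z) = snd (snd z)"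
      unfolding mem_Times_iff range_minus_iff range_plus_iff by simp_all
    obtain w where "boundary_op A (P_minus 0) (P_plus 0) w = z"
      using D[OF z, of "fst z"] by auto
    then show "z \<in> range (blinfun_apply N)" unfolding N[symmetric] by blast
  qed
qed

lemma exp_dichotomy_subset:
  assumes "exp_dichotomy \<Phi> I P" "J \<subseteq> I"
  shows "exp_dichotomy \<Phi> J P"
proof -
  obtain K \<alpha> where K: "K \<ge> 1" "\<alpha> > 0" "\<forall>t\<in>I. \<forall>s\<in>I. s \<le> t \<longrightarrow>
        onorm ((*v) (\<Phi> t s ** P s)) \<le> K * exp (- \<alpha> * (t - s)) \<and>
        onorm ((*v) (\<Phi> s t ** (mat 1 - P t))) \<le> K * exp (- \<alpha> * (t - s))"
    using assms(1) unfolding exp_dichotomy_def by (elim exE conjE)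
  have "invariant_projector \<Phi> J P"
    using assms unfolding exp_dichotomy_def invariant_projector_def by (meson subsetD)
  moreover have "\<forall>t\<in>J. \<forall>s\<in>J. s \<le> t \<longrightarrow>
        onorm ((*v) (\<Phi> t s ** P s)) \<le> K * exp (- \<alpha> * (t - s)) \<and>
        onorm ((*v) (\<Phi> s t ** (mat 1 - P t))) \<le> K * exp (- \<alpha> * (t - s))"
    using K(3) assms(2) by (meson subsetD)
  ultimately show ?thesis using K(1,2) unfolding exp_dichotomy_def by blast
qed

text \<open>\<open>L_map\<close> is the continuity in operator norm contained in L being a map of
  pairs; joint continuity of A controls it only locally uniformly in t. Both
  \<open>index_bundle\<close> and \<open>KO_class\<close> are empty outside their proper domain, so
  the second conjunct certifies that the equation is one between elements of
  \<open>KO\<close>.\<close>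

theorem theorem3p3:
  fixes A :: "'l::topological_space \<Rightarrow> real \<Rightarrow> real^'n^'n"
    and \<Phi> :: "'l \<Rightarrow> real \<Rightarrow> real \<Rightarrow> real^'n^'n"
    and P_plus P_minus :: "'l \<Rightarrow> real \<Rightarrow> real^'n^'n"
    and \<Lambda>\<^sub>0 :: "'l set"
  assumes compact: "compact (UNIV :: 'l set)"
    and connected: "connected (UNIV :: 'l set)"
    and A_continuous: "continuous_on UNIV (\<lambda>(l, t). A l t)"
    and A_bounded: "\<And>l. bounded (range (A l))"
    and A_uniform: "\<And>l. uniformly_continuous_on UNIV (A l)"
    and L_map: "continuous_on UNIV (\<lambda>l. diff_op (A l))"
    and transition: "\<And>l. transition_matrix (A l) (\<Phi> l)"
    and A1_plus: "\<And>l. exp_dichotomy (\<Phi> l) {0..} (P_plus l)"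
    and A1_minus: "\<And>l. exp_dichotomy (\<Phi> l) {..0} (P_minus l)"
    and A1_plus_continuous: "\<And>\<tau>. \<tau> \<ge> 0 \<Longrightarrow> continuous_on UNIV (\<lambda>l. P_plus l \<tau>)"
    and A1_minus_continuous: "\<And>\<tau>. \<tau> \<ge> 0 \<Longrightarrow> continuous_on UNIV (\<lambda>l. P_minus l (- \<tau>))"
    and A2_closed: "closed \<Lambda>\<^sub>0"
    and A2_nonempty: "\<Lambda>\<^sub>0 \<noteq> {}"
    and A2_dichotomy: "\<And>l. l \<in> \<Lambda>\<^sub>0 \<Longrightarrow> \<exists>P. exp_dichotomy (\<Phi> l) UNIV P"
  shows "index_bundle \<Lambda>\<^sub>0 (\<lambda>l. diff_op (A l)) =
           KO_class \<Lambda>\<^sub>0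
             (bundle_sum (\<lambda>l. unstable_space (\<Phi> l)) (\<lambda>l. stable_space (\<Phi> l)),
              product_bundle (UNIV :: (real^'n) set),
              \<lambda>l (u, v). u - v)
         \<and> index_bundle \<Lambda>\<^sub>0 (\<lambda>l. diff_op (A l)) \<in> KO \<Lambda>\<^sub>0"
proof -
  have sys: "linear_system (A l) (\<Phi> l)" for l
    by (intro linear_system.intro uniformly_continuous_imp_continuous A_uniform A_bounded transition)
  have line: "line_dichotomy (A l) (\<Phi> l) Q R" if "exp_dichotomy (\<Phi> l) {0..} Q" "exp_dichotomy (\<Phi> l) {..0} R" for l Q R
    using that by (intro line_dichotomy.intro line_dichotomy_axioms.intro sys)
  note L = line[OF A1_plus A1_minus]
  note N = line_dichotomy.boundary_blinfun_properties[OF L]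
  have Pm: "continuous_on UNIV (\<lambda>l. P_minus l 0)" and Pp: "continuous_on UNIV (\<lambda>l. P_plus l 0)"
    using A1_minus_continuous[of 0] A1_plus_continuous[of 0] by simp_all
  \<comment> \<open>Both spaces depend on \<Phi> alone, so any two dichotomies on a half-line have
    projectors with the same range at 0 (right) or the same kernel at 0 (left).\<close>
  have stable: "stable_space (\<Phi> l) = range ((*v) (Q 0))" "unstable_space (\<Phi> l) = range (\<lambda>x. x - R 0 *v x)"
    if "exp_dichotomy (\<Phi> l) {0..} Q" "exp_dichotomy (\<Phi> l) {..0} R" for l Q R
    using half_line_dichotomy.stable_space_eq[of "A l" "\<Phi> l" Q] sys that(1)
      line_dichotomy.unstable_space_eq[OF line[OF that]]
    by (simp_all add: half_line_dichotomy_def half_line_dichotomy_axioms_def)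
  interpret boundary_family "\<lambda>l. diff_op (A l)" "\<lambda>l. boundary_blinfun (A l) (P_minus l 0) (P_plus l 0)"
    "\<lambda>l x. x - P_minus l 0 *v x" "\<lambda>l. (*v) (P_plus l 0)" \<Lambda>\<^sub>0
  proof (rule boundary_family.intro)
    show "compact (UNIV :: 'l set)" "connected (UNIV :: 'l set)" "\<Lambda>\<^sub>0 \<noteq> {}"
      "continuous_on UNIV (\<lambda>l. diff_op (A l))" by fact+
    show "continuous_on UNIV (\<lambda>l. boundary_blinfun (A l) (P_minus l 0) (P_plus l 0))"
      by (rule continuous_boundary_blinfun[OF L_map Pm Pp])
    show "linear (\<lambda>x. x - P_minus l 0 *v x)" for l
      by (intro linear_compose_sub linear_ident matrix_vector_mul_linear)
    show "linear ((*v) (P_plus l 0))" for l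
      by (rule matrix_vector_mul_linear)
    show "u - P_minus l 0 *v u - P_minus l 0 *v (u - P_minus l 0 *v u) = u - P_minus l 0 *v u" for l u
      by (simp add: matrix_vector_mult_diff_distrib line_dichotomy.minus_idem[OF L])
    show "P_plus l 0 *v (P_plus l 0 *v u) = P_plus l 0 *v u" for l u
      using A1_plus[of l] by (simp add: exp_dichotomy_def invariant_projector_def matrix_vector_mul_assoc)
    show "continuous_on UNIV (\<lambda>l. u - P_minus l 0 *v u)" for u
      by (intro continuous_intros bounded_bilinear.continuous_on[OF bounded_bilinear_matrix_vector] Pm)
    show "continuous_on UNIV (\<lambda>l. P_plus l 0 *v u)" for u
      by (intro continuous_intros bounded_bilinear.continuous_on[OF bounded_bilinear_matrix_vector] Pp)
    show "fst (blinfun_apply (boundary_blinfun (A l) (P_minus l 0) (P_plus l 0)) (x, 0)) = blinfun_apply (diff_op (A l)) x" for l x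
      by (rule N)
    show "\<exists>C. \<forall>w. norm w \<le> C * norm (blinfun_apply (boundary_blinfun (A l) (P_minus l 0) (P_plus l 0)) w)" for l
      by (rule N)
    show "range (blinfun_apply (boundary_blinfun (A l) (P_minus l 0) (P_plus l 0))) =
        UNIV \<times> range (\<lambda>x. x - P_minus l 0 *v x) \<times> range ((*v) (P_plus l 0))" for l
      by (rule N)
    show "c = b - a" if "blinfun_apply (boundary_blinfun (A l) (P_minus l 0) (P_plus l 0)) (x, c) = (0, a, b)" for l x a b c
      using that by (rule N)
    fix l assume "l \<in> \<Lambda>\<^sub>0"
    then obtain P where "exp_dichotomy (\<Phi> l) UNIV P" using A2_dichotomy by blast
    then have P: "exp_dichotomy (\<Phi> l) {0..} P" "exp_dichotomy (\<Phi> l) {..0} P"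
      by (auto elim: exp_dichotomy_subset)
    \<comment> \<open>A dichotomy on the whole line need not restrict to the given projectors, but
      it has the same stable and unstable space. These are therefore the range and the kernel of the
      single projector \<open>P 0\<close>, hence complementary.\<close>
    have r: "range ((*v) (P_plus l 0)) = range ((*v) (P 0))"
      "range (\<lambda>x. x - P_minus l 0 *v x) = range (\<lambda>x. x - P 0 *v x)"
      using stable[OF P] stable[OF A1_plus A1_minus, of l] by simp_all
    have idem: "P 0 *v (P 0 *v x) = P 0 *v x" for x
      by (rule line_dichotomy.minus_idem[OF line[OF P]])
    show "range (\<lambda>x. x - P_minus l 0 *v x) \<inter> range ((*v) (P_plus l 0)) = {0}"
    proof (intro equalityI subsetI)
      fix x assume "x \<in> range (\<lambda>x. x - P_minus l 0 *v x) \<inter> range ((*v) (P_plus l 0))"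
      then obtain p q where pq: "x = p - P 0 *v p" "x = P 0 *v q" unfolding r by blast
      have "P 0 *v x = 0" unfolding pq(1) by (simp add: matrix_vector_mult_diff_distrib idem)
      moreover have "P 0 *v x = x" unfolding pq(2) by (rule idem)
      ultimately show "x \<in> {0}" by simp
    next
      fix x :: "real^'n" assume "x \<in> {0}"
      then show "x \<in> range (\<lambda>x. x - P_minus l 0 *v x) \<inter> range ((*v) (P_plus l 0))"
        by (auto intro: range_eqI[of _ _ 0])
    qed
    fix u :: "real^'n"
    have "u - P 0 *v u \<in> range (\<lambda>x. x - P_minus l 0 *v x)" "P 0 *v u \<in> range ((*v) (P_plus l 0))"
      unfolding r by auto
    then obtain a b where ab: "u - P 0 *v u = a - P_minus l 0 *v a" "P 0 *v u = P_plus l 0 *v b" by blast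
    have "u = (a - P_minus l 0 *v a) + P_plus l 0 *v b" unfolding ab[symmetric] by simp
    then show "\<exists>a b. u = a - P_minus l 0 *v a + P_plus l 0 *v b" by blast
  qed
  have "boundary_bundle = bundle_sum (\<lambda>l. unstable_space (\<Phi> l)) (\<lambda>l. stable_space (\<Phi> l))"
    using stable[OF A1_plus A1_minus] by simp
  then show ?thesis using index_bundle_boundary by simp
qed

end
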